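(* For any closed set $H\subset\mathbb R$ with $H\subset(h_c,+\infty)$ there exist $C>0$ and $\lambda>0$ such that for all integers $0\le a\le b\le n$ (with $n\in\mathbb N$) $$\mathbb E\left[\sup_{h\in H}\frac{\big|\mathsf{cov}_{n,h,\cdot}[X_a,X_b]\big|}{\min\{\mathsf E_{n,h,\cdot}[X_a],\mathsf E_{n,h,\cdot}[X_b]\}}\right]\le Ce^{-\lambda(b-a)}.$$
   Context: Notation: $\mathbb N=\{1,2,\ldots\}$, $\mathbb N_0=\{0\}\cup\mathbb N$. Renewal process: under a law $\mathsf P$ (expectation $\mathsf E$), $T_1,T_2,\ldots$ are i.i.d. $\mathbb N$-valued random variables with $p(t):=\mathsf P[T_1=t]=\ell(t)/t^{\alpha+1}>0$ for all $t\in\mathbb N$, where $\alpha\ge0$ and $\ell:[1,+\infty)\to[0,+\infty)$ is slowly varying at infinity. Set $S_0=0$, $S_i=T_1+\cdots+T_i$, $S=(S_i)_{i\in\mathbb N_0}$, and $X_a=\mathbf 1_{\{a\in S\}}$ for $a\in\mathbb N_0$. Disorder: $\Omega=\mathbb R^{\mathbb N_0}$ with its Borel $\sigma$-field carries a probability measure $\mathbb P$ (expectation $\mathbb E$) under which the coordinates of $\omega=(\omega_a)_{a\in\mathbb N_0}$ form a centered stationary Gaussian sequence with covariance function $\gamma(a)=\int_\Omega\omega_0\omega_a\,\mathbb P[d\omega]$, $a\in\mathbb N_0$, satisfying $\bar\gamma:=\sum_{a\in\mathbb N_0}|\gamma(a)|<+\infty$. Pinning model: for $n\in\mathbb N$,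 $h\in\mathbb R$, $\omega\in\Omega$, the Gibbs measure $\mathsf P_{n,h,\omega}$ is defined by $\frac{d\mathsf P_{n,h,\omega}}{d\mathsf P}=\frac{1}{Z_{n,h}(\omega)}e^{\sum_{a=1}^n(h+\omega_a)X_a}X_n$ with $Z_{n,h}(\omega)=\mathsf E\big[e^{\sum_{a=1}^n(h+\omega_a)X_a}X_n\big]$; $\mathsf E_{n,h,\omega}$ and $\mathsf{cov}_{n,h,\omega}$ denote expectation and covariance under $\mathsf P_{n,h,\omega}$. A dot in place of $\omega$ indicates the corresponding function of $\omega\in\Omega$. Free energy and critical point: $f(h)=\lim_{n\uparrow\infty}\mathbb E[\frac1n\log Z_{n,h}]$, which exists and is finite and non-negative for all $h\in\mathbb R$; $h_c=\inf\{h\in\mathbb R:f(h)>0\}$, and $-\infty<h_c\le0$. *)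

theory Defs
  imports "HOL-Probability.Probability"
begin

text \<open>Karamata's notion for functions on \<open>[1, \<infinity>)\<close>; measurability is part of it. As \<open>x / 0 = 0\<close>, the
  limits force \<open>l\<close> to be eventually nonzero.\<close>

definition slowly_varying :: "(real \<Rightarrow> real) \<Rightarrow> bool" where
  "slowly_varying l \<longleftrightarrow>
     l \<in> borel_measurable (restrict_space borel {1..}) \<and>
     (\<forall>c>0. ((\<lambda>x. l (c * x) / l x) \<longlongrightarrow> 1) at_top)"

text \<open>The inter-arrival times are \<open>T 1, T 2, \<dots>\<close>; the value \<open>T 0\<close> is never used.\<close>

locale renewal_process = prob_space M
  for M :: "'a measure" +
  fixes T :: "nat \<Rightarrow> 'a \<Rightarrow> nat" and \<alpha> :: real and l :: "real \<Rightarrow> real"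
  assumes indep: "indep_vars (\<lambda>_. count_space UNIV) T {1..}"
    and identically_distributed:
      "\<And>i. 1 \<le> i \<Longrightarrow> distr M (count_space UNIV) (T i) = distr M (count_space UNIV) (T 1)"
    and values_pos: "\<And>i x. 1 \<le> i \<Longrightarrow> x \<in> space M \<Longrightarrow> 1 \<le> T i x"
    and alpha_nonneg: "0 \<le> \<alpha>"
    and l_nonneg: "\<And>x. 1 \<le> x \<Longrightarrow> 0 \<le> l x"
    and l_slowly_varying: "slowly_varying l"
    and law: "\<And>t. 1 \<le> t \<Longrightarrow> prob {x \<in> space M. T 1 x = t} = l (real t) / real t powr (\<alpha> + 1)"
    and law_pos: "\<And>t. 1 \<le> t \<Longrightarrow> 0 < prob {x \<in> space M. T 1 x = t}"

definition renewal_time :: "(nat \<Rightarrow> 'a \<Rightarrow> nat) \<Rightarrow> nat \<Rightarrow> 'a \<Rightarrow> nat" where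
  "renewal_time T i x = (\<Sum>j=1..i. T j x)"

definition contact :: "(nat \<Rightarrow> 'a \<Rightarrow> nat) \<Rightarrow> nat \<Rightarrow> 'a \<Rightarrow> real" where
  "contact T a x = of_bool (a \<in> range (\<lambda>i. renewal_time T i x))"

text \<open>Normal laws on the real line, including the degenerate ones (variance zero).\<close>

definition gaussian_law :: "real measure \<Rightarrow> bool" where
  "gaussian_law \<mu> \<longleftrightarrow>
     (\<exists>m. \<mu> = return borel m) \<or> (\<exists>m s. 0 < s \<and> \<mu> = density lborel (normal_density m s))"

definition autocov :: "(nat \<Rightarrow> real) measure \<Rightarrow> nat \<Rightarrow> real" where
  "autocov P a = (\<integral>\<omega>. \<omega> 0 * \<omega> a \<partial>P)"

text \<open>The Borel sets of \<^typ>\<open>nat \<Rightarrow> real\<close> refer to the product topology. The coordinates are jointly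
  Gaussian: every finite linear combination of them is Gaussian.\<close>

locale gaussian_disorder = prob_space P
  for P :: "(nat \<Rightarrow> real) measure" +
  assumes sets_P: "sets P = sets borel"
    and gaussian: "\<And>n c. gaussian_law (distr P borel (\<lambda>\<omega>. \<Sum>a<n. c a * \<omega> a))"
    and centered: "\<And>a. expectation (\<lambda>\<omega>. \<omega> a) = 0"
    and stationary: "distr P borel (\<lambda>\<omega> a. \<omega> (Suc a)) = P"
    and autocov_summable: "summable (\<lambda>a. \<bar>autocov P a\<bar>)"

definition pinning_weight ::
    "(nat \<Rightarrow> 'a \<Rightarrow> nat) \<Rightarrow> nat \<Rightarrow> real \<Rightarrow> (nat \<Rightarrow> real) \<Rightarrow> 'a \<Rightarrow> real" where
  "pinning_weight T n h \<omega> x = exp (\<Sum>a=1..n. (h + \<omega> a) * contact T a x) * contact T n x"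

definition partition_function ::
    "'a measure \<Rightarrow> (nat \<Rightarrow> 'a \<Rightarrow> nat) \<Rightarrow> nat \<Rightarrow> real \<Rightarrow> (nat \<Rightarrow> real) \<Rightarrow> real" where
  "partition_function M T n h \<omega> = (\<integral>x. pinning_weight T n h \<omega> x \<partial>M)"

definition gibbs ::
    "'a measure \<Rightarrow> (nat \<Rightarrow> 'a \<Rightarrow> nat) \<Rightarrow> nat \<Rightarrow> real \<Rightarrow> (nat \<Rightarrow> real) \<Rightarrow> 'a measure" where
  "gibbs M T n h \<omega> =
     density M (\<lambda>x. ennreal (pinning_weight T n h \<omega> x / partition_function M T n h \<omega>))"

definition covariance :: "'a measure \<Rightarrow> ('a \<Rightarrow> real) \<Rightarrow> ('a \<Rightarrow> real) \<Rightarrow> real" where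
  "covariance N X Y = (\<integral>x. (X x - (\<integral>y. X y \<partial>N)) * (Y x - (\<integral>y. Y y \<partial>N)) \<partial>N)"

text \<open>For a renewal process and a Gaussian disorder as above, the limit defining the free energy
  exists in \<open>[0, \<infinity>)\<close>, and \<open>{h. f h > 0}\<close> is nonempty and bounded below, so neither \<^const>\<open>lim\<close> nor
  the real infimum takes an unspecified value.\<close>

definition free_energy ::
    "'a measure \<Rightarrow> (nat \<Rightarrow> 'a \<Rightarrow> nat) \<Rightarrow> (nat \<Rightarrow> real) measure \<Rightarrow> real \<Rightarrow> real" where
  "free_energy M T P h = lim (\<lambda>n. \<integral>\<omega>. 1 / real n * ln (partition_function M T n h \<omega>) \<partial>P)"

definition critical_point ::
    "'a measure \<Rightarrow> (nat \<Rightarrow> 'a \<Rightarrow> nat) \<Rightarrow> (nat \<Rightarrow> real) measure \<Rightarrow> real" where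
  "critical_point M T P = Inf {h. 0 < free_energy M T P h}"

text \<open>The absolute covariance divided by the smaller of the two means. The means are positive for
  \<open>a, b \<le> n\<close>, because every \<open>p(t)\<close> is; hence the division is a genuine one.\<close>

definition cov_ratio ::
    "'a measure \<Rightarrow> (nat \<Rightarrow> 'a \<Rightarrow> nat) \<Rightarrow> nat \<Rightarrow> real \<Rightarrow> (nat \<Rightarrow> real) \<Rightarrow> nat \<Rightarrow> nat \<Rightarrow> real" where
  "cov_ratio M T n h \<omega> a b =
     \<bar>covariance (gibbs M T n h \<omega>) (contact T a) (contact T b)\<bar> /
     min (\<integral>x. contact T a x \<partial>gibbs M T n h \<omega>) (\<integral>x. contact T b x \<partial>gibbs M T n h \<omega>)"

end

theory Submission
  imports Defs
begin

text \<open>The contacts in \<open>[0, n]\<close> form a random finite set whose Gibbs weight is a product over its gaps and points.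
  Take two independent copies \<open>A\<close> and \<open>B\<close>. Exchanging their parts to the right of a common point of \<open>[a, b]\<close> shows
  that the covariance only sees pairs without such a point, even after conditioning one copy on containing \<open>a\<close>
  (or \<open>b\<close>), which takes care of the denominator. Whenever a point of \<open>A\<close> lies in a short gap of \<open>B\<close> and its disorder
  is not too low, it can be inserted into \<open>B\<close> at bounded cost; hence avoiding pairs with \<open>k\<close> such points have
  probability at most \<open>(1 + c)\<^sup>-\<^sup>k\<close>. If there are few such points, then long gaps of \<open>A\<close> or \<open>B\<close> cover a positive
  fraction of \<open>[a, b]\<close>. The probability of a family of long gaps is at most the inverse product of the partition
  functions over these gaps; this bound is monotone in \<open>h\<close>, so that the supremum over \<open>h\<close> reduces to one value
  \<open>h1\<close> with positive free energy, smaller than all elements of \<open>H\<close>. The logarithm of the product is a convex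
  function of the disorder with gradient in \<open>[0, 1]\<close>, and Gaussian concentration (by rotation of two independent
  copies of the disorder) bounds a small negative moment of the product by an exponential in the total length of the
  gaps. A union bound over the families of gaps concludes.\<close>

section \<open>Paths and their gaps\<close>

text \<open>The supremum over \<open>h\<close> sits inside the expectation, so everything random is
  reduced to three quantities at \<open>h1\<close> that larger site weights can only decrease: the
  number of low sites and two sums over families of gaps. Two gap lengths occur. A path
  \<open>A\<close> without many long gaps is only known to have about \<open>m / (2 * L)\<close>
  points among \<open>m\<close> sites, while a long gap of \<open>B\<close> can hide as many points
  as its length. So the long gaps of \<open>B\<close> may take only a share
  \<open>1 / (8 * L)\<close>, and their threshold \<open>L'\<close> is chosen after
  \<open>L\<close>; the level \<open>w\<close> for low sites also follows \<open>L\<close>, and the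
  insertion cost \<open>c\<close> follows both. Small moments are used because the logarithm of the
  product has a mean linear in the total length \<open>T\<close>, whereas in a moment of order
  \<open>d\<close> its Gaussian fluctuations cost a multiple of \<open>d\<^sup>2 * T\<close>,
  summable covariances making the variance linear in \<open>T\<close>. The mean wins once
  \<open>d\<close> is small. Truncating at 1 lets the union bound run on such moments. Rotating two
  copies requires their joint law, while the disorder is given through its linear combinations;
  hence the uniqueness theorem for characteristic functions on sequences.\<close>

definition gaps :: "nat set \<Rightarrow> (nat \<times> nat) set" where
  "gaps A = {(u, v). u \<in> A \<and> v \<in> A \<and> u < v \<and> {u<..<v} \<inter> A = {}}"

definition paths :: "nat \<Rightarrow> nat \<Rightarrow> nat set set" where
  "paths u v = {A. A \<subseteq> {u..v} \<and> u \<in> A \<and> v \<in> A}"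

lemma finite_paths [simp]: "finite (paths u v)"
  by (rule finite_subset[of _ "Pow {u..v}"]) (auto simp: paths_def)

lemma finite_path: "A \<in> paths u v \<Longrightarrow> finite A"
  by (auto simp: paths_def intro: finite_subset)

lemma finite_gaps [intro]: "finite A \<Longrightarrow> finite (gaps A)"
  by (rule finite_subset[of _ "A \<times> A"]) (auto simp: gaps_def)

lemma gap_dichotomy: "(u, v) \<in> gaps A \<Longrightarrow> x \<in> A \<Longrightarrow> x \<le> u \<or> v \<le> x"
  by (auto simp: gaps_def disjoint_iff) (meson linorder_not_less)

lemma gaps_split:
  assumes "c \<in> A"
  shows "gaps A = gaps (A \<inter> {..c}) \<union> gaps (A \<inter> {c..})"
    and "gaps (A \<inter> {..c}) \<inter> gaps (A \<inter> {c..}) = {}"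
proof -
  have "(u, v) \<in> gaps A \<longleftrightarrow> (u, v) \<in> gaps (A \<inter> {..c}) \<union> gaps (A \<inter> {c..})" for u v
  proof
    assume *: "(u, v) \<in> gaps A"
    hence "c \<notin> {u<..<v}" using assms by (auto simp: gaps_def)
    hence "v \<le> c \<or> c \<le> u" by auto
    thus "(u, v) \<in> gaps (A \<inter> {..c}) \<union> gaps (A \<inter> {c..})"
      using * by (auto simp: gaps_def)
  next
    assume "(u, v) \<in> gaps (A \<inter> {..c}) \<union> gaps (A \<inter> {c..})"
    thus "(u, v) \<in> gaps A"
    proof
      assume *: "(u, v) \<in> gaps (A \<inter> {..c})"
      have "{u<..<v} \<inter> A \<subseteq> {u<..<v} \<inter> (A \<inter> {..c})" using * by (auto simp: gaps_def)
      thus ?thesis using * by (auto simp: gaps_def)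
    next
      assume *: "(u, v) \<in> gaps (A \<inter> {c..})"
      have "{u<..<v} \<inter> A \<subseteq> {u<..<v} \<inter> (A \<inter> {c..})" using * by (auto simp: gaps_def)
      thus ?thesis using * by (auto simp: gaps_def)
    qed
  qed
  thus "gaps A = gaps (A \<inter> {..c}) \<union> gaps (A \<inter> {c..})" by (auto simp del: Un_iff)
  show "gaps (A \<inter> {..c}) \<inter> gaps (A \<inter> {c..}) = {}"
    by (auto simp: gaps_def)
qed

text \<open>Since \<open>(u, v)\<close> is a gap, \<open>A\<close> and \<open>C\<close> share
  exactly the points \<open>u\<close> and \<open>v\<close>, so their other gaps lie on different
  stretches. The gap \<open>(u, v)\<close> is removed first because \<open>C = {u, v}\<close> is
  allowed and brings it back.\<close>

lemma gaps_insert_path: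
  assumes g: "(u, v) \<in> gaps A" and C: "C \<in> paths u v"
  shows "gaps (A \<union> C) = (gaps A - {(u, v)}) \<union> gaps C"
    and "(gaps A - {(u, v)}) \<inter> gaps C = {}"
proof -
  have A: "x \<le> u \<or> v \<le> x" if "x \<in> A" for x
    using gap_dichotomy[OF g that] .
  have uv: "u \<in> A" "v \<in> A" "u \<in> C" "v \<in> C" "u < v"
    using g C by (auto simp: gaps_def paths_def)
  have Cb: "u \<le> x \<and> x \<le> v" if "x \<in> C" for x using C that by (auto simp: paths_def)
  have "(x, y) \<in> gaps (A \<union> C) \<longleftrightarrow> (x, y) \<in> (gaps A - {(u, v)}) \<union> gaps C" for x y
  proof
    assume *: "(x, y) \<in> gaps (A \<union> C)"
    hence e: "z \<notin> A" "z \<notin> C" if "x < z" "z < y" for z using that by (auto simp: gaps_def)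
    have xy: "x < y" "x \<in> A \<union> C" "y \<in> A \<union> C" using * by (auto simp: gaps_def)
    consider "x < u" | "v < y" | "u \<le> x" "y \<le> v" by linarith
    thus "(x, y) \<in> (gaps A - {(u, v)}) \<union> gaps C"
    proof cases
      case 1
      have "y \<le> u" using e(1)[of u] uv 1 by force
      hence "x \<in> A" "y \<in> A" using 1 xy Cb uv by force+
      thus ?thesis using 1 xy e by (auto simp: gaps_def)
    next
      case 2
      have "v \<le> x" using e(1)[of v] uv 2 by force
      hence "x \<in> A" "y \<in> A" using 2 xy Cb uv by force+
      thus ?thesis using 2 xy e by (auto simp: gaps_def)
    next
      case 3
      have "x \<in> C" using xy(2) A[of x] 3 xy(1) uv by force
      moreover have "y \<in> C" using xy(3) A[of y] 3 xy(1) uv by force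
      ultimately show ?thesis using xy e by (auto simp: gaps_def)
    qed
  next
    assume "(x, y) \<in> (gaps A - {(u, v)}) \<union> gaps C"
    thus "(x, y) \<in> gaps (A \<union> C)"
    proof
      assume *: "(x, y) \<in> gaps A - {(u, v)}"
      hence xy: "x < y" "x \<in> A" "y \<in> A" "(x, y) \<noteq> (u, v)" by (auto simp: gaps_def)
      have e: "z \<notin> A" if "x < z" "z < y" for z using * that by (auto simp: gaps_def)
      have "y \<le> u \<or> v \<le> x"
      proof (rule ccontr)
        assume "\<not> (y \<le> u \<or> v \<le> x)"
        hence "u < y" "x < v" by auto
        hence "v \<le> y" "x \<le> u" using A xy by force+
        moreover have "\<not> v < y" using e[of v] uv \<open>x < v\<close> by auto
        moreover have "\<not> x < u" using e[of u] uv \<open>u < y\<close> by auto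
        ultimately show False using xy by auto
      qed
      hence "z \<notin> C" if "x < z" "z < y" for z using Cb[of z] that by force
      thus ?thesis using xy e by (auto simp: gaps_def)
    next
      assume *: "(x, y) \<in> gaps C"
      hence xy: "x < y" "x \<in> C" "y \<in> C" by (auto simp: gaps_def)
      have "z \<notin> A" if "x < z" "z < y" for z using A[of z] Cb[of x] Cb[of y] xy that by force
      thus ?thesis using * by (auto simp: gaps_def)
    qed
  qed
  thus "gaps (A \<union> C) = (gaps A - {(u, v)}) \<union> gaps C" by (auto simp del: Un_iff Diff_iff)
  show "(gaps A - {(u, v)}) \<inter> gaps C = {}"
  proof (rule ccontr)
    assume "(gaps A - {(u, v)}) \<inter> gaps C \<noteq> {}"
    then obtain x y where *: "(x, y) \<in> gaps A" "(x, y) \<in> gaps C" "(x, y) \<noteq> (u, v)" by auto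
    hence "x \<in> A" "y \<in> A" "x \<in> C" "y \<in> C" "x < y" by (auto simp: gaps_def)
    thus False using A[of x] A[of y] Cb[of x] Cb[of y] *(3) by auto
  qed
qed

text \<open>Half-open convention: a point of the path belongs to the gap on its right, so the
  intervals \<open>{x..<z}\<close> over all gaps tile \<open>{u..<v}\<close>. That they do not
  overlap is \<open>gaps_unique\<close>.\<close>

lemma gap_containing:
  assumes "A \<in> paths u v" "u \<le> y" "y < v"
  obtains x z where "(x, z) \<in> gaps A" "x \<le> y" "y < z" "z \<le> v" "u \<le> x"
proof -
  let ?x = "Max (A \<inter> {..y})" and ?z = "Min (A \<inter> {y<..})"
  have fin: "finite (A \<inter> {..y})" "finite (A \<inter> {y<..})" using finite_path[OF assms(1)] by auto
  have ne: "A \<inter> {..y} \<noteq> {}" "A \<inter> {y<..} \<noteq> {}" using assms by (auto simp: paths_def)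
  have x: "?x \<in> A" "?x \<le> y" and z: "?z \<in> A" "y < ?z"
    using Max_in[OF fin(1) ne(1)] Min_in[OF fin(2) ne(2)] by auto
  have "t \<notin> A" if "?x < t" "t < ?z" for t
  proof
    assume "t \<in> A"
    show False
    proof (cases "t \<le> y")
      case True
      hence "t \<le> ?x" using \<open>t \<in> A\<close> by (intro Max_ge fin) auto
      then show ?thesis using that by linarith
    next
      case False
      hence "?z \<le> t" using \<open>t \<in> A\<close> by (intro Min_le fin) auto
      then show ?thesis using that by linarith
    qed
  qed
  hence "(?x, ?z) \<in> gaps A" using x z by (auto simp: gaps_def)
  moreover have "?z \<le> v" "u \<le> ?x" using x z assms by (auto simp: paths_def)
  ultimately show ?thesis using that x z by blast
qed

lemma gaps_unique:
  assumes "(u, v) \<in> gaps A" "(u', v') \<in> gaps A" "u \<le> y" "y < v" "u' \<le> y" "y < v'"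
  shows "u = u'" "v = v'"
proof -
  have *: "x \<notin> A" if "u < x" "x < v" for x using assms(1) that by (auto simp: gaps_def)
  have **: "x \<notin> A" if "u' < x" "x < v'" for x using assms(2) that by (auto simp: gaps_def)
  have m: "u \<in> A" "v \<in> A" "u' \<in> A" "v' \<in> A" using assms by (auto simp: gaps_def)
  show "u = u'" using *[of u'] **[of u] m assms(3-6) by (cases u u' rule: linorder_cases) auto
  show "v = v'" using *[of v'] **[of v] m assms(3-6) by (cases v v' rule: linorder_cases) auto
qed

section \<open>Path weights and the refilling of gaps\<close>

definition gap_weight :: "(nat \<Rightarrow> real) \<Rightarrow> nat set \<Rightarrow> real" where
  "gap_weight p A = (\<Prod>(u, v)\<in>gaps A. p (v - u))"

text \<open>Only interior points carry a site weight. The ends of a gap are charged to the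
  surrounding path, so inserting a path into a gap multiplies the weights, and path sums over
  non-overlapping intervals read disjoint sites.\<close>

definition path_weight :: "(nat \<Rightarrow> real) \<Rightarrow> (nat \<Rightarrow> real) \<Rightarrow> nat \<Rightarrow> nat \<Rightarrow> nat set \<Rightarrow> real" where
  "path_weight p W u v A = gap_weight p A * (\<Prod>x\<in>A \<inter> {u<..<v}. W x)"

definition path_sum :: "(nat \<Rightarrow> real) \<Rightarrow> (nat \<Rightarrow> real) \<Rightarrow> nat \<Rightarrow> nat \<Rightarrow> real" where
  "path_sum p W u v = (\<Sum>A\<in>paths u v. path_weight p W u v A)"

lemma gap_weight_split:
  assumes "finite A" "c \<in> A"
  shows "gap_weight p A = gap_weight p (A \<inter> {..c}) * gap_weight p (A \<inter> {c..})"
  unfolding gap_weight_def gaps_split(1)[OF assms(2)]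
  by (rule prod.union_disjoint) (use assms gaps_split(2) in auto)

lemma gap_weight_insert_path:
  assumes "finite A" "(u, v) \<in> gaps A" "C \<in> paths u v"
  shows "gap_weight p (A \<union> C) * p (v - u) = gap_weight p A * gap_weight p C"
proof -
  have "gap_weight p (A \<union> C) = (\<Prod>(x, y)\<in>gaps A - {(u, v)}. p (y - x)) * gap_weight p C"
    unfolding gap_weight_def gaps_insert_path(1)[OF assms(2,3)]
    by (rule prod.union_disjoint)
       (use assms gaps_insert_path(2)[OF assms(2,3)] finite_path[OF assms(3)] in auto)
  moreover have "gap_weight p A = p (v - u) * (\<Prod>(x, y)\<in>gaps A - {(u, v)}. p (y - x))"
    unfolding gap_weight_def using prod.remove[of "gaps A" "(u, v)" "\<lambda>(x, y). p (y - x)"] assms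
    by auto
  ultimately show ?thesis by simp
qed

lemma path_weight_insert_path:
  assumes A: "A \<in> paths s t" "(u, v) \<in> gaps A" "C \<in> paths u v"
  shows "path_weight p W s t (A \<union> C) * p (v - u) = path_weight p W s t A * path_weight p W u v C"
proof -
  have uv: "s \<le> u" "v \<le> t" "u < v" "{u<..<v} \<inter> A = {}" "u \<in> A" "v \<in> A"
    using A by (auto simp: gaps_def paths_def)
  have "(A \<union> C) \<inter> {s<..<t} = (A \<inter> {s<..<t}) \<union> (C \<inter> {u<..<v})" (is "?l = ?r")
  proof
    show "?l \<subseteq> ?r"
    proof
      fix x assume x: "x \<in> ?l"
      show "x \<in> ?r"
      proof (cases "x \<in> A")
        case False
        hence "x \<in> C" "x \<noteq> u" "x \<noteq> v" using x uv by auto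
        thus ?thesis using A(3) by (auto simp: paths_def)
      qed (use x in auto)
    qed
    show "?r \<subseteq> ?l" using uv by auto
  qed
  moreover have "(A \<inter> {s<..<t}) \<inter> (C \<inter> {u<..<v}) = {}" using uv by auto
  ultimately have "(\<Prod>x\<in>(A \<union> C) \<inter> {s<..<t}. W x) =
      (\<Prod>x\<in>A \<inter> {s<..<t}. W x) * (\<Prod>x\<in>C \<inter> {u<..<v}. W x)"
    by (simp add: prod.union_disjoint)
  thus ?thesis
    using gap_weight_insert_path[OF finite_path[OF A(1)] A(2,3), of p]
    by (simp add: path_weight_def mult_ac)
qed

lemma insert_path_in_paths:
  assumes A: "A \<in> paths s t" "(u, v) \<in> gaps A" "C \<in> paths u v"
  shows "A \<union> C \<in> paths s t"
proof -
  have "s \<le> u" "v \<le> t" using A by (auto simp: gaps_def paths_def)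
  thus ?thesis using A(1,3) by (force simp: paths_def)
qed

locale gap_law =
  fixes p :: "nat \<Rightarrow> real"
  assumes p_pos: "\<And>t. 1 \<le> t \<Longrightarrow> 0 < p t" and p_le_1: "\<And>t. 1 \<le> t \<Longrightarrow> p t \<le> 1"
begin

lemma gap_weight_pos: "0 < gap_weight p A"
  unfolding gap_weight_def by (rule prod_pos) (auto simp: gaps_def intro!: p_pos)

lemma path_weight_pos: "(\<And>x. 0 < W x) \<Longrightarrow> 0 < path_weight p W u v A"
  unfolding path_weight_def by (intro mult_pos_pos gap_weight_pos prod_pos) auto

lemma path_sum_pos: "(\<And>x. 0 < W x) \<Longrightarrow> u \<le> v \<Longrightarrow> 0 < path_sum p W u v"
  unfolding path_sum_def
  by (rule sum_pos) (auto intro!: path_weight_pos exI[of _ "{u..v}"] simp: paths_def)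

lemma path_weight_mono:
  assumes "\<And>x. 0 < W x" "\<And>x. W x \<le> W' x"
  shows "path_weight p W u v A \<le> path_weight p W' u v A"
  unfolding path_weight_def
  using assms less_imp_le[OF gap_weight_pos] by (intro mult_left_mono prod_mono) (auto intro: less_imp_le)

lemma path_sum_mono:
  assumes "\<And>x. 0 < W x" "\<And>x. W x \<le> W' x"
  shows "path_sum p W u v \<le> path_sum p W' u v"
  unfolding path_sum_def by (intro sum_mono path_weight_mono assms)

text \<open>Distinct gaps may be refilled by arbitrary paths without losing weight, because \<open>p \<le> 1\<close>; the
  original path and the refilling are recovered from the result.\<close>

lemma sum_paths_with_gaps:
  assumes W: "\<And>x. 0 < W x" and G: "finite G"
  shows "(\<Sum>A | A \<in> paths s t \<and> c \<in> A \<and> G \<subseteq> gaps A. path_weight p W s t A) *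
      (\<Prod>(u, v)\<in>G. path_sum p W u v) \<le> (\<Sum>A | A \<in> paths s t \<and> c \<in> A. path_weight p W s t A)"
  using G
proof (induction G)
  case empty
  then show ?case by simp
next
  case (insert I G)
  obtain u v where I: "I = (u, v)" by force
  let ?S = "\<lambda>G. {A. A \<in> paths s t \<and> c \<in> A \<and> G \<subseteq> gaps A}"
  have fin: "finite (?S G)" for G by (rule finite_subset[OF _ finite_paths[of s t]]) auto
  have "(\<Sum>A\<in>?S (insert I G). path_weight p W s t A) * path_sum p W u v =
      (\<Sum>(A, C)\<in>?S (insert I G) \<times> paths u v. path_weight p W s t A * path_weight p W u v C)"
    unfolding path_sum_def by (simp add: sum_product sum.cartesian_product)
  also have "\<dots> \<le> (\<Sum>(A, C)\<in>?S (insert I G) \<times> paths u v. path_weight p W s t (A \<union> C))"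
  proof (rule sum_mono, clarify)
    fix A C assume *: "A \<in> paths s t" "insert I G \<subseteq> gaps A" "C \<in> paths u v"
    have "u < v" using * I by (auto simp: gaps_def)
    have "path_weight p W s t A * path_weight p W u v C = path_weight p W s t (A \<union> C) * p (v - u)"
      using path_weight_insert_path[of A s t u v C p W] * I by simp
    also have "\<dots> \<le> path_weight p W s t (A \<union> C) * 1"
      using \<open>u < v\<close> by (intro mult_left_mono p_le_1 less_imp_le[OF path_weight_pos] W) auto
    finally show "path_weight p W s t A * path_weight p W u v C \<le> path_weight p W s t (A \<union> C)" by simp
  qed
  also have "\<dots> = (\<Sum>B\<in>(\<lambda>(A, C). A \<union> C) ` (?S (insert I G) \<times> paths u v). path_weight p W s t B)"
  proof (subst sum.reindex)
    have rec: "(A \<union> C) \<inter> {u..v} = C \<and> (A \<union> C) - {u<..<v} = A"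
      if *: "A \<in> ?S (insert I G)" "C \<in> paths u v" for A C
    proof -
      have g: "(u, v) \<in> gaps A" using * I by auto
      have A: "x \<le> u \<or> v \<le> x" if "x \<in> A" for x using gap_dichotomy[OF g that] .
      have "x \<in> C" if "x \<in> A" "u \<le> x" "x \<le> v" for x
      proof -
        have "x = u \<or> x = v" using A[OF that(1)] that by linarith
        thus ?thesis using *(2) by (auto simp: paths_def)
      qed
      moreover have "x \<in> A" if "x \<in> C" "\<not> (u < x \<and> x < v)" for x
      proof -
        have "u \<le> x \<and> x \<le> v" using that *(2) by (auto simp: paths_def)
        hence "x = u \<or> x = v" using that(2) by linarith
        thus ?thesis using g by (auto simp: gaps_def)
      qed
      moreover have "C \<subseteq> {u..v}" using *(2) by (auto simp: paths_def)
      moreover have "A \<inter> {u<..<v} = {}" using g by (auto simp: gaps_def)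
      ultimately show ?thesis by auto
    qed
    show "inj_on (\<lambda>(A, C). A \<union> C) (?S (insert I G) \<times> paths u v)"
    proof (rule inj_onI, clarify)
      fix A C A' C'
      assume *: "A \<in> paths s t" "c \<in> A" "insert I G \<subseteq> gaps A" "C \<in> paths u v"
        "A' \<in> paths s t" "c \<in> A'" "insert I G \<subseteq> gaps A'" "C' \<in> paths u v" "A \<union> C = A' \<union> C'"
      have "(A \<union> C) \<inter> {u..v} = C \<and> (A \<union> C) - {u<..<v} = A" by (rule rec) (use * in auto)
      moreover have "(A' \<union> C') \<inter> {u..v} = C' \<and> (A' \<union> C') - {u<..<v} = A'"
        by (rule rec) (use * in auto)
      ultimately show "A = A' \<and> C = C'" using *(9) by metis
    qed
  qed (simp add: case_prod_unfold comp_def)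
  also have "\<dots> \<le> (\<Sum>A\<in>?S G. path_weight p W s t A)"
  proof (rule sum_mono2[OF fin])
    show "(\<lambda>(A, C). A \<union> C) ` (?S (insert I G) \<times> paths u v) \<subseteq> ?S G"
    proof clarify
      fix A C assume *: "A \<in> paths s t" "c \<in> A" "insert I G \<subseteq> gaps A" "C \<in> paths u v"
      hence g: "(u, v) \<in> gaps A" using I by auto
      \<comment> \<open>\<open>I\<close> is not in \<open>G\<close>, so refilling \<open>I\<close>
        leaves the gaps of \<open>G\<close> intact.\<close>
      have "G \<subseteq> gaps A - {(u, v)}" using * insert.hyps I by auto
      thus "A \<union> C \<in> paths s t \<and> c \<in> A \<union> C \<and> G \<subseteq> gaps (A \<union> C)"
        using insert_path_in_paths[OF *(1) g *(4)] gaps_insert_path(1)[OF g *(4)] *(2) by auto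
    qed
  qed (auto intro!: less_imp_le[OF path_weight_pos] W)
  finally have le: "(\<Sum>A\<in>?S (insert I G). path_weight p W s t A) * path_sum p W u v
      \<le> (\<Sum>A\<in>?S G. path_weight p W s t A)" .
  show ?case
  \<comment> \<open>If no path has all these gaps, the pairs in \<open>G\<close> need not be ordered
    and the sign of the product is not at hand, but the sum over paths is empty.\<close>
  proof (cases "?S (insert I G) = {}")
    case True
    have "0 \<le> (\<Sum>A | A \<in> paths s t \<and> c \<in> A. path_weight p W s t A)"
      by (intro sum_nonneg less_imp_le[OF path_weight_pos] W)
    thus ?thesis unfolding True by simp
  next
    case False
    then obtain A where "insert I G \<subseteq> gaps A" by auto
    hence nn: "0 \<le> (\<Prod>(u, v)\<in>G. path_sum p W u v)"
      by (intro prod_nonneg) (auto simp: gaps_def intro!: less_imp_le[OF path_sum_pos] W)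
    have "(\<Sum>A\<in>?S (insert I G). path_weight p W s t A) * (\<Prod>(u, v)\<in>insert I G. path_sum p W u v) =
        (\<Sum>A\<in>?S (insert I G). path_weight p W s t A) * path_sum p W u v * (\<Prod>(u, v)\<in>G. path_sum p W u v)"
      using insert.hyps I by simp
    also have "\<dots> \<le> (\<Sum>A\<in>?S G. path_weight p W s t A) * (\<Prod>(u, v)\<in>G. path_sum p W u v)"
      by (rule mult_right_mono[OF le nn])
    finally show ?thesis using insert.IH by simp
  qed
qed

end

section \<open>Insertions, long gaps and the counting of points\<close>

definition insertion_points ::
    "(nat \<Rightarrow> real) \<Rightarrow> real \<Rightarrow> nat \<Rightarrow> nat \<Rightarrow> nat \<Rightarrow> nat set \<Rightarrow> nat set \<Rightarrow> nat set" where
  "insertion_points W w L a b A B = {y \<in> A \<inter> {a<..<b}. y \<notin> B \<and> w \<le> W y \<and>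
     (\<exists>u v. (u, v) \<in> gaps B \<and> u < y \<and> y < v \<and> v - u \<le> L)}"

text \<open>A gap that sticks out of \<open>[a, b]\<close> counts with its full length, because its
  probability is compared with the path sum of the whole gap.\<close>

definition long_gaps :: "nat \<Rightarrow> nat \<Rightarrow> nat \<Rightarrow> nat set \<Rightarrow> (nat \<times> nat) set" where
  "long_gaps L a b A = {(u, v) \<in> gaps A. u < b \<and> a < v \<and> L < v - u}"

lemma gaps_triple: "u < y \<Longrightarrow> y < v \<Longrightarrow> gaps {u, y, v} = {(u, y), (y, v)}"
  by (auto simp: gaps_def)

context gap_law begin

text \<open>Points are added one at a time. The gap of \<open>B \<union> R\<close> around the next
  point lies inside a gap of \<open>B\<close>, so it still has length at most \<open>L\<close>, and
  each insertion multiplies the weight by at least \<open>c\<close>. The factor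
  \<open>p (z - x)\<close> of the destroyed gap is dropped by \<open>p \<le> 1\<close>.\<close>

lemma path_weight_insert_points:
  assumes W: "\<And>x. 0 < W x" and B: "B \<in> paths s t"
    and c: "0 \<le> c" "\<And>i j. 1 \<le> i \<Longrightarrow> i \<le> L \<Longrightarrow> 1 \<le> j \<Longrightarrow> j \<le> L \<Longrightarrow> c \<le> p i * p j * w"
    and R: "finite R" "\<And>y. y \<in> R \<Longrightarrow> y \<notin> B \<and> w \<le> W y \<and>
      (\<exists>u v. (u, v) \<in> gaps B \<and> u < y \<and> y < v \<and> v - u \<le> L)"
  shows "B \<union> R \<in> paths s t \<and> c ^ card R * path_weight p W s t B \<le> path_weight p W s t (B \<union> R)"
  using R
proof (induction R)
  case empty
  then show ?case using B by simp
next
  case (insert y R)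
  hence IH: "B \<union> R \<in> paths s t" "c ^ card R * path_weight p W s t B \<le> path_weight p W s t (B \<union> R)"
    by auto
  from insert.prems[of y] obtain u v where uv: "(u, v) \<in> gaps B" "u < y" "y < v" "v - u \<le> L"
    and y: "y \<notin> B" "w \<le> W y" by auto
  have st: "u \<in> B" "v \<in> B" "s \<le> u" "v \<le> t" using uv B by (auto simp: gaps_def paths_def)
  obtain x z where xz: "(x, z) \<in> gaps (B \<union> R)" "x \<le> y" "y < z"
    by (rule gap_containing[OF IH(1), of y]) (use st uv in auto)
  have "x \<in> B \<union> R" using xz by (auto simp: gaps_def)
  hence "x < y" using xz y insert.hyps by (cases "x = y") auto
  have "u \<le> x" using gap_dichotomy[OF xz(1), of u] st uv xz by auto
  moreover have "z \<le> v" using gap_dichotomy[OF xz(1), of v] st uv xz by auto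
  ultimately have L: "y - x \<le> L" "z - y \<le> L" using uv xz \<open>x < y\<close> by auto
  have C: "{x, y, z} \<in> paths x z" using xz \<open>x < y\<close> by (auto simp: paths_def)
  have eq: "B \<union> R \<union> {x, y, z} = B \<union> insert y R" using xz by (auto simp: gaps_def)
  have "{x, y, z} \<inter> {x<..<z} = {y}" using xz \<open>x < y\<close> by auto
  hence wC: "path_weight p W x z {x, y, z} = p (y - x) * p (z - y) * W y"
    using xz \<open>x < y\<close> by (simp add: path_weight_def gap_weight_def gaps_triple)
  have "c ^ card (insert y R) * path_weight p W s t B = c * (c ^ card R * path_weight p W s t B)"
    using insert.hyps by simp
  also have "\<dots> \<le> c * path_weight p W s t (B \<union> R)"
    by (rule mult_left_mono[OF IH(2) c(1)])
  also have "\<dots> \<le> (p (y - x) * p (z - y) * W y) * path_weight p W s t (B \<union> R)"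
  proof (rule mult_right_mono)
    have "c \<le> p (y - x) * p (z - y) * w" using c(2)[of "y - x" "z - y"] L \<open>x < y\<close> xz by auto
    also have "\<dots> \<le> p (y - x) * p (z - y) * W y"
      using y \<open>x < y\<close> xz by (intro mult_left_mono mult_nonneg_nonneg less_imp_le[OF p_pos]) auto
    finally show "c \<le> p (y - x) * p (z - y) * W y" .
  qed (intro less_imp_le[OF path_weight_pos] W)
  also have "\<dots> = path_weight p W s t (B \<union> insert y R) * p (z - x)"
    using path_weight_insert_path[OF IH(1) xz(1) C, of p W] unfolding eq wC by (simp add: mult_ac)
  also have "\<dots> \<le> path_weight p W s t (B \<union> insert y R) * 1"
    using \<open>x < y\<close> xz by (intro mult_left_mono p_le_1 less_imp_le[OF path_weight_pos] W) auto
  finally show ?case using insert_path_in_paths[OF IH(1) xz(1) C] unfolding eq by simp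
qed

text \<open>If \<open>A\<close> and \<open>B\<close> do not meet, a set \<open>R \<subseteq> A\<close> that is added to \<open>B\<close> can be recovered as the set of
  common points of \<open>A\<close> and \<open>B \<union> R\<close>.\<close>

lemma sum_disjoint_pairs_insertion:
  assumes W: "\<And>x. 0 < W x" and S: "S \<subseteq> paths s t"
    and c: "0 \<le> c" "\<And>i j. 1 \<le> i \<Longrightarrow> i \<le> L \<Longrightarrow> 1 \<le> j \<Longrightarrow> j \<le> L \<Longrightarrow> c \<le> p i * p j * w"
  shows "(\<Sum>(A, B) | A \<in> S \<and> B \<in> paths s t \<and> A \<inter> B \<inter> {a<..<b} = {}.
      path_weight p W s t A * path_weight p W s t B * (1 + c) ^ card (insertion_points W w L a b A B))
    \<le> (\<Sum>A\<in>S. path_weight p W s t A) * path_sum p W s t"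
    (is "(\<Sum>(A, B)\<in>?J. ?w A * ?w B * (1 + c) ^ card (?O A B)) \<le> _")
proof -
  have finS: "finite S" using S by (rule finite_subset) simp
  have finJ: "finite ?J"
    by (rule finite_subset[of _ "S \<times> paths s t"]) (use finS in auto)
  have finO: "finite (?O A B)" for A B
    by (rule finite_subset[of _ "{a<..<b}"]) (auto simp: insertion_points_def)
  \<comment> \<open>Binomial expansion: the reward becomes a sum over the subsets \<open>R\<close>
    of points that are actually inserted.\<close>
  have pow: "(1 + c) ^ card (?O A B) = (\<Sum>R\<in>Pow (?O A B). c ^ card R)" for A B
    using prod_add[OF finO, of "\<lambda>_. c" "\<lambda>_. 1" A B] by (simp add: add.commute)
  have "(\<Sum>(A, B)\<in>?J. ?w A * ?w B * (1 + c) ^ card (?O A B)) =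
      (\<Sum>(A, B)\<in>?J. \<Sum>R\<in>Pow (?O A B). ?w A * ?w B * c ^ card R)"
    unfolding pow by (simp add: sum_distrib_left)
  also have "\<dots> = (\<Sum>((A, B), R)\<in>(SIGMA x:?J. Pow (?O (fst x) (snd x))). ?w A * ?w B * c ^ card R)"
    by (subst sum.Sigma[symmetric]) (use finJ finO in \<open>auto simp: case_prod_unfold\<close>)
  also have "\<dots> \<le> (\<Sum>((A, B), R)\<in>(SIGMA x:?J. Pow (?O (fst x) (snd x))). ?w A * ?w (B \<union> R))"
  proof (rule sum_mono, clarify)
    fix A B R assume *: "A \<in> S" "B \<in> paths s t" "R \<subseteq> ?O (fst (A, B)) (snd (A, B))"
    have "c ^ card R * ?w B \<le> ?w (B \<union> R)"
    proof (rule conjunct2[OF path_weight_insert_points[of W B s t c L w R]])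
      show "finite R" by (rule finite_subset[OF *(3)]) (rule finO)
    qed (use W * c in \<open>auto simp: insertion_points_def\<close>)
    hence "?w A * (c ^ card R * ?w B) \<le> ?w A * ?w (B \<union> R)"
      by (intro mult_left_mono less_imp_le[OF path_weight_pos] W)
    thus "?w A * ?w B * c ^ card R \<le> ?w A * ?w (B \<union> R)" by (simp add: mult_ac)
  qed
  also have "\<dots> = (\<Sum>(A, B)\<in>(\<lambda>((A, B), R). (A, B \<union> R)) ` (SIGMA x:?J. Pow (?O (fst x) (snd x))). ?w A * ?w B)"
  proof (subst sum.reindex)
    have rec: "A \<inter> (B \<union> R) \<inter> {a<..<b} = R \<and> B \<union> R - R = B"
      if "A \<inter> B \<inter> {a<..<b} = {}" "R \<subseteq> ?O A B" for A B R
      using that by (auto simp: insertion_points_def)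
    show "inj_on (\<lambda>((A, B), R). (A, B \<union> R)) (SIGMA x:?J. Pow (?O (fst x) (snd x)))"
    proof (rule inj_onI)
      fix x y
      assume *: "x \<in> (SIGMA x:?J. Pow (?O (fst x) (snd x)))" "y \<in> (SIGMA x:?J. Pow (?O (fst x) (snd x)))"
        "(\<lambda>((A, B), R). (A, B \<union> R)) x = (\<lambda>((A, B), R). (A, B \<union> R)) y"
      obtain A B R A' B' R' where xy: "x = ((A, B), R)" "y = ((A', B'), R')" by (metis surj_pair)
      have "A \<inter> (B \<union> R) \<inter> {a<..<b} = R \<and> B \<union> R - R = B"
        using * xy by (intro rec) simp_all
      moreover have "A' \<inter> (B' \<union> R') \<inter> {a<..<b} = R' \<and> B' \<union> R' - R' = B'"
        using * xy by (intro rec) simp_all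
      moreover have "A = A'" "B \<union> R = B' \<union> R'" using *(3) xy by simp_all
      ultimately show "x = y" unfolding xy by metis
    qed
  qed (simp add: case_prod_unfold comp_def)
  also have "\<dots> \<le> (\<Sum>(A, B)\<in>S \<times> paths s t. ?w A * ?w B)"
  proof (rule sum_mono2)
    show "(\<lambda>((A, B), R). (A, B \<union> R)) ` (SIGMA x:?J. Pow (?O (fst x) (snd x))) \<subseteq> S \<times> paths s t"
    proof (rule image_subsetI)
      fix x assume *: "x \<in> (SIGMA x:?J. Pow (?O (fst x) (snd x)))"
      obtain A B R where x: "x = ((A, B), R)" by (metis surj_pair)
      have AB: "A \<in> S" "B \<in> paths s t" "R \<subseteq> ?O A B" using * x by auto
      have "B \<union> R \<in> paths s t"
      proof (rule conjunct1[OF path_weight_insert_points[of W B s t c L w R]])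
        show "finite R" by (rule finite_subset[OF AB(3)]) (rule finO)
      qed (use W AB c in \<open>auto simp: insertion_points_def\<close>)
      thus "(\<lambda>((A, B), R). (A, B \<union> R)) x \<in> S \<times> paths s t" using AB x by simp
    qed
  qed (use finS in \<open>auto intro!: mult_nonneg_nonneg less_imp_le[OF path_weight_pos] W\<close>)
  also have "\<dots> = (\<Sum>A\<in>S. ?w A) * path_sum p W s t"
    unfolding path_sum_def by (simp add: sum_product sum.cartesian_product)
  finally show ?thesis .
qed

end

lemma finite_long_gaps [intro]: "finite A \<Longrightarrow> finite (long_gaps L a b A)"
  by (rule finite_subset[of _ "gaps A"]) (auto simp: long_gaps_def)

text \<open>The gaps meeting \<open>[a, b)\<close> cover it. A short one contributes at most
  \<open>L\<close>, and gaps are told apart by their left ends: a point strictly between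
  \<open>a\<close> and \<open>b\<close>, or the last point up to \<open>a\<close>, which accounts
  for the \<open>+ 1\<close>.\<close>

lemma interval_length_le:
  assumes A: "A \<in> paths 0 n" and b: "b \<le> n"
  shows "b - a \<le> L * (card (A \<inter> {a<..<b}) + 1) + (\<Sum>(u, v)\<in>long_gaps L a b A. v - u)"
proof -
  have finA: "finite A" using A by (rule finite_path)
  let ?H = "{(u, v) \<in> gaps A. u < b \<and> a < v}"
  let ?short = "?H - long_gaps L a b A"
  have finH: "finite ?H" by (rule finite_subset[of _ "gaps A"]) (use finA in auto)
  have sub: "long_gaps L a b A \<subseteq> ?H" by (auto simp: long_gaps_def)
  have "{a..<b} \<subseteq> (\<Union>(u, v)\<in>?H. {u..<v})"
  proof
    fix y assume y: "y \<in> {a..<b}"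
    obtain x z where "(x, z) \<in> gaps A" "x \<le> y" "y < z"
      by (rule gap_containing[OF A, of y]) (use y b in auto)
    thus "y \<in> (\<Union>(u, v)\<in>?H. {u..<v})" using y by fastforce
  qed
  hence "card {a..<b} \<le> card (\<Union>(u, v)\<in>?H. {u..<v})"
    using finH by (intro card_mono) auto
  also have "\<dots> \<le> (\<Sum>(u, v)\<in>?H. card {u..<v})"
    using card_UN_le[OF finH, of "\<lambda>(u, v). {u..<v}"] by (simp add: case_prod_unfold)
  also have "\<dots> = (\<Sum>(u, v)\<in>?short. v - u) + (\<Sum>(u, v)\<in>long_gaps L a b A. v - u)"
    using sum.subset_diff[OF sub finH, of "\<lambda>(u, v). v - u"] by (simp add: case_prod_unfold)
  also have "(\<Sum>(u, v)\<in>?short. v - u) \<le> (\<Sum>x\<in>?short. L)"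
    by (rule sum_mono) (auto simp: long_gaps_def)
  also have "\<dots> = L * card ?short" by simp
  also have "card ?short \<le> card ?H" by (rule card_mono[OF finH]) auto
  also have "card ?H = card (fst ` ?H)"
  proof (rule card_image[symmetric], rule inj_onI)
    fix x y assume *: "x \<in> ?H" "y \<in> ?H" "fst x = fst y"
    obtain u v u' v' where xy: "x = (u, v)" "y = (u', v')" by (metis surj_pair)
    have "u < v" "u < v'" using * xy by (auto simp: gaps_def)
    thus "x = y" using gaps_unique[of u v A u' v' u] * xy by auto
  qed
  also have "\<dots> \<le> card (insert (Max (A \<inter> {..a})) (A \<inter> {a<..<b}))"
  proof (rule card_mono)
    show "fst ` ?H \<subseteq> insert (Max (A \<inter> {..a})) (A \<inter> {a<..<b})"
    proof clarsimp
      fix u v assume *: "(u, v) \<in> gaps A" "u < b" "a < v" "u \<in> A \<longrightarrow> \<not> a < u"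
      have uA: "u \<in> A" "u \<le> a" using * by (auto simp: gaps_def)
      show "u = Max (A \<inter> {..a})"
      proof (rule Max_eqI[symmetric])
        fix y assume "y \<in> A \<inter> {..a}"
        thus "y \<le> u" using gap_dichotomy[OF *(1), of y] * by auto
      qed (use finA uA in auto)
    qed
  qed (use finA in auto)
  also have "\<dots> \<le> card (A \<inter> {a<..<b}) + 1" using finA by (simp add: card_insert_if)
  finally show ?thesis by simp
qed

text \<open>A point of \<open>A\<close> strictly between \<open>a\<close> and \<open>b\<close> lies
  inside a gap of \<open>B\<close>. If it is not an insertion point, its own weight is low or that
  gap is long, and a long gap hides at most as many points as its length.\<close>

lemma card_disjoint_le:
  assumes A: "finite A" and B: "B \<in> paths 0 n" and b: "b \<le> n" and dis: "A \<inter> B \<inter> {a<..<b} = {}"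
  shows "card (A \<inter> {a<..<b}) \<le> card (insertion_points W w L a b A B) + card {y \<in> {a<..<b}. W y < w} +
    (\<Sum>(u, v)\<in>long_gaps L a b B. v - u)"
proof -
  have finB: "finite B" using B by (rule finite_path)
  let ?O = "insertion_points W w L a b A B" and ?D = "{y \<in> {a<..<b}. W y < w}"
    and ?U = "\<Union>(u, v)\<in>long_gaps L a b B. {u..<v}"
  have finU: "finite ?U" using finite_long_gaps[OF finB] by auto
  have finO: "finite ?O" by (rule finite_subset[of _ A]) (use A in \<open>auto simp: insertion_points_def\<close>)
  have "A \<inter> {a<..<b} \<subseteq> ?O \<union> ?D \<union> ?U"
  proof
    fix y assume y: "y \<in> A \<inter> {a<..<b}"
    hence yB: "y \<notin> B" using dis by auto
    obtain x z where xz: "(x, z) \<in> gaps B" "x \<le> y" "y < z"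
      by (rule gap_containing[OF B, of y]) (use y b in auto)
    have "x < y" using xz yB by (cases "x = y") (auto simp: gaps_def)
    consider "W y < w" | "w \<le> W y" "z - x \<le> L" | "L < z - x" by linarith
    thus "y \<in> ?O \<union> ?D \<union> ?U"
    proof cases
      case 3
      hence "(x, z) \<in> long_gaps L a b B" using xz y by (auto simp: long_gaps_def)
      hence "y \<in> ?U" by (rule UN_I) (use xz in auto)
      thus ?thesis by simp
    qed (use y yB xz \<open>x < y\<close> in \<open>auto simp: insertion_points_def\<close>)
  qed
  hence "card (A \<inter> {a<..<b}) \<le> card (?O \<union> ?D \<union> ?U)"
    using finU finO by (intro card_mono) auto
  also have "\<dots> \<le> card ?O + card ?D + card ?U"
    by (meson card_Un_le add_le_mono le_refl order_trans)
  also have "card ?U \<le> (\<Sum>(u, v)\<in>long_gaps L a b B. card {u..<v})"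
    using card_UN_le[OF finite_long_gaps[OF finB], of "\<lambda>(u, v). {u..<v}"] by (simp add: case_prod_unfold)
  finally show ?thesis by simp
qed

section \<open>Splicing two paths\<close>

text \<open>Meaningful only for paths that meet in \<open>[a, b]\<close>. The first common point is
  decided by the parts of the two paths up to it; an exchange of the tails keeps these parts, so it
  can be undone by the same rule.\<close>

definition first_meeting :: "nat \<Rightarrow> nat \<Rightarrow> nat set \<Rightarrow> nat set \<Rightarrow> nat" where
  "first_meeting a b A B = Min (A \<inter> B \<inter> {a..b})"

definition splice :: "nat \<Rightarrow> nat set \<Rightarrow> nat set \<Rightarrow> nat set" where
  "splice c A B = (A \<inter> {..c}) \<union> (B \<inter> {c..})"

lemma splice_Int:
  assumes "c \<in> A" "c \<in> B"
  shows "splice c A B \<inter> {..c} = A \<inter> {..c}" "splice c A B \<inter> {c..} = B \<inter> {c..}"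
  using assms unfolding splice_def by (blast dest: le_antisym)+

lemma splice_in_paths: "A \<in> paths s t \<Longrightarrow> B \<in> paths s t \<Longrightarrow> c \<in> A \<Longrightarrow> splice c A B \<in> paths s t"
  by (auto simp: splice_def paths_def)

lemma splice_mem: "c \<in> A \<Longrightarrow> c \<in> B \<Longrightarrow> x \<in> splice c A B \<longleftrightarrow> (if x \<le> c then x \<in> A else x \<in> B)"
  unfolding splice_def by (cases "x = c") auto

lemma path_weight_splice:
  assumes A: "A \<in> paths s t" and B: "B \<in> paths s t" and c: "c \<in> A" "c \<in> B"
  shows "path_weight p W s t (splice c A B) * path_weight p W s t (splice c B A) =
    path_weight p W s t A * path_weight p W s t B"
proof -
  \<comment> \<open>The site \<open>c\<close> is charged to the left factor only, so the cut counts
    it once.\<close>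
  define l r where "l X = gap_weight p X * (\<Prod>x\<in>X \<inter> {s<..<t}. W x)"
    and "r X = gap_weight p X * (\<Prod>x\<in>X \<inter> ({s<..<t} - {c}). W x)" for X
  have split: "path_weight p W s t X = l (X \<inter> {..c}) * r (X \<inter> {c..})"
    if "X \<in> paths s t" "c \<in> X" for X
  proof -
    have "X \<inter> {s<..<t} = (X \<inter> {..c} \<inter> {s<..<t}) \<union> (X \<inter> {c..} \<inter> ({s<..<t} - {c}))"
      using that by auto
    moreover have "(X \<inter> {..c} \<inter> {s<..<t}) \<inter> (X \<inter> {c..} \<inter> ({s<..<t} - {c})) = {}" by auto
    ultimately have "(\<Prod>x\<in>X \<inter> {s<..<t}. W x) =
        (\<Prod>x\<in>X \<inter> {..c} \<inter> {s<..<t}. W x) * (\<Prod>x\<in>X \<inter> {c..} \<inter> ({s<..<t} - {c}). W x)"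
      using finite_path[OF that(1)] by (metis finite_Int finite_greaterThanLessThan prod.union_disjoint finite_Diff)
    thus ?thesis using gap_weight_split[OF finite_path[OF that(1)] that(2), of p]
      by (simp add: path_weight_def l_def r_def mult_ac)
  qed
  have "c \<in> splice c A B" "c \<in> splice c B A" using c by (auto simp: splice_def)
  thus ?thesis
    using split[OF A c(1)] split[OF B c(2)]
      split[OF splice_in_paths[OF A B c(1)]] split[OF splice_in_paths[OF B A c(2)]]
    by (simp add: splice_Int c mult_ac)
qed

text \<open>Exchanging the tails at the first common point is a weight-preserving involution on
  meeting pairs. It keeps the difference of the indicators at \<open>a\<close> and reverses the sign
  of the one at \<open>b\<close>, so the sum equals its own negative.\<close>

lemma sum_meeting_pairs_eq_0:
  "(\<Sum>(A, B) | A \<in> paths s t \<and> B \<in> paths s t \<and> A \<inter> B \<inter> {a..b} \<noteq> {}.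
     path_weight p W s t A * path_weight p W s t B *
     ((of_bool (a \<in> A) - of_bool (a \<in> B)) * (of_bool (b \<in> A) - of_bool (b \<in> B)))) = 0"
  (is "sum ?f ?T = 0")
proof -
  let ?c = "\<lambda>(A, B). first_meeting a b A B"
  let ?s = "\<lambda>x. (splice (?c x) (fst x) (snd x), splice (?c x) (snd x) (fst x))"
  have c: "?c (A, B) \<in> A \<inter> B \<inter> {a..b}" "\<And>y. y \<in> A \<inter> B \<inter> {a..b} \<Longrightarrow> ?c (A, B) \<le> y"
    if "(A, B) \<in> ?T" for A B
    using that Min_in[of "A \<inter> B \<inter> {a..b}"] by (auto simp: first_meeting_def)
  have sT: "?s (A, B) \<in> ?T" and cs: "?c (?s (A, B)) = ?c (A, B)" and fs: "?f (?s (A, B)) = - ?f (A, B)"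
    and ss: "?s (?s (A, B)) = (A, B)"
    if AB: "(A, B) \<in> ?T" for A B
  proof -
    define c where "c = ?c (A, B)"
    have cm: "c \<in> A" "c \<in> B" "a \<le> c" "c \<le> b" using c(1)[OF AB] by (auto simp: c_def)
    have P: "A \<in> paths s t" "B \<in> paths s t" using AB by auto
    have s: "?s (A, B) = (splice c A B, splice c B A)" by (simp add: c_def)
    have csp: "c \<in> splice c A B" "c \<in> splice c B A" using cm by (auto simp: splice_def)
    show "?s (A, B) \<in> ?T" unfolding s
      using splice_in_paths[OF P cm(1)] splice_in_paths[OF P(2,1) cm(2)] csp cm by auto
    have "first_meeting a b (splice c A B) (splice c B A) = c"
      unfolding first_meeting_def
    proof (rule Min_eqI)
      fix y assume y: "y \<in> splice c A B \<inter> splice c B A \<inter> {a..b}"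
      show "c \<le> y"
      proof (rule ccontr)
        assume "\<not> c \<le> y"
        hence "y \<in> A \<inter> B \<inter> {a..b}" using y by (auto simp: splice_mem cm)
        thus False using c(2)[OF AB] \<open>\<not> c \<le> y\<close> by (auto simp: c_def)
      qed
    qed (use csp cm in auto)
    thus cs: "?c (?s (A, B)) = ?c (A, B)" unfolding s by (simp add: c_def)
    have "splice c (splice c A B) (splice c B A) = A" "splice c (splice c B A) (splice c A B) = B"
      using cm by (auto simp: splice_mem csp split: if_splits)
    thus "?s (?s (A, B)) = (A, B)"
      using cs unfolding s by (simp add: c_def)
    have "a \<in> splice c A B \<longleftrightarrow> a \<in> A" "a \<in> splice c B A \<longleftrightarrow> a \<in> B"
      using cm by (auto simp: splice_mem)
    \<comment> \<open>If the meeting point is \<open>b\<close> itself, both differences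
      vanish.\<close>
    moreover have "of_bool (b \<in> splice c A B) - of_bool (b \<in> splice c B A) =
        - (of_bool (b \<in> A) - of_bool (b \<in> B) :: real)"
      using cm by (cases "c = b") (auto simp: splice_mem)
    ultimately show "?f (?s (A, B)) = - ?f (A, B)"
      unfolding s using path_weight_splice[OF P cm(1,2), of p W] by simp
  qed
  have "sum ?f ?T = sum (\<lambda>x. - ?f x) ?T"
  proof (rule sum.reindex_bij_witness[of _ ?s ?s])
    show "- ?f (?s x) = ?f x" if "x \<in> ?T" for x
      using fs[of "fst x" "snd x"] that unfolding prod.collapse by linarith
  qed (use sT ss in \<open>simp_all only: split_paired_all\<close>)
  thus ?thesis by (simp add: sum_negf)
qed

definition path_mass :: "(nat \<Rightarrow> real) \<Rightarrow> (nat \<Rightarrow> real) \<Rightarrow> nat \<Rightarrow> nat \<Rightarrow> nat set \<Rightarrow> real" where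
  "path_mass p W s t D = (\<Sum>A | A \<in> paths s t \<and> D \<subseteq> A. path_weight p W s t A)"

text \<open>Divided by the square of \<open>path_sum\<close>, this is the probability that two
  independent paths do not meet in \<open>[a, b]\<close> and the first contains \<open>c\<close>.
  The mark on one path later supplies the factor that cancels the denominator.\<close>

definition avoiding_mass ::
    "(nat \<Rightarrow> real) \<Rightarrow> (nat \<Rightarrow> real) \<Rightarrow> nat \<Rightarrow> nat \<Rightarrow> nat \<Rightarrow> nat \<Rightarrow> nat \<Rightarrow> real" where
  "avoiding_mass p W s t a b c =
     (\<Sum>(A, B) | A \<in> paths s t \<and> c \<in> A \<and> B \<in> paths s t \<and> A \<inter> B \<inter> {a..b} = {}.
        path_weight p W s t A * path_weight p W s t B)"

text \<open>Twice the covariance is the mean of the product of the indicator differences of two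
  copies at \<open>a\<close> and at \<open>b\<close>. For \<open>c = a\<close> as for
  \<open>c = b\<close>, this product is bounded by the sum of the two indicators at
  \<open>c\<close>; by symmetry each of them contributes one \<open>avoiding_mass\<close>, which
  cancels the factor 2.\<close>

lemma (in gap_law) covariance_le_avoiding_mass:
  assumes W: "\<And>x. 0 < W x" and c: "c \<in> {a, b}"
  shows "\<bar>path_sum p W s t * path_mass p W s t {a, b} - path_mass p W s t {a} * path_mass p W s t {b}\<bar>
    \<le> avoiding_mass p W s t a b c"
proof -
  let ?w = "path_weight p W s t" and ?P = "paths s t"
  let ?i = "\<lambda>x A. of_bool (x \<in> A) :: real"
  let ?f = "\<lambda>(A, B). ?w A * ?w B * ((?i a A - ?i a B) * (?i b A - ?i b B))"
  let ?J = "{(A, B). A \<in> ?P \<and> B \<in> ?P \<and> A \<inter> B \<inter> {a..b} = {}}"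
  let ?T = "{(A, B). A \<in> ?P \<and> B \<in> ?P \<and> A \<inter> B \<inter> {a..b} \<noteq> {}}"
  have finJ: "finite ?J" "finite ?T" by (rule finite_subset[of _ "?P \<times> ?P"], auto)+
  have mass: "path_mass p W s t D = (\<Sum>A\<in>?P. ?w A * of_bool (D \<subseteq> A))" for D
    unfolding path_mass_def using sum.inter_filter[of ?P ?w "\<lambda>A. D \<subseteq> A"]
    by (simp add: of_bool_def if_distrib[of "\<lambda>x. _ * x"] cong: if_cong)
  have ab: "of_bool ({a, b} \<subseteq> A) = ?i a A * ?i b A" for A by auto
  have prod: "sum f ?P * sum g ?P = (\<Sum>(A, B)\<in>?P \<times> ?P. f A * g B)" for f g :: "nat set \<Rightarrow> real"
    by (simp add: sum_product sum.cartesian_product)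
  have "2 * (path_sum p W s t * path_mass p W s t {a, b} - path_mass p W s t {a} * path_mass p W s t {b})
      = path_sum p W s t * path_mass p W s t {a, b} + path_mass p W s t {a, b} * path_sum p W s t
        - path_mass p W s t {a} * path_mass p W s t {b} - path_mass p W s t {b} * path_mass p W s t {a}"
    by (simp add: algebra_simps)
  also have "\<dots> = sum ?f (?P \<times> ?P)"
    unfolding mass ab path_sum_def prod
    unfolding sum.distrib[symmetric] sum_subtractf[symmetric]
    by (rule sum.cong) (auto simp: algebra_simps)
  also have "\<dots> = sum ?f ?J + sum ?f ?T"
    by (subst sum.union_disjoint[symmetric]) (use finJ in \<open>auto intro!: sum.cong\<close>)
  also have "sum ?f ?T = 0" by (rule sum_meeting_pairs_eq_0)
  finally have "2 * \<bar>path_sum p W s t * path_mass p W s t {a, b} - path_mass p W s t {a} * path_mass p W s t {b}\<bar>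
      = \<bar>sum ?f ?J\<bar>" by (subst abs_numeral[symmetric], subst abs_mult[symmetric]) simp
  also have "\<dots> \<le> (\<Sum>x\<in>?J. \<bar>?f x\<bar>)" by (rule sum_abs)
  also have "\<dots> \<le> (\<Sum>(A, B)\<in>?J. ?w A * ?w B * ?i c A + ?w B * ?w A * ?i c B)"
  proof (rule sum_mono, clarify)
    fix A B
    define d where "d = (?i a A - ?i a B) * (?i b A - ?i b B)"
    have d: "\<bar>d\<bar> \<le> ?i c A + ?i c B" using c by (auto simp: d_def)
    have w: "0 < ?w A * ?w B" using path_weight_pos[of W, OF W] by simp
    have "\<bar>?w A * ?w B * d\<bar> = ?w A * ?w B * \<bar>d\<bar>"
      unfolding abs_mult[of "?w A * ?w B"] using w by simp
    also have "\<dots> \<le> ?w A * ?w B * (?i c A + ?i c B)" using w d by (intro mult_left_mono) auto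
    finally show "\<bar>?w A * ?w B * ((?i a A - ?i a B) * (?i b A - ?i b B))\<bar>
        \<le> ?w A * ?w B * ?i c A + ?w B * ?w A * ?i c B"
      by (simp add: d_def distrib_left mult.commute[of "?w B"])
  qed
  also have "\<dots> = (\<Sum>(A, B)\<in>?J. ?w A * ?w B * ?i c A) + (\<Sum>(A, B)\<in>?J. ?w B * ?w A * ?i c B)"
    by (simp add: case_prod_unfold sum.distrib)
  also have "(\<Sum>(A, B)\<in>?J. ?w B * ?w A * ?i c B) = (\<Sum>(A, B)\<in>?J. ?w A * ?w B * ?i c A)"
    by (rule sum.reindex_bij_witness[of _ prod.swap prod.swap]) auto
  also have "(\<Sum>(A, B)\<in>?J. ?w A * ?w B * ?i c A) = avoiding_mass p W s t a b c"
  proof -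
    have eq: "{(A, B). A \<in> ?P \<and> c \<in> A \<and> B \<in> ?P \<and> A \<inter> B \<inter> {a..b} = {}} = {x \<in> ?J. c \<in> fst x}"
      by auto
    show ?thesis unfolding avoiding_mass_def eq sum.inter_filter[OF finJ(1)]
      by (rule sum.cong) auto
  qed
  finally show ?thesis by simp
qed

section \<open>Union bound over families of long gaps\<close>

text \<open>Contains every value that \<open>long_gaps L a b A\<close> can take with total length at
  least \<open>m\<close>, but is described without a path, so that one can sum over it.\<close>

definition gap_families :: "nat \<Rightarrow> nat \<Rightarrow> nat \<Rightarrow> nat \<Rightarrow> real \<Rightarrow> (nat \<times> nat) set set" where
  "gap_families n L a b m = {G. G \<subseteq> {(u, v). u < v \<and> v \<le> n \<and> u < b \<and> a < v \<and> L < v - u} \<and>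
     disjoint_family_on (\<lambda>(u, v). {u..<v}) G \<and> m \<le> (\<Sum>(u, v)\<in>G. real (v - u))}"

definition gap_family_sum ::
    "(nat \<Rightarrow> real) \<Rightarrow> (nat \<Rightarrow> real) \<Rightarrow> nat \<Rightarrow> nat \<Rightarrow> nat \<Rightarrow> nat \<Rightarrow> real \<Rightarrow> real" where
  "gap_family_sum p W n L a b m = (\<Sum>G\<in>gap_families n L a b m. \<Prod>(u, v)\<in>G. 1 / path_sum p W u v)"

lemma finite_gap_interval_set: "finite {(u, v). u < v \<and> v \<le> n \<and> u < b \<and> a < v \<and> L < v - u}" for n :: nat
  by (rule finite_subset[of _ "{..n} \<times> {..n}"]) auto

lemma finite_gap_families [simp]: "finite (gap_families n L a b m)"
  by (rule finite_subset[of _ "Pow {(u, v). u < v \<and> v \<le> n \<and> u < b \<and> a < v \<and> L < v - u}"])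
     (auto simp: gap_families_def finite_gap_interval_set)

lemma gap_families_finite: "G \<in> gap_families n L a b m \<Longrightarrow> finite G"
  by (rule finite_subset[OF _ finite_gap_interval_set[of n b a L]]) (auto simp: gap_families_def)

context gap_law begin

lemma gap_family_prod_pos:
  "(\<And>x. 0 < W x) \<Longrightarrow> G \<in> gap_families n L a b m \<Longrightarrow> 0 < (\<Prod>(u, v)\<in>G. path_sum p W u v)"
  by (rule prod_pos) (force simp: gap_families_def intro!: path_sum_pos)

lemma gap_family_sum_nonneg: "(\<And>x. 0 < W x) \<Longrightarrow> 0 \<le> gap_family_sum p W n L a b m"
  unfolding gap_family_sum_def
  by (intro sum_nonneg prod_nonneg) (force simp: gap_families_def intro!: less_imp_le[OF path_sum_pos])

text \<open>This removes the dependence on \<open>h\<close>: raising the site weights raises every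
  path sum, so the value at \<open>h1\<close> serves for all larger \<open>h\<close>.\<close>

lemma gap_family_sum_antimono:
  assumes "\<And>x. 0 < W x" "\<And>x. W x \<le> W' x"
  shows "gap_family_sum p W' n L a b m \<le> gap_family_sum p W n L a b m"
  unfolding gap_family_sum_def
proof (intro sum_mono prod_mono, clarify)
  fix G u v assume "G \<in> gap_families n L a b m" "(u, v) \<in> G"
  hence uv: "u \<le> v" by (auto simp: gap_families_def)
  have W': "0 < W' x" for x using assms[of x] by linarith
  show "0 \<le> 1 / path_sum p W' u v \<and> 1 / path_sum p W' u v \<le> 1 / path_sum p W u v"
    using path_sum_pos[of W, OF assms(1) uv] path_sum_pos[of W', OF W' uv] path_sum_mono[of W W' u v, OF assms]
    by (auto simp: frac_le)
qed

text \<open>Union bound over the value \<open>G\<close> of \<open>long_gaps L a b A\<close>;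
  possessing all gaps of \<open>G\<close> costs the inverse product by
  \<open>sum_paths_with_gaps\<close>. The marked point \<open>c\<close> survives because refilling
  never deletes points.\<close>

lemma long_gaps_mass:
  assumes W: "\<And>x. 0 < W x"
  shows "(\<Sum>A | A \<in> paths 0 n \<and> c \<in> A \<and> m \<le> (\<Sum>(u, v)\<in>long_gaps L a b A. real (v - u)).
      path_weight p W 0 n A) \<le> path_mass p W 0 n {c} * gap_family_sum p W n L a b m"
    (is "sum ?w ?S \<le> _")
proof -
  let ?F = "gap_families n L a b m"
  have finS: "finite ?S" by (rule finite_subset[OF _ finite_paths[of 0 n]]) auto
  have "?w A \<le> (\<Sum>G\<in>?F. if G \<subseteq> gaps A then ?w A else 0)" if A: "A \<in> ?S" for A
  proof -
    let ?G = "long_gaps L a b A"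
    have "disjoint_family_on (\<lambda>(u, v). {u..<v}) ?G"
      unfolding disjoint_family_on_def
    proof (intro ballI impI)
      fix x y assume *: "x \<in> ?G" "y \<in> ?G" "x \<noteq> y"
      obtain u v u' v' where xy: "x = (u, v)" "y = (u', v')" by (metis surj_pair)
      show "(case x of (u, v) \<Rightarrow> {u..<v}) \<inter> (case y of (u, v) \<Rightarrow> {u..<v}) = {}"
      proof (rule ccontr)
        assume "\<not> ?thesis"
        hence "\<exists>z. z \<in> {u..<v} \<and> z \<in> {u'..<v'}" unfolding xy prod.case by blast
        then obtain z where "u \<le> z" "z < v" "u' \<le> z" "z < v'" by auto
        thus False using * gaps_unique[of u v A u' v' z] unfolding xy by (auto simp: long_gaps_def)
      qed
    qed
    hence G: "?G \<in> ?F" using A by (auto simp: gap_families_def long_gaps_def gaps_def paths_def)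
    have "?w A = (if ?G \<subseteq> gaps A then ?w A else 0)" by (auto simp: long_gaps_def)
    also have "\<dots> \<le> (\<Sum>G\<in>?F. if G \<subseteq> gaps A then ?w A else 0)"
      by (rule member_le_sum[OF G]) (auto intro: less_imp_le[OF path_weight_pos] W)
    finally show ?thesis .
  qed
  hence "sum ?w ?S \<le> (\<Sum>A\<in>?S. \<Sum>G\<in>?F. if G \<subseteq> gaps A then ?w A else 0)" by (rule sum_mono)
  also have "\<dots> = (\<Sum>G\<in>?F. \<Sum>A\<in>?S. if G \<subseteq> gaps A then ?w A else 0)" by (rule sum.swap)
  also have "\<dots> \<le> (\<Sum>G\<in>?F. path_mass p W 0 n {c} * (\<Prod>(u, v)\<in>G. 1 / path_sum p W u v))"
  proof (rule sum_mono)
    fix G assume G: "G \<in> ?F"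
    have "(\<Sum>A\<in>?S. if G \<subseteq> gaps A then ?w A else 0) = (\<Sum>A\<in>{A \<in> ?S. G \<subseteq> gaps A}. ?w A)"
      by (rule sym, rule sum.inter_filter, rule finS)
    also have "\<dots> \<le> (\<Sum>A | A \<in> paths 0 n \<and> c \<in> A \<and> G \<subseteq> gaps A. ?w A)"
      by (rule sum_mono2) (auto intro: less_imp_le[OF path_weight_pos] W)
    also have "\<dots> \<le> path_mass p W 0 n {c} / (\<Prod>(u, v)\<in>G. path_sum p W u v)"
      using sum_paths_with_gaps[of W G 0 n c, OF W gap_families_finite[OF G]]
        gap_family_prod_pos[of W G, OF W G]
      by (simp add: pos_le_divide_eq path_mass_def)
    also have "\<dots> = path_mass p W 0 n {c} * (\<Prod>(u, v)\<in>G. 1 / path_sum p W u v)"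
      by (simp add: case_prod_unfold prod_dividef)
    finally show "(\<Sum>A\<in>?S. if G \<subseteq> gaps A then ?w A else 0)
        \<le> path_mass p W 0 n {c} * (\<Prod>(u, v)\<in>G. 1 / path_sum p W u v)" .
  qed
  finally show ?thesis unfolding gap_family_sum_def by (simp add: sum_distrib_left)
qed

end

context gap_law begin

text \<open>Bookkeeping of points: unless the long gaps of \<open>A\<close> add up to
  \<open>m / 2\<close>, \<open>A\<close> has at least \<open>m / (2 * L) - 1\<close> points between
  \<open>a\<close> and \<open>b\<close>. Low sites and long gaps of \<open>B\<close> spoil at most
  \<open>m / (8 * L)\<close> of them each, or \<open>B\<close> falls under the last term. At least
  \<open>m / (4 * L) - 1\<close> insertion points remain, and their reward yields the first
  term.\<close>

lemma avoiding_mass_le: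
  assumes W: "\<And>x. 0 < W x" and ab: "a \<le> b" "b \<le> n"
    and c: "0 \<le> c" "\<And>i j. 1 \<le> i \<Longrightarrow> i \<le> L' \<Longrightarrow> 1 \<le> j \<Longrightarrow> j \<le> L' \<Longrightarrow> c \<le> p i * p j * w"
    and L: "1 \<le> L" and m: "m = real (b - a)"
    and bad: "real (card {y \<in> {a<..<b}. W y < w}) \<le> m / (8 * real L)"
  shows "avoiding_mass p W 0 n a b z \<le> path_mass p W 0 n {z} * path_sum p W 0 n *
    ((1 + c) powr (1 - m / (4 * real L)) + gap_family_sum p W n L a b (m / 2)
      + gap_family_sum p W n L' a b (m / (8 * real L)))"
proof -
  let ?w = "path_weight p W 0 n"
  let ?S = "{A. A \<in> paths 0 n \<and> z \<in> A}"
  let ?J = "{(A, B). A \<in> ?S \<and> B \<in> paths 0 n \<and> A \<inter> B \<inter> {a<..<b} = {}}"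
  let ?D = "\<lambda>L A. \<Sum>(u, v)\<in>long_gaps L a b A. real (v - u)"
  let ?O = "insertion_points W w L' a b"
  \<comment> \<open>The reciprocal of the reward guaranteed by \<open>m / (4 * L) - 1\<close>
    insertion points.\<close>
  define q where "q = (1 + c) powr (1 - m / (4 * real L))"
  have q0: "0 \<le> q" by (simp add: q_def)
  have wp: "0 \<le> ?w A" for A by (rule less_imp_le[OF path_weight_pos[of W, OF W]])
  have fin: "finite ?S" "finite (?S \<times> paths 0 n)" by auto
  have finJ: "finite ?J" by (rule finite_subset[OF _ fin(2)]) auto
  define f1 f2 where "f1 A = (if m / 2 \<le> ?D L A then ?w A else 0)"
    and "f2 B = (if m / (8 * real L) \<le> ?D L' B then ?w B else 0)" for A B
  have f0: "0 \<le> f1 A" "0 \<le> f2 A" for A by (auto simp: f1_def f2_def wp)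
  have key: "?w A * ?w B \<le> q * (?w A * ?w B * (1 + c) ^ card (?O A B)) + f1 A * ?w B + ?w A * f2 B"
    if AB: "(A, B) \<in> ?J" for A B
  proof -
    consider "m / 2 \<le> ?D L A" | "m / (8 * real L) \<le> ?D L' B" | "?D L A < m / 2" "?D L' B < m / (8 * real L)"
      by linarith
    thus ?thesis
    proof cases
      case 1
      thus ?thesis using wp q0 c(1) f0(2)[of B] by (auto simp: f1_def add_increasing add_increasing2)
    next
      case 2
      thus ?thesis using wp q0 c(1) f0(1)[of A] by (auto simp: f2_def add_increasing add_increasing2)
    next
      case 3
      have "b - a \<le> L * (card (A \<inter> {a<..<b}) + 1) + (\<Sum>(u, v)\<in>long_gaps L a b A. v - u)"
        by (rule interval_length_le) (use AB ab in auto)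
      hence "m \<le> real (L * (card (A \<inter> {a<..<b}) + 1) + (\<Sum>(u, v)\<in>long_gaps L a b A. v - u))"
        unfolding m by (rule of_nat_mono)
      also have "\<dots> = L * (card (A \<inter> {a<..<b}) + 1) + ?D L A"
        by (simp add: case_prod_unfold)
      finally have "m / 2 \<le> L * (card (A \<inter> {a<..<b}) + 1)" using 3 by linarith
      hence A: "m / (2 * real L) \<le> card (A \<inter> {a<..<b}) + 1" using L by (simp add: field_simps)
      have "card (A \<inter> {a<..<b}) \<le> card (?O A B) + card {y \<in> {a<..<b}. W y < w} +
          (\<Sum>(u, v)\<in>long_gaps L' a b B. v - u)"
        by (rule card_disjoint_le) (use AB ab finite_path in auto)
      hence "real (card (A \<inter> {a<..<b})) \<le> real (card (?O A B) + card {y \<in> {a<..<b}. W y < w} +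
          (\<Sum>(u, v)\<in>long_gaps L' a b B. v - u))"
        by (rule of_nat_mono)
      also have "\<dots> = card (?O A B) + card {y \<in> {a<..<b}. W y < w} + ?D L' B"
        by (simp add: case_prod_unfold)
      finally have "card (A \<inter> {a<..<b}) \<le> card (?O A B) + 2 * (m / (8 * real L))"
        using 3 bad by linarith
      moreover have "m / (2 * real L) - 2 * (m / (8 * real L)) = m / (4 * real L)" using L by (simp add: field_simps)
      ultimately have "m / (4 * real L) - 1 \<le> card (?O A B)" using A by linarith
      hence "1 \<le> (1 + c) powr (1 - m / (4 * real L) + card (?O A B))"
        using c(1) by (intro ge_one_powr_ge_zero) auto
      also have "\<dots> = q * (1 + c) ^ card (?O A B)"
        using c(1) by (simp add: q_def powr_add powr_realpow)
      finally have "?w A * ?w B * 1 \<le> ?w A * ?w B * (q * (1 + c) ^ card (?O A B))"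
        by (intro mult_left_mono) (simp_all add: wp)
      thus ?thesis using mult_nonneg_nonneg[OF f0(1) wp, of A B] mult_nonneg_nonneg[OF wp f0(2), of A B]
        by (simp add: mult_ac)
    qed
  qed
  have "avoiding_mass p W 0 n a b z \<le> (\<Sum>(A, B)\<in>?J. ?w A * ?w B)"
    unfolding avoiding_mass_def by (rule sum_mono2[OF finJ]) (auto simp: wp)
  also have "\<dots> \<le> (\<Sum>(A, B)\<in>?J. q * (?w A * ?w B * (1 + c) ^ card (?O A B)) + f1 A * ?w B + ?w A * f2 B)"
    by (rule sum_mono) (use key in auto)
  also have "\<dots> = q * (\<Sum>(A, B)\<in>?J. ?w A * ?w B * (1 + c) ^ card (?O A B)) +
      (\<Sum>(A, B)\<in>?J. f1 A * ?w B) + (\<Sum>(A, B)\<in>?J. ?w A * f2 B)"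
    by (simp add: case_prod_unfold sum.distrib sum_distrib_left)
  also have "\<dots> \<le> q * (path_mass p W 0 n {z} * path_sum p W 0 n) +
      path_mass p W 0 n {z} * gap_family_sum p W n L a b (m / 2) * path_sum p W 0 n +
      path_mass p W 0 n {z} * (path_sum p W 0 n * gap_family_sum p W n L' a b (m / (8 * real L)))"
  proof (intro add_mono)
    have "(\<Sum>(A, B)\<in>?J. ?w A * ?w B * (1 + c) ^ card (?O A B)) \<le> (\<Sum>A\<in>?S. ?w A) * path_sum p W 0 n"
      by (rule sum_disjoint_pairs_insertion[of W, OF W _ c]) auto
    thus "q * (\<Sum>(A, B)\<in>?J. ?w A * ?w B * (1 + c) ^ card (?O A B))
        \<le> q * (path_mass p W 0 n {z} * path_sum p W 0 n)"
      by (intro mult_left_mono q0) (simp add: path_mass_def)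
    have prod: "(\<Sum>(A, B)\<in>?J. g A * h B) \<le> (\<Sum>A\<in>?S. g A) * (\<Sum>B\<in>paths 0 n. h B)"
      if "\<And>A. 0 \<le> g A" "\<And>A. 0 \<le> h A" for g h :: "nat set \<Rightarrow> real"
    proof -
      have "(\<Sum>(A, B)\<in>?J. g A * h B) \<le> (\<Sum>(A, B)\<in>?S \<times> paths 0 n. g A * h B)"
        by (rule sum_mono2[OF fin(2)]) (auto simp: that)
      thus ?thesis by (simp add: sum_product sum.cartesian_product)
    qed
    have "(\<Sum>A\<in>?S. f1 A) = (\<Sum>A\<in>{A \<in> ?S. m / 2 \<le> ?D L A}. ?w A)"
      unfolding f1_def by (rule sum.inter_filter[OF fin(1), symmetric])
    also have "{A \<in> ?S. m / 2 \<le> ?D L A} = {A. A \<in> paths 0 n \<and> z \<in> A \<and> m / 2 \<le> ?D L A}" by auto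
    finally have "(\<Sum>A\<in>?S. f1 A) \<le> path_mass p W 0 n {z} * gap_family_sum p W n L a b (m / 2)"
      using long_gaps_mass[of W n z "m / 2" L a b, OF W] by simp
    hence "(\<Sum>A\<in>?S. f1 A) * (\<Sum>B\<in>paths 0 n. ?w B) \<le>
        path_mass p W 0 n {z} * gap_family_sum p W n L a b (m / 2) * path_sum p W 0 n"
      unfolding path_sum_def by (intro mult_right_mono sum_nonneg wp)
    thus "(\<Sum>(A, B)\<in>?J. f1 A * ?w B) \<le>
        path_mass p W 0 n {z} * gap_family_sum p W n L a b (m / 2) * path_sum p W 0 n"
      using prod[of f1 ?w, OF f0(1) wp] by linarith
    have "(\<Sum>B\<in>paths 0 n. f2 B) = (\<Sum>B\<in>{B \<in> paths 0 n. m / (8 * real L) \<le> ?D L' B}. ?w B)"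
      unfolding f2_def by (rule sum.inter_filter[symmetric]) simp
    \<comment> \<open>\<open>B\<close> carries no mark; the point 0, common to all paths, takes its
      place.\<close>
    also have "{B \<in> paths 0 n. m / (8 * real L) \<le> ?D L' B} =
        {A. A \<in> paths 0 n \<and> 0 \<in> A \<and> m / (8 * real L) \<le> ?D L' A}" by (auto simp: paths_def)
    also have "(\<Sum>B\<in>\<dots>. ?w B) \<le> path_mass p W 0 n {0} * gap_family_sum p W n L' a b (m / (8 * real L))"
      by (rule long_gaps_mass[of W, OF W])
    also have "path_mass p W 0 n {0} = path_sum p W 0 n"
      unfolding path_mass_def path_sum_def by (rule sum.cong) (auto simp: paths_def)
    finally have "(\<Sum>A\<in>?S. ?w A) * (\<Sum>B\<in>paths 0 n. f2 B) \<le>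
        path_mass p W 0 n {z} * (path_sum p W 0 n * gap_family_sum p W n L' a b (m / (8 * real L)))"
      unfolding path_mass_def[of p W 0 n "{z}"]
      by (simp add: mult_left_mono sum_nonneg wp)
    thus "(\<Sum>(A, B)\<in>?J. ?w A * f2 B) \<le>
        path_mass p W 0 n {z} * (path_sum p W 0 n * gap_family_sum p W n L' a b (m / (8 * real L)))"
      using prod[of ?w f2, OF wp f0(2)] by linarith
  qed
  finally show ?thesis by (simp add: q_def algebra_simps)
qed

lemma path_mass_pos:
  assumes W: "\<And>x. 0 < W x" and D: "s \<le> t" "D \<subseteq> {s..t}"
  shows "0 < path_mass p W s t D"
  unfolding path_mass_def
proof (rule sum_pos)
  show "{A. A \<in> paths s t \<and> D \<subseteq> A} \<noteq> {}" using D by (auto intro!: exI[of _ "{s..t}"] simp: paths_def)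
  show "finite {A. A \<in> paths s t \<and> D \<subseteq> A}" by (rule finite_subset[OF _ finite_paths[of s t]]) auto
qed (rule path_weight_pos[of W, OF W])

lemma avoiding_mass_trivial:
  assumes W: "\<And>x. 0 < W x"
  shows "avoiding_mass p W s t a b c \<le> path_mass p W s t {c} * path_sum p W s t"
proof -
  have "avoiding_mass p W s t a b c \<le>
      (\<Sum>(A, B)\<in>{A. A \<in> paths s t \<and> {c} \<subseteq> A} \<times> paths s t. path_weight p W s t A * path_weight p W s t B)"
    unfolding avoiding_mass_def
    by (rule sum_mono2) (auto intro!: mult_nonneg_nonneg less_imp_le[OF path_weight_pos] W)
  thus ?thesis by (simp add: path_mass_def path_sum_def sum_product sum.cartesian_product)
qed

text \<open>The bound depends on the weights only through \<open>W0\<close>, hence it is uniform over all \<open>W \<ge> W0\<close>.\<close>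

lemma covariance_ratio_le:
  assumes W0: "\<And>x. 0 < W0 x" and W: "\<And>x. W0 x \<le> W x" and ab: "a \<le> b" "b \<le> n"
    and c: "0 \<le> c" "\<And>i j. 1 \<le> i \<Longrightarrow> i \<le> L' \<Longrightarrow> 1 \<le> j \<Longrightarrow> j \<le> L' \<Longrightarrow> c \<le> p i * p j * w"
    and L: "1 \<le> L" and m: "m = real (b - a)"
  defines "Z \<equiv> path_sum p W 0 n"
  defines "E \<equiv> \<lambda>D. path_mass p W 0 n D / Z"
  shows "\<bar>E {a, b} - E {a} * E {b}\<bar> / min (E {a}) (E {b}) \<le>
    (1 + c) powr (1 - m / (4 * real L))
    + of_bool (m / (8 * real L) < real (card {y \<in> {a<..<b}. W0 y < w}))
    + min 1 (gap_family_sum p W0 n L a b (m / 2))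
    + min 1 (gap_family_sum p W0 n L' a b (m / (8 * real L)))" (is "_ \<le> ?R")
proof -
  have Wp: "0 < W x" for x using W0[of x] W[of x] by linarith
  have Z: "0 < Z" unfolding Z_def by (rule path_sum_pos[of W, OF Wp]) simp
  have R0: "0 \<le> (1 + c) powr (1 - m / (4 * real L))"
    "0 \<le> gap_family_sum p W0 n L a b (m / 2)" "0 \<le> gap_family_sum p W0 n L' a b (m / (8 * real L))"
    by (simp_all add: gap_family_sum_nonneg[of W0, OF W0])
  have le: "avoiding_mass p W 0 n a b z \<le> path_mass p W 0 n {z} * Z * ?R" if z: "z \<in> {a, b}" for z
  proof -
    have M: "0 < path_mass p W 0 n {z} * Z"
      using path_mass_pos[of W 0 n "{z}", OF Wp] z ab Z by auto
    have triv: "path_mass p W 0 n {z} * Z * 1 \<le> path_mass p W 0 n {z} * Z * ?R" if "1 \<le> ?R"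
      using M that by (intro mult_left_mono) auto
    show ?thesis
    \<comment> \<open>Either the trivial bound is enough, or the indicator is 0 and no minimum is
      attained at 1, so that the sums themselves stand in \<open>?R\<close>.\<close>
    proof (cases "1 \<le> ?R")
      case True
      thus ?thesis using triv avoiding_mass_trivial[of W 0 n a b z, OF Wp] by (simp add: Z_def)
    next
      case False
      hence small: "real (card {y \<in> {a<..<b}. W0 y < w}) \<le> m / (8 * real L)"
        "gap_family_sum p W0 n L a b (m / 2) < 1" "gap_family_sum p W0 n L' a b (m / (8 * real L)) < 1"
        using R0 by (auto simp: of_bool_def min_def split: if_splits)
      have "card {y \<in> {a<..<b}. W y < w} \<le> card {y \<in> {a<..<b}. W0 y < w}"
        using W by (intro card_mono) (auto intro: le_less_trans)
      hence bad: "real (card {y \<in> {a<..<b}. W y < w}) \<le> m / (8 * real L)" using small(1) by linarith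
      have "avoiding_mass p W 0 n a b z \<le> path_mass p W 0 n {z} * Z *
          ((1 + c) powr (1 - m / (4 * real L)) + gap_family_sum p W n L a b (m / 2)
            + gap_family_sum p W n L' a b (m / (8 * real L)))"
        unfolding Z_def by (rule avoiding_mass_le[of W, OF Wp ab c L m bad])
      also have "\<dots> \<le> path_mass p W 0 n {z} * Z * ?R"
        using small M gap_family_sum_antimono[of W0 W n L a b "m / 2", OF W0 W]
          gap_family_sum_antimono[of W0 W n L' a b "m / (8 * real L)", OF W0 W]
        by (intro mult_left_mono) auto
      finally show ?thesis .
    qed
  qed
  have "\<bar>E {a, b} - E {a} * E {b}\<bar> = \<bar>Z * path_mass p W 0 n {a, b} - path_mass p W 0 n {a} * path_mass p W 0 n {b}\<bar> / Z\<^sup>2"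
  proof -
    have "E {a, b} - E {a} * E {b} = (Z * path_mass p W 0 n {a, b} - path_mass p W 0 n {a} * path_mass p W 0 n {b}) / Z\<^sup>2"
      using Z by (simp add: E_def field_simps power2_eq_square)
    thus ?thesis by (simp add: abs_divide)
  qed
  \<comment> \<open>Dividing by the square of \<open>Z\<close> leaves one mean \<open>E {z}\<close>.
    Both choices of \<open>z\<close> are possible, hence the minimum.\<close>
  hence "\<bar>E {a, b} - E {a} * E {b}\<bar> \<le> E {z} * ?R" if z: "z \<in> {a, b}" for z
    using order_trans[OF covariance_le_avoiding_mass[of W z a b 0 n, OF Wp z] le[OF z]] Z
    by (simp add: Z_def[symmetric] E_def divide_simps power2_eq_square mult_ac)
  hence "\<bar>E {a, b} - E {a} * E {b}\<bar> \<le> min (E {a}) (E {b}) * ?R" by (simp add: min_def)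
  moreover have "0 < E {z}" if "z \<in> {a, b}" for z
    using path_mass_pos[of W 0 n "{z}", OF Wp] that ab Z by (auto simp: E_def)
  ultimately show ?thesis by (simp add: pos_divide_le_eq mult.commute)
qed

end

section \<open>The renewal process as a random path\<close>

text \<open>Independence of the \<open>T i\<close> is indexed by the number of the renewal, the
  weight of a path by its gaps. The increasing enumeration translates one into the other.\<close>

lemma sorted_list_of_path:
  assumes A: "A \<in> paths 0 n" and n: "1 \<le> n"
  defines "xs \<equiv> sorted_list_of_set A"
  shows "sorted_wrt (<) xs" "set xs = A" "2 \<le> length xs" "xs ! 0 = 0" "xs ! (length xs - 1) = n"
    "gap_weight p A = (\<Prod>i\<in>{1..<length xs}. p (xs ! i - xs ! (i - 1)))"
proof -
  have fin: "finite A" by (rule finite_path[OF A])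
  show sorted: "sorted_wrt (<) xs" and set: "set xs = A"
    unfolding xs_def using fin by (auto simp: strict_sorted_list_of_set)
  have len: "length xs = card A" by (simp add: xs_def)
  have "card {0, n} \<le> card A" using A fin by (intro card_mono) (auto simp: paths_def)
  thus l2: "2 \<le> length xs" using n len by simp
  have mono: "xs ! i < xs ! j" if "i < j" "j < length xs" for i j
    using sorted that by (simp add: sorted_wrt_iff_nth_less)
  have memA: "x \<in> A \<longleftrightarrow> (\<exists>i<length xs. x = xs ! i)" for x
    unfolding set[symmetric] by (auto simp: in_set_conv_nth)
  obtain i where i: "i < length xs" "0 = xs ! i" using memA[of 0] A by (auto simp: paths_def)
  show "xs ! 0 = 0" using mono[of 0 i] i by (cases "i = 0") auto
  obtain j where j: "j < length xs" "n = xs ! j" using memA[of n] A by (auto simp: paths_def)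
  have "xs ! (length xs - 1) \<in> A" unfolding memA using l2 by (intro exI[of _ "length xs - 1"]) auto
  hence "xs ! (length xs - 1) \<le> n" using A by (auto simp: paths_def)
  thus "xs ! (length xs - 1) = n"
  proof (rule le_antisym)
    have "j = length xs - 1 \<or> j < length xs - 1" "length xs - 1 < length xs" using j l2 by linarith+
    thus "n \<le> xs ! (length xs - 1)" using mono[of j "length xs - 1"] j by auto
  qed
  have gaps: "gaps A = (\<lambda>i. (xs ! (i - 1), xs ! i)) ` {1..<length xs}"
  proof (intro equalityI subsetI)
    fix g assume "g \<in> gaps A"
    then obtain u v where g: "g = (u, v)" "(u, v) \<in> gaps A" by (metis surj_pair)
    obtain i j where ij: "i < length xs" "u = xs ! i" "j < length xs" "v = xs ! j"
      using g memA by (auto simp: gaps_def)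
    have "u < v" using g by (auto simp: gaps_def)
    hence "i < j" using mono[of j i] ij by (cases i j rule: linorder_cases) auto
    have "j = Suc i"
    proof (rule ccontr)
      assume "j \<noteq> Suc i"
      hence k: "Suc i < j" using \<open>i < j\<close> by simp
      hence "u < xs ! Suc i" "xs ! Suc i < v" using mono ij by auto
      moreover have "xs ! Suc i \<in> A" unfolding memA using k ij by (intro exI[of _ "Suc i"]) auto
      ultimately show False using gap_dichotomy[OF g(2), of "xs ! Suc i"] by auto
    qed
    thus "g \<in> (\<lambda>i. (xs ! (i - 1), xs ! i)) ` {1..<length xs}" using g ij by (intro image_eqI[of _ _ j]) auto
  next
    fix g assume "g \<in> (\<lambda>i. (xs ! (i - 1), xs ! i)) ` {1..<length xs}"
    then obtain i where i: "1 \<le> i" "i < length xs" "g = (xs ! (i - 1), xs ! i)" by auto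
    have "xs ! k \<notin> {xs ! (i - 1)<..<xs ! i}" if "k < length xs" for k
    proof (cases "k < i")
      case True
      hence "k = i - 1 \<or> k < i - 1" by auto
      moreover have "i - 1 < length xs" using i by linarith
      ultimately show ?thesis using mono[of k "i - 1"] by auto
    next
      case False
      hence "k = i \<or> i < k" by auto
      thus ?thesis using mono[of i k] that by auto
    qed
    hence "x \<notin> {xs ! (i - 1)<..<xs ! i}" if "x \<in> A" for x using that unfolding memA by metis
    hence "{xs ! (i - 1)<..<xs ! i} \<inter> A = {}" by (intro Int_emptyI) metis
    moreover have "xs ! (i - 1) \<in> A" "xs ! i \<in> A" unfolding set[symmetric] using i by auto
    moreover have "xs ! (i - 1) < xs ! i" using i by (intro mono) auto
    ultimately show "g \<in> gaps A" using i(3) by (simp add: gaps_def)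
  qed
  have inj: "inj_on (\<lambda>i. (xs ! (i - 1), xs ! i)) {1..<length xs}"
  proof (rule inj_onI)
    fix i j assume "i \<in> {1..<length xs}" "j \<in> {1..<length xs}" "(xs ! (i - 1), xs ! i) = (xs ! (j - 1), xs ! j)"
    thus "i = j" using mono[of i j] mono[of j i] by (cases i j rule: linorder_cases) auto
  qed
  show "gap_weight p A = (\<Prod>i\<in>{1..<length xs}. p (xs ! i - xs ! (i - 1)))"
    unfolding gap_weight_def gaps by (subst prod.reindex[OF inj]) simp
qed

context renewal_process begin

definition gap_prob :: "nat \<Rightarrow> real" where
  "gap_prob t = prob {x \<in> space M. T 1 x = t}"

sublocale gap_law gap_prob
  by standard (auto simp: gap_prob_def law_pos simp del: One_nat_def)

lemma T_measurable [measurable]: "1 \<le> i \<Longrightarrow> T i \<in> measurable M (count_space UNIV)"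
  using indep by (simp add: indep_vars_def)

lemma prob_T: "1 \<le> i \<Longrightarrow> prob {x \<in> space M. T i x = t} = gap_prob t"
proof -
  assume i: "1 \<le> i"
  have "prob {x \<in> space M. T i x = t} = measure (distr M (count_space UNIV) (T i)) {t}"
    by (subst measure_distr) (use i in \<open>auto intro!: arg_cong[of _ _ prob]\<close>)
  also have "\<dots> = measure (distr M (count_space UNIV) (T 1)) {t}"
    using identically_distributed[OF i] by simp
  also have "\<dots> = gap_prob t" unfolding gap_prob_def
    by (subst measure_distr) (auto intro!: arg_cong[of _ _ prob])
  finally show ?thesis .
qed

definition contact_set :: "nat \<Rightarrow> 'a \<Rightarrow> nat set" where
  "contact_set n x = range (\<lambda>i. renewal_time T i x) \<inter> {..n}"

lemma renewal_time_0: "renewal_time T 0 x = 0"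
  by (simp add: renewal_time_def)

lemma renewal_time_Suc: "renewal_time T (Suc i) x = renewal_time T i x + T (Suc i) x"
  by (simp add: renewal_time_def)

lemma renewal_time_strict_mono: "x \<in> space M \<Longrightarrow> strict_mono (\<lambda>i. renewal_time T i x)"
  unfolding strict_mono_Suc_iff renewal_time_Suc using values_pos[of "Suc _" x] by (simp add: Suc_le_eq)

text \<open>Only the first \<open>length xs - 1\<close> inter-arrival times are constrained: once a
  renewal sits at \<open>n\<close>, the next one exceeds \<open>n\<close> by itself.\<close>

lemma contact_set_eq_iff:
  assumes x: "x \<in> space M" and A: "A \<in> paths 0 n" and n: "1 \<le> n"
  defines "xs \<equiv> sorted_list_of_set A"
  shows "contact_set n x = A \<longleftrightarrow> (\<forall>i\<in>{1..<length xs}. T i x = xs ! i - xs ! (i - 1))"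
proof
  note xs = sorted_list_of_path[OF A n, folded xs_def]
  let ?r = "\<lambda>i. renewal_time T i x"
  have mono: "?r i < ?r j \<longleftrightarrow> i < j" for i j
    using strict_mono_less[OF renewal_time_strict_mono[OF x]] by simp
  have lenpos: "length xs \<noteq> 0" using xs(3) by linarith
  {
    assume tr: "contact_set n x = A"
    define m where "m = (LEAST i. n < ?r i)"
    have "n < ?r (Suc n)" using strict_mono_imp_increasing[OF renewal_time_strict_mono[OF x], of "Suc n"] by auto
    hence m: "n < ?r m" unfolding m_def by (rule LeastI)
    have m': "?r i \<le> n" if "i < m" for i using not_less_Least[of i "\<lambda>i. n < ?r i"] that by (auto simp: m_def)
    have iff: "?r i \<le> n \<longleftrightarrow> i < m" for i
      using m m' mono[of m i] by (metis leD leI less_trans order_le_less mono)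
    have "A = ?r ` {..<m}" unfolding tr[symmetric] contact_set_def using iff by auto
    hence "set (map ?r [0..<m]) = A" by auto
    moreover have "sorted_wrt (<) (map ?r [0..<m])"
      by (simp add: sorted_wrt_map mono sorted_wrt_iff_nth_less)
    ultimately have eq: "map ?r [0..<m] = xs"
      using xs(1,2) by (metis strict_sorted_equal)
    hence "length xs = m" by auto
    hence r: "?r i = xs ! i" if "i < length xs" for i using arg_cong[OF eq, of "\<lambda>l. l ! i"] that \<open>length xs = m\<close> by simp
    show "\<forall>i\<in>{1..<length xs}. T i x = xs ! i - xs ! (i - 1)"
    proof
      fix i assume i: "i \<in> {1..<length xs}"
      then obtain j where j: "i = Suc j" by (cases i) auto
      show "T i x = xs ! i - xs ! (i - 1)" using r[of i] r[of j] i renewal_time_Suc[of j x] unfolding j by auto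
    qed
  }
  {
    assume T: "\<forall>i\<in>{1..<length xs}. T i x = xs ! i - xs ! (i - 1)"
    have r: "i < length xs \<Longrightarrow> ?r i = xs ! i" for i
    proof (induction i)
      case 0
      then show ?case by (simp add: renewal_time_0 xs)
    next
      case (Suc i)
      have "xs ! i < xs ! Suc i" using xs(1) Suc.prems by (simp add: sorted_wrt_iff_nth_less)
      thus ?case using Suc T[rule_format, of "Suc i"] by (simp add: renewal_time_Suc)
    qed
    have n': "?r (length xs - 1) = n" using r[of "length xs - 1"] xs lenpos by simp
    have "?r i \<le> n \<longleftrightarrow> i < length xs" for i
    proof -
      have "?r i \<le> n \<longleftrightarrow> i \<le> length xs - 1"
        using strict_mono_less_eq[OF renewal_time_strict_mono[OF x]] n' by metis
      also have "\<dots> \<longleftrightarrow> i < length xs" using lenpos by linarith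
      finally show ?thesis .
    qed
    hence "contact_set n x = ?r ` {..<length xs}" by (auto simp: contact_set_def)
    also have "\<dots> = (!) xs ` {..<length xs}" using r by (intro image_cong) auto
    also have "\<dots> = set xs" by (auto simp: set_conv_nth)
    finally show "contact_set n x = A" using xs(2) by simp
  }
qed

lemma prob_contact_set:
  assumes A: "A \<in> paths 0 n" and n: "1 \<le> n"
  shows "{x \<in> space M. contact_set n x = A} \<in> events" "prob {x \<in> space M. contact_set n x = A} = gap_weight gap_prob A"
proof -
  define xs where "xs = sorted_list_of_set A"
  note xs = sorted_list_of_path[OF A n, folded xs_def]
  let ?I = "{1..<length xs}"
  let ?Y = "\<lambda>i. {xs ! i - xs ! (i - 1)}"
  have ne: "?I \<noteq> {}" using xs(3) by auto
  have eq: "{x \<in> space M. contact_set n x = A} = (\<Inter>i\<in>?I. T i -` ?Y i \<inter> space M)"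
    using contact_set_eq_iff[OF _ A n, folded xs_def] ne by auto
  show "{x \<in> space M. contact_set n x = A} \<in> events" unfolding eq
    by (rule sets.finite_INT) (use ne in \<open>auto intro!: measurable_sets[OF T_measurable]\<close>)
  have "prob (\<Inter>i\<in>?I. T i -` ?Y i \<inter> space M) = (\<Prod>i\<in>?I. prob (T i -` ?Y i \<inter> space M))"
    by (rule indep_varsD[OF indep]) (use ne in auto)
  also have "\<dots> = (\<Prod>i\<in>?I. gap_prob (xs ! i - xs ! (i - 1)))"
  proof (rule prod.cong)
    fix i assume "i \<in> ?I"
    have "T i -` ?Y i \<inter> space M = {x \<in> space M. T i x = xs ! i - xs ! (i - 1)}" by auto
    thus "prob (T i -` ?Y i \<inter> space M) = gap_prob (xs ! i - xs ! (i - 1))"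
      using prob_T[of i] \<open>i \<in> ?I\<close> by simp
  qed simp
  finally show "prob {x \<in> space M. contact_set n x = A} = gap_weight gap_prob A"
    unfolding eq xs(6) .
qed

lemma contact_eq: "a \<le> n \<Longrightarrow> contact T a x = of_bool (a \<in> contact_set n x)"
  by (simp add: contact_def contact_set_def)

text \<open>The factor of the endpoint \<open>n\<close> is split off to match
  \<open>path_weight\<close>, which charges interior points only; it cancels in Gibbs averages. The
  point 0 is never weighted.\<close>

lemma pinning_weight_eq:
  assumes n: "1 \<le> n"
  shows "pinning_weight T n h \<omega> x =
    of_bool (contact_set n x \<in> paths 0 n) * (exp (h + \<omega> n) * (\<Prod>y\<in>contact_set n x \<inter> {0<..<n}. exp (h + \<omega> y)))"
proof (cases "n \<in> contact_set n x")
  case True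
  have "0 \<in> contact_set n x" using renewal_time_0[of x] by (auto simp: contact_set_def intro!: rev_image_eqI[of 0])
  hence tr: "contact_set n x \<in> paths 0 n" using True by (auto simp: paths_def contact_set_def)
  have "(\<Sum>a=1..n. (h + \<omega> a) * contact T a x) = (\<Sum>a\<in>contact_set n x \<inter> {1..n}. h + \<omega> a)"
    by (rule sum.mono_neutral_cong_right) (auto simp: contact_eq[of _ n])
  also have "contact_set n x \<inter> {1..n} = insert n (contact_set n x \<inter> {0<..<n})" using True n by auto
  also have "(\<Sum>a\<in>\<dots>. h + \<omega> a) = h + \<omega> n + (\<Sum>y\<in>contact_set n x \<inter> {0<..<n}. h + \<omega> y)"
    by (subst sum.insert) auto
  finally show ?thesis using True tr by (simp add: pinning_weight_def contact_eq[of n n] exp_add exp_sum)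
next
  case False
  thus ?thesis by (auto simp: pinning_weight_def contact_eq[of n n] paths_def)
qed

lemma integral_pinning_weight:
  assumes n: "1 \<le> n"
  shows "(\<integral>x. pinning_weight T n h \<omega> x * F (contact_set n x) \<partial>M) =
    exp (h + \<omega> n) * (\<Sum>A\<in>paths 0 n. path_weight gap_prob (\<lambda>y. exp (h + \<omega> y)) 0 n A * F A)"
proof -
  let ?E = "\<lambda>A. {x \<in> space M. contact_set n x = A}"
  let ?c = "\<lambda>A. exp (h + \<omega> n) * (\<Prod>y\<in>A \<inter> {0<..<n}. exp (h + \<omega> y)) * F A"
  have "(\<integral>x. pinning_weight T n h \<omega> x * F (contact_set n x) \<partial>M) = (\<integral>x. (\<Sum>A\<in>paths 0 n. indicator (?E A) x * ?c A) \<partial>M)"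
  proof (rule Bochner_Integration.integral_cong[OF refl])
    fix x assume x: "x \<in> space M"
    have "(\<Sum>A\<in>paths 0 n. indicator (?E A) x * ?c A) = (\<Sum>A\<in>paths 0 n. if contact_set n x = A then ?c A else 0)"
      by (rule sum.cong) (auto simp: x indicator_def)
    thus "pinning_weight T n h \<omega> x * F (contact_set n x) = (\<Sum>A\<in>paths 0 n. indicator (?E A) x * ?c A)"
      by (simp add: pinning_weight_eq[OF n])
  qed
  also have "\<dots> = (\<Sum>A\<in>paths 0 n. \<integral>x. indicator (?E A) x * ?c A \<partial>M)"
    by (rule Bochner_Integration.integral_sum) (use prob_contact_set(1)[OF _ n] in
      \<open>auto intro!: integrable_mult_left integrable_real_indicator simp: less_top[symmetric]\<close>)
  also have "\<dots> = (\<Sum>A\<in>paths 0 n. gap_weight gap_prob A * ?c A)"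
    by (rule sum.cong) (use prob_contact_set[OF _ n] in auto)
  finally show ?thesis by (simp add: path_weight_def sum_distrib_left mult_ac)
qed

lemma partition_function_eq:
  assumes "1 \<le> n"
  shows "partition_function M T n h \<omega> = exp (h + \<omega> n) * path_sum gap_prob (\<lambda>y. exp (h + \<omega> y)) 0 n"
  using integral_pinning_weight[OF assms, of h \<omega> "\<lambda>_. 1"]
  by (simp add: partition_function_def path_sum_def)

lemma contact_measurable [measurable]: "contact T a \<in> borel_measurable M"
proof -
  have [measurable]: "(\<lambda>x. real (renewal_time T i x)) \<in> borel_measurable M" for i
    unfolding renewal_time_def of_nat_sum by measurable
  have "{x \<in> space M. a \<in> range (\<lambda>i. renewal_time T i x)} =
      (\<Union>i. {x \<in> space M. real (renewal_time T i x) = real a})" by auto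
  moreover have "(\<Union>i. {x \<in> space M. real (renewal_time T i x) = real a}) \<in> events" by measurable
  ultimately have [measurable]: "{x \<in> space M. a \<in> range (\<lambda>i. renewal_time T i x)} \<in> events" by simp
  thus ?thesis unfolding contact_def[abs_def] by measurable
qed

lemma integral_gibbs:
  fixes h \<omega>
  assumes n: "1 \<le> n" and f: "f \<in> borel_measurable M" "\<And>x. x \<in> space M \<Longrightarrow> f x = F (contact_set n x)"
  defines "W \<equiv> \<lambda>y. exp (h + \<omega> y)"
  shows "(\<integral>x. f x \<partial>gibbs M T n h \<omega>) =
    (\<Sum>A\<in>paths 0 n. path_weight gap_prob W 0 n A * F A) / path_sum gap_prob W 0 n"
proof -
  have Z: "0 < path_sum gap_prob W 0 n" by (rule path_sum_pos) (auto simp: W_def)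
  have Z': "partition_function M T n h \<omega> = exp (h + \<omega> n) * path_sum gap_prob W 0 n"
    unfolding W_def by (rule partition_function_eq[OF n])
  have pos: "0 \<le> pinning_weight T n h \<omega> x / partition_function M T n h \<omega>" for x
    using Z unfolding Z' by (simp add: pinning_weight_def contact_def)
  have [measurable]: "pinning_weight T n h \<omega> \<in> borel_measurable M"
    unfolding pinning_weight_def[abs_def] by measurable
  have "(\<integral>x. f x \<partial>gibbs M T n h \<omega>) =
      (\<integral>x. (pinning_weight T n h \<omega> x / partition_function M T n h \<omega>) *\<^sub>R f x \<partial>M)"
    unfolding gibbs_def by (rule integral_density) (use f pos in auto)
  also have "\<dots> = (\<integral>x. (pinning_weight T n h \<omega> x * F (contact_set n x)) / partition_function M T n h \<omega> \<partial>M)"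
    by (rule Bochner_Integration.integral_cong) (use f in auto)
  also have "\<dots> = (\<integral>x. pinning_weight T n h \<omega> x * F (contact_set n x) \<partial>M) / partition_function M T n h \<omega>"
    by simp
  finally show ?thesis unfolding integral_pinning_weight[OF n] Z' W_def by simp
qed

lemma cov_ratio_eq:
  fixes h \<omega>
  assumes n: "1 \<le> n" "a \<le> n" "b \<le> n"
  defines "W \<equiv> \<lambda>y. exp (h + \<omega> y)"
  defines "E \<equiv> \<lambda>D. path_mass gap_prob W 0 n D / path_sum gap_prob W 0 n"
  shows "cov_ratio M T n h \<omega> a b =
    \<bar>E {a, b} - E {a} * E {b}\<bar> / min (E {a}) (E {b})"
proof -
  let ?w = "path_weight gap_prob W 0 n"
  define Z where "Z = path_sum gap_prob W 0 n"
  have Z: "0 < Z" unfolding Z_def W_def by (rule path_sum_pos) auto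
  have mass: "(\<Sum>A\<in>paths 0 n. ?w A * of_bool (D \<subseteq> A)) = Z * E D" for D
  proof -
    have "(\<Sum>A\<in>paths 0 n. ?w A * of_bool (D \<subseteq> A)) = path_mass gap_prob W 0 n D"
      unfolding path_mass_def using sum.inter_filter[of "paths 0 n" ?w "\<lambda>A. D \<subseteq> A"]
      by (simp add: of_bool_def if_distrib[of "\<lambda>x. _ * x"] cong: if_cong)
    thus ?thesis using Z by (simp add: E_def Z_def)
  qed
  have mean: "(\<integral>x. contact T c x \<partial>gibbs M T n h \<omega>) = E {c}" if "c \<le> n" for c
  proof -
    have "(\<integral>x. contact T c x \<partial>gibbs M T n h \<omega>) = (\<Sum>A\<in>paths 0 n. ?w A * of_bool ({c} \<subseteq> A)) / Z"
      unfolding Z_def W_def by (rule integral_gibbs[OF n(1) contact_measurable]) (simp add: contact_eq[OF that])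
    thus ?thesis using Z unfolding mass by simp
  qed
  have "covariance (gibbs M T n h \<omega>) (contact T a) (contact T b) =
      (\<integral>x. (contact T a x - E {a}) * (contact T b x - E {b}) \<partial>gibbs M T n h \<omega>)"
    unfolding covariance_def mean[OF n(2)] mean[OF n(3)] ..
  also have "\<dots> = (\<Sum>A\<in>paths 0 n. ?w A * ((of_bool (a \<in> A) - E {a}) * (of_bool (b \<in> A) - E {b}))) / Z"
    unfolding Z_def W_def 
    by (rule integral_gibbs[OF n(1)]) (measurable, simp add: contact_eq[OF n(2)] contact_eq[OF n(3)])
  also have "(\<Sum>A\<in>paths 0 n. ?w A * ((of_bool (a \<in> A) - E {a}) * (of_bool (b \<in> A) - E {b}))) =
      Z * E {a, b} - E {a} * (Z * E {b}) - E {b} * (Z * E {a}) + E {a} * E {b} * (\<Sum>A\<in>paths 0 n. ?w A)"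
    unfolding mass[symmetric]
    unfolding sum_distrib_left sum.distrib[symmetric] sum_subtractf[symmetric]
    by (rule sum.cong) (auto simp: algebra_simps)
  also have "(\<Sum>A\<in>paths 0 n. ?w A) = Z" by (simp add: Z_def path_sum_def)
  also have "(Z * E {a, b} - E {a} * (Z * E {b}) - E {b} * (Z * E {a}) + E {a} * E {b} * Z) / Z
      = E {a, b} - E {a} * E {b}"
    using Z by (simp add: field_simps)
  finally have "covariance (gibbs M T n h \<omega>) (contact T a) (contact T b) = E {a, b} - E {a} * E {b}" .
  thus ?thesis unfolding cov_ratio_def mean[OF n(2)] mean[OF n(3)] by simp
qed

end

section \<open>Gaussian sequences\<close>

lemma normal_distribution_eq_distr:
  assumes s: "0 < s"
  shows "density lborel (normal_density 0 s) = distr std_normal_distribution borel (\<lambda>x. s * x)"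
proof -
  interpret prob_space std_normal_distribution by (rule prob_space_normal_density) simp
  have "distributed std_normal_distribution lborel (\<lambda>x. x) std_normal_density"
    by (simp add: distributed_def distr_id2)
  from normal_density_affine[OF this, of s 0] s
  have "distr std_normal_distribution lborel (\<lambda>x. s * x) = density lborel (normal_density 0 s)"
    by (simp add: distributed_def)
  moreover have "distr std_normal_distribution lborel (\<lambda>x. s * x) = distr std_normal_distribution borel (\<lambda>x. s * x)"
    by (rule distr_cong) auto
  ultimately show ?thesis by simp
qed

text \<open>Expressing everything through the second moment \<open>v\<close> treats the degenerate
  law and the normal ones alike. The exponential moment is a nonnegative integral, so no
  integrability has to be settled first.\<close>

lemma centered_gaussian_law:
  assumes g: "gaussian_law \<mu>" and mean: "(\<integral>x. x \<partial>\<mu>) = 0"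
  defines "v \<equiv> (\<integral>x. x\<^sup>2 \<partial>\<mu>)"
  shows "integrable \<mu> (\<lambda>x. x)" "integrable \<mu> (\<lambda>x. x\<^sup>2)"
    "(\<integral>\<^sup>+x. ennreal (exp (t * x)) \<partial>\<mu>) = ennreal (exp (t\<^sup>2 * v / 2))"
    "char \<mu> t = exp (- (t\<^sup>2 * v / 2))"
proof -
  consider (deg) m where "\<mu> = return borel m"
    | (normal) m s where "0 < s" "\<mu> = density lborel (normal_density m s)"
    using g by (auto simp: gaussian_law_def)
  hence "integrable \<mu> (\<lambda>x. x) \<and> integrable \<mu> (\<lambda>x. x\<^sup>2) \<and>
    (\<integral>\<^sup>+x. ennreal (exp (t * x)) \<partial>\<mu>) = ennreal (exp (t\<^sup>2 * v / 2)) \<and>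
    char \<mu> t = exp (- (t\<^sup>2 * v / 2))"
  proof cases
    case deg
    interpret prob_space "return borel m" by (rule prob_space_return) simp
    have m: "m = 0" using mean unfolding deg by (simp add: integral_return)
    have v: "v = 0" unfolding v_def deg m by (simp add: integral_return)
    have i: "integrable (return borel m) f" if "f \<in> borel_measurable borel" for f :: "real \<Rightarrow> real"
      using that by (simp add: integrable_iff_bounded nn_integral_return)
    have "integrable \<mu> (\<lambda>x. x)" "integrable \<mu> (\<lambda>x. x\<^sup>2)" unfolding deg by (intro i; simp)+
    moreover have "(\<integral>\<^sup>+x. ennreal (exp (t * x)) \<partial>\<mu>) = ennreal (exp (t\<^sup>2 * v / 2))"
      unfolding deg m v by (subst nn_integral_return) auto
    moreover have "char \<mu> t = exp (- (t\<^sup>2 * v / 2))"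
      unfolding deg m v char_def by (subst integral_return) auto
    ultimately show ?thesis by simp
  next
    case normal
    have "(\<integral>x. x \<partial>\<mu>) = (\<integral>x. normal_density m s x * x \<partial>lborel)"
      unfolding normal(2) by (subst integral_density) auto
    hence m: "m = 0" using mean normal_moment_nz_1[of s m] normal(1) by (simp add: has_bochner_integral_iff)
    have i1: "integrable \<mu> (\<lambda>x. x)"
      unfolding normal(2) using integrable_normal_moment_nz_1[of s m] normal(1)
      by (subst integrable_density) auto
    have i2: "integrable \<mu> (\<lambda>x. x\<^sup>2)"
      unfolding normal(2) m using integrable_normal_moment[of s 0 2] normal(1)
      by (subst integrable_density) auto
    have "v = (\<integral>x. normal_density 0 s x * x\<^sup>2 \<partial>lborel)"
      unfolding v_def normal(2) m by (subst integral_density) auto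
    also have "\<dots> = s\<^sup>2"
      using integral_normal_moment_even[of s 0 1] normal(1) by (simp add: power2_eq_square fact_numeral)
    finally have v: "v = s\<^sup>2" .
    have mgf: "(\<integral>\<^sup>+x. ennreal (exp (t * x)) \<partial>\<mu>) = ennreal (exp (t\<^sup>2 * v / 2))"
    proof -
      have eq: "normal_density 0 s x * exp (t * x) = exp (t\<^sup>2 * s\<^sup>2 / 2) * normal_density (t * s\<^sup>2) s x" for x
      proof -
        have "- (x - 0)\<^sup>2 / (2 * s\<^sup>2) + t * x = t\<^sup>2 * s\<^sup>2 / 2 + (- (x - t * s\<^sup>2)\<^sup>2 / (2 * s\<^sup>2))"
          using normal(1) by (simp add: field_simps power2_eq_square)
        thus ?thesis unfolding normal_density_def by (simp add: exp_add[symmetric] mult_ac)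
      qed
      have "(\<integral>\<^sup>+x. ennreal (exp (t * x)) \<partial>\<mu>) =
          (\<integral>\<^sup>+x. ennreal (normal_density 0 s x) * ennreal (exp (t * x)) \<partial>lborel)"
        unfolding normal(2) m by (subst nn_integral_density) auto
      also have "\<dots> = (\<integral>\<^sup>+x. ennreal (exp (t\<^sup>2 * s\<^sup>2 / 2)) * ennreal (normal_density (t * s\<^sup>2) s x) \<partial>lborel)"
        by (simp add: ennreal_mult'[symmetric] eq)
      also have "\<dots> = ennreal (exp (t\<^sup>2 * s\<^sup>2 / 2)) * (\<integral>\<^sup>+x. ennreal (normal_density (t * s\<^sup>2) s x) \<partial>lborel)"
        by (subst nn_integral_cmult) auto
      also have "(\<integral>\<^sup>+x. ennreal (normal_density (t * s\<^sup>2) s x) \<partial>lborel) = 1"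
        using normal(1) by (subst nn_integral_eq_integral) auto
      finally show ?thesis by (simp add: v)
    qed
    have "char \<mu> t = char std_normal_distribution (t * s)"
      unfolding normal(2) m normal_distribution_eq_distr[OF normal(1)] char_def
      by (subst integral_distr) (auto simp: mult_ac)
    also have "\<dots> = exp (- (t\<^sup>2 * v / 2))"
      by (simp add: char_std_normal_distribution v power_mult_distrib exp_of_real[symmetric])
    finally show ?thesis using i1 i2 mgf by simp
  qed
  thus "integrable \<mu> (\<lambda>x. x)" "integrable \<mu> (\<lambda>x. x\<^sup>2)"
    "(\<integral>\<^sup>+x. ennreal (exp (t * x)) \<partial>\<mu>) = ennreal (exp (t\<^sup>2 * v / 2))"
    "char \<mu> t = exp (- (t\<^sup>2 * v / 2))" by auto
qed

definition linear_form :: "nat \<Rightarrow> (nat \<Rightarrow> real) \<Rightarrow> (nat \<Rightarrow> real) \<Rightarrow> real" where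
  "linear_form n c \<omega> = (\<Sum>a<n. c a * \<omega> a)"

lemma coordinate_measurable [measurable]: "(\<lambda>\<omega>. \<omega> a) \<in> borel_measurable (borel :: (nat \<Rightarrow> real) measure)"
  by (intro borel_measurable_continuous_onI continuous_on_product_coordinates)

lemma linear_form_measurable [measurable]: "linear_form n c \<in> borel_measurable borel"
  unfolding linear_form_def[abs_def] by measurable

context gaussian_disorder begin

lemma measurable_P: "f \<in> measurable borel N \<Longrightarrow> f \<in> measurable P N"
  using measurable_cong_sets[OF sets_P refl] by auto

lemma coordinate_measurable_P [measurable]: "(\<lambda>\<omega>. \<omega> a) \<in> borel_measurable P"
  by (rule measurable_P) measurable

lemma linear_form_measurable_P [measurable]: "linear_form n c \<in> borel_measurable P"
  by (rule measurable_P) measurable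

lemma space_P [simp]: "space P = UNIV"
  using sets_eq_imp_space_eq[OF sets_P] by simp

definition moment2 :: "nat \<Rightarrow> nat \<Rightarrow> real" where
  "moment2 a b = (\<integral>\<omega>. \<omega> a * \<omega> b \<partial>P)"

definition form_variance :: "nat \<Rightarrow> (nat \<Rightarrow> real) \<Rightarrow> real" where
  "form_variance n c = (\<Sum>a<n. \<Sum>b<n. c a * c b * moment2 a b)"

lemma coordinate_integrable: "integrable P (\<lambda>\<omega>. \<omega> a)" "integrable P (\<lambda>\<omega>. (\<omega> a)\<^sup>2)"
proof -
  let ?c = "\<lambda>i. if i = a then 1 else 0"
  have eq: "(\<Sum>i<Suc a. ?c i * \<omega> i) = \<omega> a" for \<omega> :: "nat \<Rightarrow> real"
    by (simp add: if_distrib[of "\<lambda>x. x * _"] cong: if_cong)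
  have g: "gaussian_law (distr P borel (\<lambda>\<omega>. \<omega> a))"
    using gaussian[where n = "Suc a" and c = ?c] unfolding eq .
  have mean: "(\<integral>x. x \<partial>distr P borel (\<lambda>\<omega>. \<omega> a)) = 0"
    using centered[of a] by (subst integral_distr) auto
  show "integrable P (\<lambda>\<omega>. \<omega> a)" "integrable P (\<lambda>\<omega>. (\<omega> a)\<^sup>2)"
    using centered_gaussian_law(1,2)[OF g mean] by (simp_all add: integrable_distr_eq)
qed

lemma coordinate_product_integrable: "integrable P (\<lambda>\<omega>. \<omega> a * \<omega> b)"
proof (rule Bochner_Integration.integrable_bound)
  show "integrable P (\<lambda>\<omega>. (\<omega> a)\<^sup>2 + (\<omega> b)\<^sup>2)" using coordinate_integrable by auto
  show "AE \<omega> in P. norm (\<omega> a * \<omega> b) \<le> norm ((\<omega> a)\<^sup>2 + (\<omega> b)\<^sup>2)"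
  proof (rule AE_I2)
    fix \<omega> :: "nat \<Rightarrow> real"
    have "0 \<le> (\<bar>\<omega> a\<bar> - \<bar>\<omega> b\<bar>)\<^sup>2" by simp
    hence "2 * (\<bar>\<omega> a\<bar> * \<bar>\<omega> b\<bar>) \<le> (\<omega> a)\<^sup>2 + (\<omega> b)\<^sup>2" by (simp add: power2_diff)
    moreover have "0 \<le> \<bar>\<omega> a\<bar> * \<bar>\<omega> b\<bar>" by simp
    ultimately have "\<bar>\<omega> a * \<omega> b\<bar> \<le> (\<omega> a)\<^sup>2 + (\<omega> b)\<^sup>2" unfolding abs_mult by linarith
    thus "norm (\<omega> a * \<omega> b) \<le> norm ((\<omega> a)\<^sup>2 + (\<omega> b)\<^sup>2)" by simp
  qed
qed measurable

lemma linear_form_law: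
  "integrable P (linear_form n c)"
  "(\<integral>\<^sup>+\<omega>. ennreal (exp (linear_form n c \<omega>)) \<partial>P) = ennreal (exp (form_variance n c / 2))"
  "(\<integral>\<omega>. iexp (linear_form n c \<omega>) \<partial>P) = complex_of_real (exp (- (form_variance n c / 2)))"
proof -
  show int: "integrable P (linear_form n c)"
    unfolding linear_form_def[abs_def] using coordinate_integrable by auto
  let ?D = "distr P borel (linear_form n c)"
  have g: "gaussian_law ?D" using gaussian[of c n] unfolding linear_form_def[abs_def] .
  have "expectation (linear_form n c) = 0"
    unfolding linear_form_def[abs_def] using coordinate_integrable centered by simp
  hence mean: "(\<integral>x. x \<partial>?D) = 0" by (subst integral_distr) auto
  have "(\<integral>x. x\<^sup>2 \<partial>?D) = (\<integral>\<omega>. (linear_form n c \<omega>)\<^sup>2 \<partial>P)" by (subst integral_distr) auto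
  also have "\<dots> = (\<integral>\<omega>. (\<Sum>a<n. \<Sum>b<n. c a * c b * (\<omega> a * \<omega> b)) \<partial>P)"
    by (rule Bochner_Integration.integral_cong) (auto simp: linear_form_def power2_eq_square sum_product mult_ac)
  also have "\<dots> = form_variance n c"
    using coordinate_product_integrable by (simp add: form_variance_def moment2_def)
  finally have v: "(\<integral>x. x\<^sup>2 \<partial>?D) = form_variance n c" .
  have "(\<integral>\<^sup>+\<omega>. ennreal (exp (linear_form n c \<omega>)) \<partial>P) = (\<integral>\<^sup>+x. ennreal (exp (1 * x)) \<partial>?D)"
    by (subst nn_integral_distr) auto
  thus "(\<integral>\<^sup>+\<omega>. ennreal (exp (linear_form n c \<omega>)) \<partial>P) = ennreal (exp (form_variance n c / 2))"
    unfolding centered_gaussian_law(3)[OF g mean] v by simp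
  have "(\<integral>\<omega>. iexp (linear_form n c \<omega>) \<partial>P) = char ?D 1"
    unfolding char_def by (subst integral_distr) auto
  thus "(\<integral>\<omega>. iexp (linear_form n c \<omega>) \<partial>P) = complex_of_real (exp (- (form_variance n c / 2)))"
    unfolding centered_gaussian_law(4)[OF g mean] v by simp
qed

lemma distr_shift: "distr P borel (\<lambda>\<omega> a. \<omega> (k + a)) = P"
proof (induction k)
  case 0
  show ?case using sets_P by (simp add: distr_id2)
next
  case (Suc k)
  have m: "(\<lambda>\<omega> a. \<omega> (j + a)) \<in> measurable borel (borel :: (nat \<Rightarrow> real) measure)" for j
    by (intro borel_measurable_continuous_onI continuous_on_coordinatewise_then_product
        continuous_on_product_coordinates)
  have "distr P borel (\<lambda>\<omega> a. \<omega> (Suc k + a)) = distr (distr P borel (\<lambda>\<omega> a. \<omega> (Suc a))) borel (\<lambda>\<omega> a. \<omega> (k + a))"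
    using m[of 1] m[of k] by (subst distr_distr) (auto simp: comp_def intro!: measurable_P)
  thus ?case using Suc stationary by simp
qed

lemma shift_measurable: "(\<lambda>\<omega> a. \<omega> (k + a)) \<in> measurable P (borel :: (nat \<Rightarrow> real) measure)"
  by (intro measurable_P borel_measurable_continuous_onI continuous_on_coordinatewise_then_product
        continuous_on_product_coordinates)

lemma integral_shift:
  fixes f :: "(nat \<Rightarrow> real) \<Rightarrow> real"
  assumes "f \<in> borel_measurable borel"
  shows "(\<integral>\<omega>. f (\<lambda>a. \<omega> (k + a)) \<partial>P) = (\<integral>\<omega>. f \<omega> \<partial>P)"
  using integral_distr[OF shift_measurable assms, of k] distr_shift by simp

lemma moment2_eq: "moment2 a (a + b) = autocov P b" "moment2 (a + b) a = autocov P b"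
  using integral_shift[of "\<lambda>\<omega>. \<omega> 0 * \<omega> b" a] by (simp_all add: moment2_def autocov_def mult.commute)

text \<open>Bounds every row sum of the covariance matrix; the factor 2 accounts for lags to the
  left and to the right.\<close>

definition cov_bound :: real where
  "cov_bound = 2 * (\<Sum>a. \<bar>autocov P a\<bar>)"

lemma cov_bound_nonneg: "0 \<le> cov_bound"
  unfolding cov_bound_def by (simp add: suminf_nonneg autocov_summable)

lemma sum_moment2_le: "finite B \<Longrightarrow> (\<Sum>b\<in>B. \<bar>moment2 a b\<bar>) \<le> cov_bound"
proof -
  assume B: "finite B"
  have le: "(\<Sum>b\<in>C. \<bar>autocov P b\<bar>) \<le> (\<Sum>a. \<bar>autocov P a\<bar>)" if "finite C" for C
    by (rule sum_le_suminf[OF autocov_summable that]) auto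
  have "(\<Sum>b\<in>B. \<bar>moment2 a b\<bar>) = (\<Sum>b\<in>B \<inter> {..a}. \<bar>moment2 a b\<bar>) + (\<Sum>b\<in>B - {..a}. \<bar>moment2 a b\<bar>)"
    using B by (rule sum.Int_Diff)
  also have "(\<Sum>b\<in>B \<inter> {..a}. \<bar>moment2 a b\<bar>) = (\<Sum>b\<in>(\<lambda>b. a - b) ` (B \<inter> {..a}). \<bar>autocov P b\<bar>)"
  proof (subst sum.reindex)
    show "inj_on ((-) a) (B \<inter> {..a})" by (auto simp: inj_on_def)
    show "(\<Sum>b\<in>B \<inter> {..a}. \<bar>moment2 a b\<bar>) = sum ((\<lambda>b. \<bar>autocov P b\<bar>) \<circ> (-) a) (B \<inter> {..a})"
    proof (rule sum.cong[OF refl])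
      fix b assume "b \<in> B \<inter> {..a}"
      thus "\<bar>moment2 a b\<bar> = ((\<lambda>b. \<bar>autocov P b\<bar>) \<circ> (-) a) b" using moment2_eq(2)[of b "a - b"] by simp
    qed
  qed
  also have "\<dots> \<le> (\<Sum>a. \<bar>autocov P a\<bar>)" by (rule le) (use B in auto)
  also have "(\<Sum>b\<in>B - {..a}. \<bar>moment2 a b\<bar>) = (\<Sum>b\<in>(\<lambda>b. b - a) ` (B - {..a}). \<bar>autocov P b\<bar>)"
  proof (subst sum.reindex)
    show "inj_on (\<lambda>b. b - a) (B - {..a})" by (auto simp: inj_on_def)
    show "(\<Sum>b\<in>B - {..a}. \<bar>moment2 a b\<bar>) = sum ((\<lambda>b. \<bar>autocov P b\<bar>) \<circ> (\<lambda>b. b - a)) (B - {..a})"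
    proof (rule sum.cong[OF refl])
      fix b assume "b \<in> B - {..a}"
      thus "\<bar>moment2 a b\<bar> = ((\<lambda>b. \<bar>autocov P b\<bar>) \<circ> (\<lambda>b. b - a)) b"
        using moment2_eq(1)[of a "b - a"] by simp
    qed
  qed
  also have "\<dots> \<le> (\<Sum>a. \<bar>autocov P a\<bar>)" by (rule le) (use B in auto)
  finally show ?thesis by (simp add: cov_bound_def)
qed

text \<open>Summable covariances make the variance linear in the number of sites, the same order as
  the mean of the logarithm that has to beat it.\<close>

lemma form_variance_le:
  assumes c: "\<And>a. \<bar>c a\<bar> \<le> 1" "\<And>a. a \<notin> B \<Longrightarrow> c a = 0" and B: "finite B"
  shows "form_variance n c \<le> cov_bound * card B"
proof -
  have "form_variance n c \<le> (\<Sum>a<n. \<Sum>b<n. \<bar>c a\<bar> * \<bar>moment2 a b\<bar>)"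
    unfolding form_variance_def
  proof (intro sum_mono)
    fix a b
    have "c a * c b * moment2 a b \<le> \<bar>c a\<bar> * (\<bar>c b\<bar> * \<bar>moment2 a b\<bar>)"
      by (metis abs_ge_self abs_mult mult.assoc)
    also have "\<dots> \<le> \<bar>c a\<bar> * (1 * \<bar>moment2 a b\<bar>)"
      by (intro mult_left_mono mult_right_mono c) auto
    finally show "c a * c b * moment2 a b \<le> \<bar>c a\<bar> * \<bar>moment2 a b\<bar>" by simp
  qed
  also have "\<dots> = (\<Sum>a<n. \<bar>c a\<bar> * (\<Sum>b<n. \<bar>moment2 a b\<bar>))" by (simp add: sum_distrib_left)
  also have "\<dots> \<le> (\<Sum>a<n. \<bar>c a\<bar> * cov_bound)"
    by (intro sum_mono mult_left_mono sum_moment2_le) auto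
  also have "\<dots> = (\<Sum>a\<in>{..<n} \<inter> B. \<bar>c a\<bar> * cov_bound)"
    by (rule sum.mono_neutral_right) (use c in auto)
  also have "\<dots> \<le> (\<Sum>a\<in>{..<n} \<inter> B. 1 * cov_bound)"
    by (intro sum_mono mult_right_mono c cov_bound_nonneg)
  also have "\<dots> \<le> cov_bound * card B"
    using card_mono[OF B, of "{..<n} \<inter> B"] cov_bound_nonneg by (simp add: mult.commute mult_left_mono)
  finally show ?thesis .
qed

end

section \<open>Uniqueness of laws on the space of sequences\<close>

text \<open>Normalised by its integral, \<open>g\<close> is a probability density, and uniqueness
  applies to the law of \<open>X\<close> under it. If the integral is 0 there is nothing to
  normalise, and both sides vanish.\<close>

lemma weighted_char_uniqueness:
  fixes X :: "'a \<Rightarrow> real" and g :: "'a \<Rightarrow> real"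
  assumes fin: "finite_measure N1" "finite_measure N2" and sets: "sets N1 = sets N2"
    and X: "X \<in> borel_measurable N1" and g: "g \<in> borel_measurable N1" "\<And>x. 0 \<le> g x" "\<And>x. g x \<le> C"
    and eq: "\<And>t. (\<integral>x. of_real (g x) * iexp (t * X x) \<partial>N1) = (\<integral>x. of_real (g x) * iexp (t * X x) \<partial>N2)"
    and B: "B \<in> sets borel"
  shows "(\<integral>x. g x * indicator B (X x) \<partial>N1) = (\<integral>x. g x * indicator B (X x) \<partial>N2)"
proof -
  note measurable_cong_sets[OF sets refl, simp]
  have X2: "X \<in> borel_measurable N2" and g2: "g \<in> borel_measurable N2" using X g(1) by simp_all
  have int: "integrable N g" if "finite_measure N" "g \<in> borel_measurable N" for N
  proof -
    interpret finite_measure N by fact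
    show ?thesis by (rule integrable_const_bound[of _ C]) (use g that in auto)
  qed
  define m where "m = (\<integral>x. g x \<partial>N1)"
  \<comment> \<open>The case \<open>t = 0\<close> says that both total masses agree.\<close>
  have m2: "(\<integral>x. g x \<partial>N2) = m"
    using eq[of 0] by (simp add: m_def)
  have m0: "0 \<le> m" unfolding m_def by (rule integral_nonneg_AE) (use g in auto)
  show ?thesis
  proof (cases "m = 0")
    case True
    have "(\<integral>x. g x * indicator B (X x) \<partial>N) = 0"
      if N: "finite_measure N" "g \<in> borel_measurable N" "(\<integral>x. g x \<partial>N) = 0" for N
    proof -
      have "AE x in N. g x = 0"
        using integral_nonneg_eq_0_iff_AE[OF int[OF N(1,2)]] N(3) g by simp
      hence "AE x in N. g x * indicator B (X x) = 0" by eventually_elim simp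
      thus ?thesis by (rule integral_eq_zero_AE)
    qed
    thus ?thesis using fin g(1) g2 True m2 by (simp add: m_def)
  next
    case False
    hence m: "0 < m" using m0 by simp
    define D where "D N = distr (density N (\<lambda>x. ennreal (g x / m))) borel X" for N
    have D: "real_distribution (D N)" "char (D N) t = (\<integral>x. of_real (g x) * iexp (t * X x) \<partial>N) / m"
      "measure (D N) B = (\<integral>x. g x * indicator B (X x) \<partial>N) / m"
      if N: "finite_measure N" "X \<in> borel_measurable N" "g \<in> borel_measurable N" "(\<integral>x. g x \<partial>N) = m" for N t
    proof -
      note [measurable] = N(2,3)
      have "emeasure (density N (\<lambda>x. ennreal (g x / m))) (space N) = (\<integral>\<^sup>+x. ennreal (g x / m) \<partial>N)"
        by (subst emeasure_density) (auto intro!: nn_integral_cong)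
      also have "\<dots> = ennreal (\<integral>x. g x / m \<partial>N)"
        by (rule nn_integral_eq_integral) (use int[OF N(1,3)] g m in auto)
      also have "\<dots> = 1" using m N(4) by simp
      finally have "prob_space (density N (\<lambda>x. ennreal (g x / m)))" by (intro prob_spaceI) simp
      thus rd: "real_distribution (D N)"
        unfolding D_def by (intro prob_space.real_distribution_distr) auto
      show "char (D N) t = (\<integral>x. of_real (g x) * iexp (t * X x) \<partial>N) / m"
      proof -
        have "char (D N) t = (\<integral>x. (g x / m) *\<^sub>R iexp (t * X x) \<partial>N)"
          unfolding D_def char_def using g m
          by (subst integral_distr) (auto intro!: integral_density)
        also have "\<dots> = (\<integral>x. of_real (g x) * iexp (t * X x) / m \<partial>N)"
          by (rule Bochner_Integration.integral_cong) (auto simp: scaleR_conv_of_real)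
        finally show ?thesis by simp
      qed
      have "measure (D N) B = (\<integral>x. indicator B x \<partial>D N)" using B by (simp add: D_def)
      also have "\<dots> = (\<integral>x. indicator B (X x) \<partial>density N (\<lambda>x. ennreal (g x / m)))"
        unfolding D_def by (rule integral_distr) (use B in auto)
      also have "\<dots> = (\<integral>x. (g x / m) *\<^sub>R indicator B (X x) \<partial>N)"
        by (rule integral_density) (use g m B in auto)
      also have "\<dots> = (\<integral>x. g x * indicator B (X x) / m \<partial>N)" by simp
      finally show "measure (D N) B = (\<integral>x. g x * indicator B (X x) \<partial>N) / m" by simp
    qed
    have "char (D N1) = char (D N2)"
      using D(2)[OF fin(1) X g(1)] D(2)[OF fin(2) X2 g2 m2] eq by (auto simp: m_def)
    hence "D N1 = D N2"
      using D(1)[OF fin(1) X g(1)] D(1)[OF fin(2) X2 g2 m2] by (intro Levy_uniqueness) (auto simp: m_def)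
    thus ?thesis using D(3)[OF fin(1) X g(1)] D(3)[OF fin(2) X2 g2 m2] m by (simp add: m_def)
  qed
qed

lemma linear_form_comb:
  "k < n \<Longrightarrow> linear_form n (\<lambda>a. s * c a + (if a = k then t else 0)) \<omega> = s * linear_form n c \<omega> + t * \<omega> k"
  by (simp add: linear_form_def distrib_right sum.distrib sum_distrib_left mult.assoc
      if_distrib[of "\<lambda>x. x * _"] cong: if_cong)

text \<open>The signed weights \<open>cos\<close> and \<open>sin\<close> of the remaining coordinates are made nonnegative by adding \<open>1\<close>,
  so that uniqueness of one-dimensional characteristic functions applies to one coordinate at a time.\<close>

lemma char_restrict_coordinate:
  fixes g :: "(nat \<Rightarrow> real) \<Rightarrow> real"
  assumes N: "prob_space N1" "prob_space N2" "sets N1 = sets borel" "sets N2 = sets borel"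
    and g: "g \<in> borel_measurable borel" "\<And>x. 0 \<le> g x" "\<And>x. g x \<le> 1"
    and eq: "\<And>c. (\<integral>\<omega>. of_real (g \<omega>) * iexp (linear_form n c \<omega>) \<partial>N1) = (\<integral>\<omega>. of_real (g \<omega>) * iexp (linear_form n c \<omega>) \<partial>N2)"
    and k: "k < n" and B: "B \<in> sets borel"
  shows "(\<integral>\<omega>. of_real (g \<omega> * indicator B (\<omega> k)) * iexp (linear_form n c \<omega>) \<partial>N1) =
    (\<integral>\<omega>. of_real (g \<omega> * indicator B (\<omega> k)) * iexp (linear_form n c \<omega>) \<partial>N2)"
proof -
  let ?l = "linear_form n c"
  let ?e = "\<lambda>s t \<omega>. complex_of_real (g \<omega>) * iexp (s * ?l \<omega> + t * \<omega> k)"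
  define K where "K = {N1, N2}"
  have K: "prob_space N" "finite_measure N" and m: "f \<in> borel_measurable borel \<Longrightarrow> f \<in> borel_measurable N"
    if "N \<in> K" for N and f :: "(nat \<Rightarrow> real) \<Rightarrow> 'b :: topological_space"
    using that N measurable_cong_sets[OF N(3) refl] measurable_cong_sets[OF N(4) refl] prob_space.finite_measure
    by (auto simp: K_def)
  have bint: "integrable N f" if "N \<in> K" "f \<in> borel_measurable borel" "\<And>\<omega>. norm (f \<omega>) \<le> b"
    for N b and f :: "(nat \<Rightarrow> real) \<Rightarrow> 'b :: {banach, second_countable_topology}"
    by (rule finite_measure.integrable_const_bound[OF K(2)[OF that(1)], of _ b])
       (use that m[OF that(1) that(2)] in auto)
  have K12: "N1 \<in> K" "N2 \<in> K" by (simp_all add: K_def)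
  note [measurable] = g(1) B
  have g2: "g x \<le> 2" for x using g(3)[of x] by linarith
  have inte: "integrable N (?e s t)" if "N \<in> K" for N s t
    by (rule bint[OF that, of _ 1]) (use g in \<open>auto simp: norm_mult\<close>)
  have e: "(\<integral>\<omega>. ?e s t \<omega> \<partial>N1) = (\<integral>\<omega>. ?e s t \<omega> \<partial>N2)" for s t
    using eq[of "\<lambda>a. s * c a + (if a = k then t else 0)"] unfolding linear_form_comb[OF k] .
  \<comment> \<open>\<open>G\<close> will be \<open>g\<close> times 1, \<open>1 + cos\<close> or
    \<open>1 + sin\<close> of the linear form. Each factor is a combination of
    \<open>iexp (s * ?l \<omega>)\<close> with \<open>s\<close> among 0, 1 and -1, so the transform
    of \<open>G\<close> in coordinate \<open>k\<close> is known from \<open>eq\<close> with modified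
    coefficients.\<close>
  have main: "(\<integral>\<omega>. G \<omega> * indicator B (\<omega> k) \<partial>N1) = (\<integral>\<omega>. G \<omega> * indicator B (\<omega> k) \<partial>N2)"
    if G: "G \<in> borel_measurable borel" "\<And>x. 0 \<le> G x" "\<And>x. G x \<le> 2"
      and Ge: "\<And>\<omega> t. complex_of_real (G \<omega>) * iexp (t * \<omega> k) = ?e 0 t \<omega> + z1 * ?e 1 t \<omega> + z2 * ?e (-1) t \<omega>" for G z1 z2
  proof (rule weighted_char_uniqueness[where C = 2])
    show "finite_measure N1" "finite_measure N2" "(\<lambda>\<omega>. \<omega> k) \<in> borel_measurable N1" "G \<in> borel_measurable N1"
      using K(2)[OF K12(1)] K(2)[OF K12(2)] m[OF K12(1) coordinate_measurable] m[OF K12(1) G(1)] by simp_all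
    show "sets N1 = sets N2" using N by simp
    fix t
    have h: "(\<integral>\<omega>. complex_of_real (G \<omega>) * iexp (t * \<omega> k) \<partial>N) =
        (\<integral>\<omega>. ?e 0 t \<omega> \<partial>N) + z1 * (\<integral>\<omega>. ?e 1 t \<omega> \<partial>N) + z2 * (\<integral>\<omega>. ?e (-1) t \<omega> \<partial>N)" if "N \<in> K" for N
      unfolding Ge using inte[OF that, of 0 t] inte[OF that, of 1 t] inte[OF that, of "-1" t]
      by (simp del: of_real_mult of_real_add of_real_minus)
    show "(\<integral>\<omega>. complex_of_real (G \<omega>) * iexp (t * \<omega> k) \<partial>N1) = (\<integral>\<omega>. complex_of_real (G \<omega>) * iexp (t * \<omega> k) \<partial>N2)"
      by (simp only: h[OF K12(1)] h[OF K12(2)] e)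
  qed (use G B in auto)
  have exps: "iexp (s * ?l \<omega> + t * \<omega> k) = iexp (s * ?l \<omega>) * iexp (t * \<omega> k)" for s t \<omega>
    by (simp add: exp_add[symmetric] algebra_simps)
  have alg_cos: "z * (1 + (x + y) / 2) * w = z * w + 1/2 * (z * (x * w)) + 1/2 * (z * (y * w))"
    and alg_sin: "z * (1 + (-\<i>/2 * x + \<i>/2 * y)) * w = z * w + (-\<i>/2) * (z * (x * w)) + \<i>/2 * (z * (y * w))"
    for x y z w :: complex by (simp_all add: field_simps)
  have m0: "(\<integral>\<omega>. g \<omega> * indicator B (\<omega> k) \<partial>N1) = (\<integral>\<omega>. g \<omega> * indicator B (\<omega> k) \<partial>N2)"
    by (rule main[of g 0 0]) (use g g2 in auto)
  have mc: "(\<integral>\<omega>. (g \<omega> * (1 + cos (?l \<omega>))) * indicator B (\<omega> k) \<partial>N1) =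
      (\<integral>\<omega>. (g \<omega> * (1 + cos (?l \<omega>))) * indicator B (\<omega> k) \<partial>N2)"
  proof (rule main[of _ "1/2" "1/2"])
    fix \<omega> :: "nat \<Rightarrow> real" and t
    have b: "0 \<le> 1 + cos (?l \<omega>)" "1 + cos (?l \<omega>) \<le> 2"
      using cos_ge_minus_one[of "?l \<omega>"] cos_le_one[of "?l \<omega>"] by linarith+
    show "0 \<le> g \<omega> * (1 + cos (?l \<omega>))" by (rule mult_nonneg_nonneg[OF g(2) b(1)])
    show "g \<omega> * (1 + cos (?l \<omega>)) \<le> 2"
      using mult_mono[OF g(3)[of \<omega>] b(2) zero_le_one b(1)] by simp
    have "complex_of_real (cos (?l \<omega>)) = (iexp (1 * ?l \<omega>) + iexp (-1 * ?l \<omega>)) / 2"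
      by (simp add: cos_of_real[symmetric] cos_exp_eq)
    thus "complex_of_real (g \<omega> * (1 + cos (?l \<omega>))) * iexp (t * \<omega> k) =
        ?e 0 t \<omega> + 1/2 * ?e 1 t \<omega> + 1/2 * ?e (-1) t \<omega>"
      unfolding exps of_real_mult[of "g \<omega>"] of_real_add[of 1]
      by (simp only: alg_cos mult_zero_left of_real_0 of_real_1 mult_zero_right exp_zero mult_1)
  qed measurable
  have ms: "(\<integral>\<omega>. (g \<omega> * (1 + sin (?l \<omega>))) * indicator B (\<omega> k) \<partial>N1) =
      (\<integral>\<omega>. (g \<omega> * (1 + sin (?l \<omega>))) * indicator B (\<omega> k) \<partial>N2)"
  proof (rule main[of _ "-\<i>/2" "\<i>/2"])
    fix \<omega> :: "nat \<Rightarrow> real" and t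
    have b: "0 \<le> 1 + sin (?l \<omega>)" "1 + sin (?l \<omega>) \<le> 2"
      using sin_ge_minus_one[of "?l \<omega>"] sin_le_one[of "?l \<omega>"] by linarith+
    show "0 \<le> g \<omega> * (1 + sin (?l \<omega>))" by (rule mult_nonneg_nonneg[OF g(2) b(1)])
    show "g \<omega> * (1 + sin (?l \<omega>)) \<le> 2"
      using mult_mono[OF g(3)[of \<omega>] b(2) zero_le_one b(1)] by simp
    have "complex_of_real (sin (?l \<omega>)) = -\<i>/2 * iexp (1 * ?l \<omega>) + \<i>/2 * iexp (-1 * ?l \<omega>)"
      by (simp add: sin_of_real[symmetric] sin_exp_eq field_simps)
    thus "complex_of_real (g \<omega> * (1 + sin (?l \<omega>))) * iexp (t * \<omega> k) =
        ?e 0 t \<omega> + (-\<i>/2) * ?e 1 t \<omega> + \<i>/2 * ?e (-1) t \<omega>"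
      unfolding exps of_real_mult[of "g \<omega>"] of_real_add[of 1]
      by (simp only: alg_sin mult_zero_left of_real_0 of_real_1 mult_zero_right exp_zero mult_1)
  qed measurable
  \<comment> \<open>The auxiliary summand 1 is subtracted again, and cosine and sine are
    reassembled.\<close>
  have "(\<integral>\<omega>. of_real (g \<omega> * indicator B (\<omega> k)) * iexp (?l \<omega>) \<partial>N) =
      of_real ((\<integral>\<omega>. (g \<omega> * (1 + cos (?l \<omega>))) * indicator B (\<omega> k) \<partial>N) - (\<integral>\<omega>. g \<omega> * indicator B (\<omega> k) \<partial>N))
      + \<i> * of_real ((\<integral>\<omega>. (g \<omega> * (1 + sin (?l \<omega>))) * indicator B (\<omega> k) \<partial>N) - (\<integral>\<omega>. g \<omega> * indicator B (\<omega> k) \<partial>N))"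
    if "N \<in> K" for N
  proof -
    have b: "\<bar>g \<omega> * x\<bar> \<le> \<bar>x\<bar>" for \<omega> x
      using mult_mono[of "\<bar>g \<omega>\<bar>" 1 "\<bar>x\<bar>" "\<bar>x\<bar>"] g by (simp add: abs_mult)
    have i0: "integrable N (\<lambda>\<omega>. g \<omega> * indicator B (\<omega> k))"
      by (rule bint[OF that, of _ 1]) (use g in \<open>auto simp: indicator_def\<close>)
    have ic: "integrable N (\<lambda>\<omega>. g \<omega> * cos (?l \<omega>) * indicator B (\<omega> k))"
      by (rule bint[OF that, of _ 1]) (use b in \<open>auto simp: indicator_def intro: order_trans[OF b]\<close>)
    have isin: "integrable N (\<lambda>\<omega>. g \<omega> * sin (?l \<omega>) * indicator B (\<omega> k))"
      by (rule bint[OF that, of _ 1]) (use b in \<open>auto simp: indicator_def intro: order_trans[OF b]\<close>)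
    have "(\<integral>\<omega>. of_real (g \<omega> * indicator B (\<omega> k)) * iexp (?l \<omega>) \<partial>N) =
        (\<integral>\<omega>. of_real (g \<omega> * cos (?l \<omega>) * indicator B (\<omega> k)) + \<i> * of_real (g \<omega> * sin (?l \<omega>) * indicator B (\<omega> k)) \<partial>N)"
      by (rule Bochner_Integration.integral_cong)
         (auto simp: cis_conv_exp[symmetric] complex_eq_iff indicator_def)
    also have "\<dots> = of_real (\<integral>\<omega>. g \<omega> * cos (?l \<omega>) * indicator B (\<omega> k) \<partial>N) +
        \<i> * of_real (\<integral>\<omega>. g \<omega> * sin (?l \<omega>) * indicator B (\<omega> k) \<partial>N)"
      using ic isin by (simp del: of_real_mult)
    also have "(\<integral>\<omega>. g \<omega> * cos (?l \<omega>) * indicator B (\<omega> k) \<partial>N) =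
        (\<integral>\<omega>. (g \<omega> * (1 + cos (?l \<omega>))) * indicator B (\<omega> k) \<partial>N) - (\<integral>\<omega>. g \<omega> * indicator B (\<omega> k) \<partial>N)"
      using ic i0 by (simp add: algebra_simps)
    also have "(\<integral>\<omega>. g \<omega> * sin (?l \<omega>) * indicator B (\<omega> k) \<partial>N) =
        (\<integral>\<omega>. (g \<omega> * (1 + sin (?l \<omega>))) * indicator B (\<omega> k) \<partial>N) - (\<integral>\<omega>. g \<omega> * indicator B (\<omega> k) \<partial>N)"
      using isin i0 by (simp add: algebra_simps)
    finally show ?thesis .
  qed
  thus ?thesis using m0 mc ms by (simp add: K_def)
qed

text \<open>By induction, \<open>char_restrict_coordinate\<close> adds the indicator of one more
  coordinate to the integrand while the coefficients \<open>c\<close> stay arbitrary. With all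
  \<open>n\<close> coordinates restricted and \<open>c = 0\<close>, the measures of cylinder sets
  remain, which determine the law.\<close>

lemma char_uniqueness_sequence:
  fixes N1 N2 :: "(nat \<Rightarrow> real) measure"
  assumes N: "prob_space N1" "prob_space N2" "sets N1 = sets borel" "sets N2 = sets borel"
    and eq: "\<And>n c. (\<integral>\<omega>. iexp (linear_form n c \<omega>) \<partial>N1) = (\<integral>\<omega>. iexp (linear_form n c \<omega>) \<partial>N2)"
  shows "N1 = N2"
proof -
  have key: "(\<integral>\<omega>. of_real (\<Prod>j<k. indicator (A j) (\<omega> j)) * iexp (linear_form n c \<omega>) \<partial>N1) =
      (\<integral>\<omega>. of_real (\<Prod>j<k. indicator (A j) (\<omega> j)) * iexp (linear_form n c \<omega>) \<partial>N2)"
    if "k \<le> n" "\<And>j. A j \<in> sets borel" for k n c and A :: "nat \<Rightarrow> real set"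
    using that(1)
  proof (induction k arbitrary: c)
    case 0
    then show ?case using eq by simp
  next
    case (Suc k)
    have le1: "(\<Prod>j<k. indicator (A j) (\<omega> j)) \<le> (1 :: real)" for \<omega>
      by (rule prod_le_1) (auto simp: indicator_def)
    show ?case unfolding prod.lessThan_Suc
      by (rule char_restrict_coordinate[OF N _ _ le1 Suc.IH])
         (use Suc.prems that(2) in \<open>auto intro!: prod_nonneg\<close>)
  qed
  have sets: "sets (\<Pi>\<^sub>M i\<in>UNIV. borel) = sets (borel :: (nat \<Rightarrow> real) measure)"
    by (rule sets_PiM_equal_borel)
  show ?thesis
  proof (rule measure_eqI_PiM_infinite[where I = UNIV and M = "\<lambda>_. borel"])
    fix A :: "nat \<Rightarrow> real set" and J
    assume J: "finite J" "\<And>i. i \<in> J \<Longrightarrow> A i \<in> sets borel"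
    obtain n where n: "J \<subseteq> {..<n}" using finite_nat_bounded[OF J(1)] by blast
    define A' where "A' j = (if j \<in> J then A j else UNIV)" for j
    have A': "A' j \<in> sets borel" for j using J by (simp add: A'_def)
    let ?E = "prod_emb UNIV (\<lambda>_. borel) J (Pi\<^sub>E J A)"
    have E: "?E = {\<omega>. \<forall>j<n. \<omega> j \<in> A' j}"
    proof (rule set_eqI)
      fix \<omega> :: "nat \<Rightarrow> real"
      have "\<omega> \<in> ?E \<longleftrightarrow> (\<forall>j\<in>J. \<omega> j \<in> A j)" by (auto simp: prod_emb_def PiE_iff)
      also have "\<dots> \<longleftrightarrow> \<omega> \<in> {\<omega>. \<forall>j<n. \<omega> j \<in> A' j}" using n by (auto simp: A'_def)
      finally show "\<omega> \<in> ?E \<longleftrightarrow> \<omega> \<in> {\<omega>. \<forall>j<n. \<omega> j \<in> A' j}" .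
    qed
    have ind: "(\<Prod>j<n. indicator (A' j) (\<omega> j)) = (indicator ?E \<omega> :: real)" for \<omega>
      unfolding E by (auto simp: indicator_def prod_zero_iff)
    have Eb: "?E \<in> sets borel" unfolding sets[symmetric] using J by (intro sets_PiM_I) auto
    have "(\<integral>\<omega>. complex_of_real (indicator ?E \<omega>) \<partial>N1) = (\<integral>\<omega>. complex_of_real (indicator ?E \<omega>) \<partial>N2)"
      using key[of n n A' "\<lambda>_. 0"] A' unfolding ind by (simp add: linear_form_def)
    hence "measure N1 ?E = measure N2 ?E"
      using Eb N(3,4) sets_eq_imp_space_eq[OF N(3)] sets_eq_imp_space_eq[OF N(4)] by simp
    thus "emeasure N1 ?E = emeasure N2 ?E"
      using N(1,2) by (simp add: finite_measure.emeasure_eq_measure prob_space.finite_measure)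
  qed (use N sets in \<open>auto simp: prob_space.finite_measure\<close>)
qed

section \<open>Independent pairs and their rotations\<close>

text \<open>Reads a pair as one sequence, so that uniqueness of laws on sequences applies to
  pairs.\<close>

definition interleave :: "(nat \<Rightarrow> real) \<times> (nat \<Rightarrow> real) \<Rightarrow> nat \<Rightarrow> real" where
  "interleave z j = (if even j then fst z (j div 2) else snd z (j div 2))"

text \<open>The first component runs from \<open>fst z\<close> at \<open>t = 0\<close> to
  \<open>snd z\<close> at \<open>t = pi / 2\<close>; the second is its derivative in
  \<open>t\<close>.\<close>

definition rotate_pair :: "real \<Rightarrow> (nat \<Rightarrow> real) \<times> (nat \<Rightarrow> real) \<Rightarrow> (nat \<Rightarrow> real) \<times> (nat \<Rightarrow> real)" where
  "rotate_pair t z = (\<lambda>a. cos t * fst z a + sin t * snd z a, \<lambda>a. cos t * snd z a - sin t * fst z a)"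

lemma linear_form_interleave:
  "linear_form (2 * m) c (interleave z) =
    linear_form m (\<lambda>a. c (2 * a)) (fst z) + linear_form m (\<lambda>a. c (2 * a + 1)) (snd z)"
proof (induction m)
  case 0
  show ?case by (simp add: linear_form_def)
next
  case (Suc m)
  have "interleave z (2 * m) = fst z m" "interleave z (Suc (2 * m)) = snd z m"
    by (simp_all add: interleave_def)
  thus ?case using Suc by (simp add: linear_form_def)
qed

lemma linear_form_extend: "n \<le> m \<Longrightarrow> linear_form n c \<omega> = linear_form m (\<lambda>a. if a < n then c a else 0) \<omega>"
  unfolding linear_form_def by (rule sum.mono_neutral_cong_left) auto

lemma linear_form_rotate_pair:
  "linear_form m c (fst (rotate_pair t z)) + linear_form m d (snd (rotate_pair t z)) =
    linear_form m (\<lambda>a. cos t * c a - sin t * d a) (fst z) + linear_form m (\<lambda>a. sin t * c a + cos t * d a) (snd z)"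
  unfolding linear_form_def sum.distrib[symmetric]
  by (rule sum.cong) (auto simp: rotate_pair_def algebra_simps)

text \<open>Jensen's inequality with equal weights: the sum of the \<open>f k\<close> is the mean of
  the numbers \<open>N * f k\<close>. The tangent of \<open>exp\<close> at that mean is
  summed.\<close>

lemma exp_mean_le:
  fixes f :: "nat \<Rightarrow> real"
  assumes "1 \<le> N"
  shows "exp (\<Sum>k<N. f k) \<le> (\<Sum>k<N. exp (real N * f k)) / N"
proof -
  define s where "s = (\<Sum>k<N. f k)"
  have "exp s * (1 + (real N * f k - s)) \<le> exp (real N * f k)" for k
  proof -
    have "exp s * (1 + (real N * f k - s)) \<le> exp s * exp (real N * f k - s)"
      by (intro mult_left_mono exp_ge_add_one_self) auto
    thus ?thesis by (simp add: exp_add[symmetric])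
  qed
  hence "(\<Sum>k<N. exp s * (1 + (real N * f k - s))) \<le> (\<Sum>k<N. exp (real N * f k))" by (rule sum_mono)
  also have "(\<Sum>k<N. exp s * (1 + (real N * f k - s))) = exp s * N"
    unfolding sum_distrib_left[symmetric]
    by (simp add: sum.distrib sum_subtractf s_def sum_distrib_left[symmetric])
  finally show ?thesis using assms by (simp add: s_def field_simps)
qed

context gaussian_disorder begin

abbreviation PP :: "((nat \<Rightarrow> real) \<times> (nat \<Rightarrow> real)) measure" where "PP \<equiv> P \<Otimes>\<^sub>M P"

sublocale PP: pair_prob_space P P ..

lemma coordinate_measurable_PP [measurable]:
  "(\<lambda>z. fst z a) \<in> borel_measurable PP" "(\<lambda>z. snd z a) \<in> borel_measurable PP"
  by (rule measurable_compose[OF measurable_fst coordinate_measurable_P])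
     (rule measurable_compose[OF measurable_snd coordinate_measurable_P])

lemma measurable_into_P: "(\<And>a. (\<lambda>z. f z a) \<in> borel_measurable N) \<Longrightarrow> f \<in> measurable N P"
  unfolding measurable_cong_sets[OF refl sets_P] by (rule measurable_coordinatewise_then_product)

lemma rotate_pair_measurable [measurable]: "rotate_pair t \<in> measurable PP PP"
  unfolding rotate_pair_def[abs_def]
  by (intro measurable_Pair measurable_into_P) measurable

lemma interleave_measurable [measurable]: "interleave \<in> borel_measurable PP"
  unfolding interleave_def[abs_def]
  by (rule measurable_coordinatewise_then_product) measurable

lemma form_variance_rotate:
  "form_variance m (\<lambda>a. cos t * c a - sin t * d a) + form_variance m (\<lambda>a. sin t * c a + cos t * d a) =
    form_variance m c + form_variance m d"
proof -
  have "(C * x - S * y) * (C * x' - S * y') + (S * x + C * y) * (S * x' + C * y')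
      = (S\<^sup>2 + C\<^sup>2) * (x * x' + y * y')" for C S x y x' y' :: real
    by (simp add: algebra_simps power2_eq_square)
  from this[of "cos t" _ "sin t"]
  have "(cos t * x - sin t * y) * (cos t * x' - sin t * y') + (sin t * x + cos t * y) * (sin t * x' + cos t * y')
      = x * x' + y * y'" for x y x' y' :: real by simp
  thus ?thesis
    unfolding form_variance_def sum.distrib[symmetric] distrib_right[symmetric] by simp
qed

lemma char_pair:
  "(\<integral>z. iexp (linear_form m c (fst z) + linear_form m d (snd z)) \<partial>PP) =
    complex_of_real (exp (- ((form_variance m c + form_variance m d) / 2)))"
proof -
  let ?f = "\<lambda>z. iexp (linear_form m c (fst z) + linear_form m d (snd z))"
  have [measurable]: "(\<lambda>z. linear_form m e (fst z)) \<in> borel_measurable PP"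
    "(\<lambda>z. linear_form m e (snd z)) \<in> borel_measurable PP" for e
    unfolding linear_form_def by measurable
  have "integrable PP ?f" by (rule PP.P.integrable_const_bound[of _ 1]) auto
  hence "(\<integral>z. ?f z \<partial>PP) = (\<integral>x. \<integral>y. ?f (x, y) \<partial>P \<partial>P)" by (rule PP.integral_fst'[symmetric])
  also have "\<dots> = (\<integral>x. \<integral>y. iexp (linear_form m c x) * iexp (linear_form m d y) \<partial>P \<partial>P)"
    by (simp add: distrib_left exp_add)
  also have "\<dots> = (\<integral>x. iexp (linear_form m c x) \<partial>P) * (\<integral>y. iexp (linear_form m d y) \<partial>P)" by simp
  finally show ?thesis unfolding linear_form_law(3) of_real_mult[symmetric] exp_add[symmetric]
    by (simp add: add_divide_distrib)
qed

text \<open>The characteristic function of a pair depends on the coefficients only through the sum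
  of two variances, which a rotation of the coefficients preserves.\<close>

lemma distr_rotate_pair:
  "distr PP borel (\<lambda>z. interleave (rotate_pair t z)) = distr PP borel interleave"
proof (rule char_uniqueness_sequence)
  have [measurable]: "(\<lambda>z. interleave (rotate_pair t z)) \<in> borel_measurable PP" by measurable
  show "prob_space (distr PP borel (\<lambda>z. interleave (rotate_pair t z)))" "prob_space (distr PP borel interleave)"
    by (rule PP.P.prob_space_distr, measurable)+
  fix n and c :: "nat \<Rightarrow> real"
  define c' where "c' a = (if a < n then c a else 0)" for a
  have lin: "linear_form n c \<omega> = linear_form (2 * n) c' \<omega>" for \<omega>
    unfolding c'_def by (rule linear_form_extend) simp
  have "(\<integral>\<omega>. iexp (linear_form n c \<omega>) \<partial>distr PP borel interleave) =
      (\<integral>z. iexp (linear_form (2 * n) c' (interleave z)) \<partial>PP)"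
    unfolding lin by (rule integral_distr) measurable
  moreover have "(\<integral>\<omega>. iexp (linear_form n c \<omega>) \<partial>distr PP borel (\<lambda>z. interleave (rotate_pair t z))) =
      (\<integral>z. iexp (linear_form (2 * n) c' (interleave (rotate_pair t z))) \<partial>PP)"
    unfolding lin by (rule integral_distr) measurable
  ultimately show "(\<integral>\<omega>. iexp (linear_form n c \<omega>) \<partial>distr PP borel (\<lambda>z. interleave (rotate_pair t z))) =
      (\<integral>\<omega>. iexp (linear_form n c \<omega>) \<partial>distr PP borel interleave)"
    unfolding linear_form_interleave linear_form_rotate_pair char_pair form_variance_rotate by simp
qed simp_all

lemma nn_integral_rotate_pair:
  assumes f: "f \<in> borel_measurable PP"
  shows "(\<integral>\<^sup>+z. f (rotate_pair t z) \<partial>PP) = (\<integral>\<^sup>+z. f z \<partial>PP)"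
proof -
  define split where "split \<omega> = ((\<lambda>a. \<omega> (2 * a)), (\<lambda>a. \<omega> (2 * a + 1)))" for \<omega> :: "nat \<Rightarrow> real"
  have inv: "split (interleave z) = z" for z by (simp add: split_def interleave_def prod_eq_iff fun_eq_iff)
  have split [measurable]: "split \<in> measurable borel PP"
    unfolding split_def[abs_def] by (intro measurable_Pair measurable_into_P) measurable
  have fs [measurable]: "(\<lambda>\<omega>. f (split \<omega>)) \<in> borel_measurable borel" using measurable_compose[OF split f] .
  have "(\<integral>\<^sup>+z. f (rotate_pair t z) \<partial>PP) = (\<integral>\<^sup>+z. f (split (interleave (rotate_pair t z))) \<partial>PP)"
    by (simp add: inv)
  also have "\<dots> = (\<integral>\<^sup>+\<omega>. f (split \<omega>) \<partial>distr PP borel (\<lambda>z. interleave (rotate_pair t z)))"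
    by (rule nn_integral_distr[symmetric]) measurable
  also have "\<dots> = (\<integral>\<^sup>+z. f (split (interleave z)) \<partial>PP)"
    unfolding distr_rotate_pair by (rule nn_integral_distr) measurable
  finally show ?thesis by (simp add: inv)
qed

section \<open>Exponential moments of the disorder\<close>

text \<open>For \<open>s = 1\<close>, each \<open>exp \<bar>\<omega> a\<bar>\<close> is at most
  \<open>exp (\<omega> a) + exp (- \<omega> a)\<close>, and the product expands into
  \<open>2 ^ card B\<close> sign patterns. Each is a linear form of variance at most
  \<open>cov_bound * card B\<close>, which gives \<open>ln 2 + cov_bound / 2\<close> per site
  although the sites are correlated. Jensen's inequality yields the smaller
  \<open>s\<close>.\<close>

lemma nn_integral_exp_sum_abs:
  assumes B: "finite B" and s: "0 \<le> s" "s \<le> 1"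
  shows "(\<integral>\<^sup>+\<omega>. ennreal (exp (s * (\<Sum>a\<in>B. \<bar>\<omega> a\<bar>))) \<partial>P) \<le> ennreal (exp (s * card B * (ln 2 + cov_bound / 2)))"
proof -
  obtain n where n: "B \<subseteq> {..<n}" using finite_nat_bounded[OF B] by blast
  let ?Y = "\<lambda>\<omega>. \<Sum>a\<in>B. \<bar>\<omega> a\<bar> :: real"
  define K where "K = real (card B) * (ln 2 + cov_bound / 2)"
  define c where "c X a = (if a \<in> X then 1 else if a \<in> B then -1 else (0 :: real))" for X a
  have one: "(\<integral>\<^sup>+\<omega>. ennreal (exp (?Y \<omega>)) \<partial>P) \<le> ennreal (exp K)"
  proof -
    have "exp (?Y \<omega>) \<le> (\<Sum>X\<in>Pow B. exp (linear_form n (c X) \<omega>))" for \<omega>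
    proof -
      have "exp (?Y \<omega>) = (\<Prod>a\<in>B. exp \<bar>\<omega> a\<bar>)" using B by (rule exp_sum)
      also have "\<dots> \<le> (\<Prod>a\<in>B. exp (\<omega> a) + exp (- \<omega> a))" by (rule prod_mono) (auto simp: abs_if)
      also have "\<dots> = (\<Sum>X\<in>Pow B. (\<Prod>a\<in>X. exp (\<omega> a)) * (\<Prod>a\<in>B - X. exp (- \<omega> a)))"
        by (rule prod_add[OF B])
      also have "\<dots> = (\<Sum>X\<in>Pow B. exp (linear_form n (c X) \<omega>))"
      proof (rule sum.cong[OF refl])
        fix X assume X: "X \<in> Pow B"
        have fin: "finite X" using X B finite_subset by auto
        have "linear_form n (c X) \<omega> = (\<Sum>a\<in>B. c X a * \<omega> a)"
          unfolding linear_form_def using n X by (intro sum.mono_neutral_right) (auto simp: c_def)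
        also have "\<dots> = (\<Sum>a\<in>B - X. c X a * \<omega> a) + (\<Sum>a\<in>X. c X a * \<omega> a)"
          using X B by (intro sum.subset_diff) auto
        also have "(\<Sum>a\<in>X. c X a * \<omega> a) = (\<Sum>a\<in>X. \<omega> a)" by (simp add: c_def)
        also have "(\<Sum>a\<in>B - X. c X a * \<omega> a) = (\<Sum>a\<in>B - X. - \<omega> a)"
          by (rule sum.cong) (auto simp: c_def)
        finally show "(\<Prod>a\<in>X. exp (\<omega> a)) * (\<Prod>a\<in>B - X. exp (- \<omega> a)) = exp (linear_form n (c X) \<omega>)"
          using fin B by (simp add: exp_sum exp_add mult.commute)
      qed
      finally show ?thesis .
    qed
    hence "(\<integral>\<^sup>+\<omega>. ennreal (exp (?Y \<omega>)) \<partial>P) \<le> (\<integral>\<^sup>+\<omega>. (\<Sum>X\<in>Pow B. ennreal (exp (linear_form n (c X) \<omega>))) \<partial>P)"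
      by (intro nn_integral_mono) (simp add: sum_ennreal ennreal_leI)
    also have "\<dots> = (\<Sum>X\<in>Pow B. \<integral>\<^sup>+\<omega>. ennreal (exp (linear_form n (c X) \<omega>)) \<partial>P)"
      by (rule nn_integral_sum) measurable
    also have "\<dots> \<le> (\<Sum>X\<in>Pow B. ennreal (exp (cov_bound * card B / 2)))"
    proof (rule sum_mono)
      fix X assume X: "X \<in> Pow B"
      have "form_variance n (c X) \<le> cov_bound * card B"
        by (rule form_variance_le[OF _ _ B]) (use X in \<open>auto simp: c_def\<close>)
      thus "(\<integral>\<^sup>+\<omega>. ennreal (exp (linear_form n (c X) \<omega>)) \<partial>P) \<le> ennreal (exp (cov_bound * card B / 2))"
        unfolding linear_form_law(2) by (intro ennreal_leI) simp
    qed
    also have "\<dots> = ennreal (2 ^ card B * exp (cov_bound * card B / 2))"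
      using B by (simp add: card_Pow ennreal_mult'' ennreal_power[symmetric] flip: ennreal_numeral)
    also have "2 ^ card B * exp (cov_bound * card B / 2) = exp K"
    proof -
      have "(2 :: real) ^ card B = exp (card B * ln 2)" by (simp add: exp_of_nat_mult)
      thus ?thesis by (simp add: K_def exp_add[symmetric] algebra_simps)
    qed
    finally show ?thesis .
  qed
  \<comment> \<open>Used at \<open>t = ?Y \<omega> - K\<close>. The mean of the right side is then
    at most 1, because \<open>exp (?Y \<omega>)\<close> has mean at most
    \<open>exp K\<close>.\<close>
  have conv: "exp (s * t) \<le> (1 - s) + s * exp t" for t
    using convex_onD[OF exp_convex, of s 0 t] s by simp
  have "exp (s * ?Y \<omega>) \<le> exp (s * K) * ((1 - s) + s * exp (- K) * exp (?Y \<omega>))" for \<omega>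
  proof -
    have "exp (s * ?Y \<omega>) = exp (s * K) * exp (s * (?Y \<omega> - K))" by (simp add: exp_add[symmetric] algebra_simps)
    also have "\<dots> \<le> exp (s * K) * ((1 - s) + s * exp (?Y \<omega> - K))" by (intro mult_left_mono conv) simp
    also have "exp (?Y \<omega> - K) = exp (- K) * exp (?Y \<omega>)" by (simp add: exp_add[symmetric])
    finally show ?thesis by (simp add: mult.assoc)
  qed
  hence "(\<integral>\<^sup>+\<omega>. ennreal (exp (s * ?Y \<omega>)) \<partial>P) \<le>
      (\<integral>\<^sup>+\<omega>. ennreal (exp (s * K)) * (ennreal (1 - s) + ennreal (s * exp (- K)) * ennreal (exp (?Y \<omega>))) \<partial>P)"
    using s by (intro nn_integral_mono) (simp add: ennreal_mult'[symmetric] ennreal_plus[symmetric] ennreal_leI del: ennreal_plus)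
  also have "\<dots> = ennreal (exp (s * K)) * (ennreal (1 - s) + ennreal (s * exp (- K)) * (\<integral>\<^sup>+\<omega>. ennreal (exp (?Y \<omega>)) \<partial>P))"
    using emeasure_space_1 by (simp add: nn_integral_cmult nn_integral_add)
  also have "\<dots> \<le> ennreal (exp (s * K)) * (ennreal (1 - s) + ennreal (s * exp (- K)) * ennreal (exp K))"
    by (intro mult_left_mono add_left_mono one) auto
  also have "ennreal (s * exp (- K)) * ennreal (exp K) = ennreal s"
    using s by (subst ennreal_mult''[symmetric]) (auto simp: exp_minus)
  also have "ennreal (1 - s) + ennreal s = 1"
    using s by (subst ennreal_plus[symmetric]) auto
  finally show ?thesis by (simp add: K_def mult.assoc)
qed

text \<open>Jensen's inequality with a possibly infinite right side. The tangent of
  \<open>exp\<close> at the mean is cut off at 0 to pass to nonnegative integrals.\<close>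

lemma exp_expectation_le:
  assumes F: "integrable P F"
  shows "ennreal (exp (expectation F)) \<le> (\<integral>\<^sup>+\<omega>. ennreal (exp (F \<omega>)) \<partial>P)"
proof -
  define m where "m = expectation F"
  let ?h = "\<lambda>\<omega>. exp m * (1 + (F \<omega> - m))"
  have h: "integrable P ?h" using F by auto
  have "expectation ?h = exp m" using F prob_space by (simp add: m_def)
  moreover have "expectation ?h \<le> (\<integral>\<omega>. max 0 (?h \<omega>) \<partial>P)" by (rule integral_mono) (use h in auto)
  ultimately have "ennreal (exp m) \<le> ennreal (\<integral>\<omega>. max 0 (?h \<omega>) \<partial>P)" by (simp add: ennreal_leI)
  also have "\<dots> = (\<integral>\<^sup>+\<omega>. ennreal (max 0 (?h \<omega>)) \<partial>P)"
    by (rule nn_integral_eq_integral[symmetric]) (use h in auto)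
  also have "\<dots> \<le> (\<integral>\<^sup>+\<omega>. ennreal (exp (F \<omega>)) \<partial>P)"
  proof (intro nn_integral_mono ennreal_leI)
    fix \<omega>
    have "?h \<omega> \<le> exp m * exp (F \<omega> - m)" by (intro mult_left_mono exp_ge_add_one_self) auto
    thus "max 0 (?h \<omega>) \<le> exp (F \<omega>)" by (simp add: exp_add[symmetric])
  qed
  finally show ?thesis by (simp add: m_def)
qed

end

section \<open>Gaussian concentration\<close>

context gaussian_disorder begin

text \<open>Discretised Maurey--Pisier argument: \<open>F x - F y\<close> is telescoped along \<open>N\<close> rotations of the pair
  \<open>(x, y)\<close>, each of which leaves the law of the pair invariant.\<close>

lemma nn_integral_exp_difference:
  fixes F :: "(nat \<Rightarrow> real) \<Rightarrow> real" and g :: "nat \<Rightarrow> (nat \<Rightarrow> real) \<Rightarrow> real"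
  assumes F [measurable]: "F \<in> borel_measurable P"
    and g [measurable]: "\<And>a. g a \<in> borel_measurable P" and g1: "\<And>a x. \<bar>g a x\<bar> \<le> 1"
    and tangent: "\<And>x y. F x + (\<Sum>a\<in>B. g a x * (y a - x a)) \<le> F y"
    and B: "finite B" and N: "1 \<le> N" and d: "0 \<le> d" "d * pi\<^sup>2 / (8 * real N) \<le> 1"
  shows "(\<integral>\<^sup>+z. ennreal (exp (d * (F (fst z) - F (snd z)))) \<partial>PP) \<le>
    ennreal (exp (card B * (d\<^sup>2 * pi\<^sup>2 * cov_bound / 8 + d * pi\<^sup>2 / (8 * real N) * (ln 2 + cov_bound / 2))))"
proof -
  \<comment> \<open>A quarter turn in \<open>N\<close> equal steps: step 0 shows the first copy,
    step \<open>N\<close> the second.\<close>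
  define t where "t = pi / (2 * real N)"
  have t: "0 \<le> t" "t \<le> pi / 2" using N by (simp_all add: t_def field_simps)
  define R where "R k = rotate_pair (real k * t)" for k
  have Rm [measurable]: "R k \<in> measurable PP PP" for k by (simp add: R_def)
  have R0: "fst (R 0 z) = fst z" and RN: "fst (R N z) = snd z" for z
    using N by (simp_all add: R_def rotate_pair_def t_def)
  have RS: "fst (R (Suc k) z) a = cos t * fst (R k z) a + sin t * snd (R k z) a" for k z a
    by (simp add: R_def rotate_pair_def distrib_right cos_add sin_add algebra_simps)
  \<comment> \<open>Bounds the drop of \<open>F\<close> in one step by the tangent inequality. The
    part with \<open>sin t\<close> carries the fluctuations; the part with \<open>1 - cos t\<close>
    is the discretisation error, of second order in \<open>t\<close>.\<close>
  define Phi where "Phi z = (\<Sum>a\<in>B. g a (fst z) * ((1 - cos t) * fst z a - sin t * snd z a))" for z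
  have gm [measurable]: "(\<lambda>z. g a (fst z)) \<in> borel_measurable PP" for a
    by (rule measurable_compose[OF measurable_fst g])
  have Phi [measurable]: "Phi \<in> borel_measurable PP" unfolding Phi_def[abs_def] by measurable
  have step: "F (fst (R k z)) - F (fst (R (Suc k) z)) \<le> Phi (R k z)" for k z
  proof -
    have "(\<Sum>a\<in>B. g a (fst (R k z)) * (fst (R (Suc k) z) a - fst (R k z) a)) = - Phi (R k z)"
      unfolding Phi_def RS sum_negf[symmetric] by (rule sum.cong) (auto simp: algebra_simps)
    thus ?thesis using tangent[of "fst (R k z)" "fst (R (Suc k) z)"] by simp
  qed
  have tele: "F (fst z) - F (snd z) \<le> (\<Sum>k<N. Phi (R k z))" for z
  proof -
    have "F (fst z) - F (snd z) = (\<Sum>k<N. F (fst (R k z)) - F (fst (R (Suc k) z)))"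
      using sum_lessThan_telescope'[of "\<lambda>k. F (fst (R k z))" N] by (simp add: R0 RN)
    also have "\<dots> \<le> (\<Sum>k<N. Phi (R k z))" by (rule sum_mono[OF step])
    finally show ?thesis .
  qed
  have "exp (d * (F (fst z) - F (snd z))) \<le> (\<Sum>k<N. exp (real N * (d * Phi (R k z)))) / real N" for z
  proof -
    have "d * (F (fst z) - F (snd z)) \<le> (\<Sum>k<N. d * Phi (R k z))"
      using mult_left_mono[OF tele d(1)] by (simp add: sum_distrib_left)
    hence "exp (d * (F (fst z) - F (snd z))) \<le> exp (\<Sum>k<N. d * Phi (R k z))" by simp
    also have "\<dots> \<le> (\<Sum>k<N. exp (real N * (d * Phi (R k z)))) / real N" by (rule exp_mean_le[OF N])
    finally show ?thesis .
  qed
  hence "(\<integral>\<^sup>+z. ennreal (exp (d * (F (fst z) - F (snd z)))) \<partial>PP) \<le>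
      (\<integral>\<^sup>+z. ennreal (1 / real N) * (\<Sum>k<N. ennreal (exp (real N * (d * Phi (R k z))))) \<partial>PP)"
    by (intro nn_integral_mono) (simp add: sum_ennreal sum_nonneg ennreal_mult'[symmetric] ennreal_leI)
  also have "\<dots> = ennreal (1 / real N) * (\<Sum>k<N. \<integral>\<^sup>+z. ennreal (exp (real N * (d * Phi (R k z)))) \<partial>PP)"
    by (simp add: nn_integral_cmult nn_integral_sum del: sum_ennreal)
  \<comment> \<open>By rotation invariance all \<open>N\<close> terms coincide, so their average is
    a single one.\<close>
  also have "\<dots> = ennreal (1 / real N) * (\<Sum>k<N. \<integral>\<^sup>+z. ennreal (exp (real N * (d * Phi z))) \<partial>PP)"
    unfolding R_def by (subst nn_integral_rotate_pair) simp_all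
  also have "\<dots> = (\<integral>\<^sup>+z. ennreal (exp (real N * (d * Phi z))) \<partial>PP)"
  proof -
    have "ennreal (1 / real N) * of_nat N = 1"
      using N unfolding ennreal_of_nat_eq_real_of_nat by (subst ennreal_mult''[symmetric]) auto
    thus ?thesis by (simp add: mult.assoc[symmetric])
  qed
  \<comment> \<open>With \<open>x\<close> fixed the exponent is affine in \<open>y\<close>, because
    the coefficients \<open>g a\<close> look at the first copy only. The inner integral is a
    Gaussian exponential moment whose variance stays bounded as \<open>N\<close> grows, since
    \<open>N * sin t \<le> pi / 2\<close>.\<close>
  also have "\<dots> = (\<integral>\<^sup>+x. \<integral>\<^sup>+y. ennreal (exp (real N * (d * Phi (x, y)))) \<partial>P \<partial>P)"
    by (rule nn_integral_fst[symmetric]) measurable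
  also have "\<dots> \<le> (\<integral>\<^sup>+x. ennreal (exp (d\<^sup>2 * pi\<^sup>2 * cov_bound / 8 * card B)) *
      ennreal (exp (d * pi\<^sup>2 / (8 * real N) * (\<Sum>a\<in>B. \<bar>x a\<bar>))) \<partial>P)"
  proof (rule nn_integral_mono)
    fix x :: "nat \<Rightarrow> real"
    obtain n where n: "B \<subseteq> {..<n}" using finite_nat_bounded[OF B] by blast
    define q where "q = real N * d * sin t"
    have sint: "0 \<le> sin t" "sin t \<le> t" using t by (auto intro!: sin_ge_zero sin_x_le_x)
    have q: "0 \<le> q" "q \<le> d * pi / 2"
    proof -
      show "0 \<le> q" using d sint by (simp add: q_def)
      have "q \<le> real N * d * t" unfolding q_def by (intro mult_left_mono sint) (use d in auto)
      thus "q \<le> d * pi / 2" using N by (simp add: t_def)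
    qed
    define c where "c a = (if a \<in> B then - g a x else 0)" for a
    define A where "A = real N * d * (1 - cos t) * (\<Sum>a\<in>B. g a x * x a)"
    have exp_eq: "real N * (d * Phi (x, y)) = A + linear_form n (\<lambda>a. q * c a) y" for y
    proof -
      have "linear_form n (\<lambda>a. q * c a) y = (\<Sum>a\<in>B. q * c a * y a)"
        unfolding linear_form_def using n by (intro sum.mono_neutral_right) (auto simp: c_def)
      also have "\<dots> = (\<Sum>a\<in>B. - (q * g a x * y a))" by (rule sum.cong) (auto simp: c_def)
      finally show ?thesis
        by (simp add: Phi_def A_def q_def sum_distrib_left sum_negf sum_subtractf[symmetric] algebra_simps)
    qed
    have "form_variance n (\<lambda>a. q * c a) = q\<^sup>2 * form_variance n c"
      by (simp add: form_variance_def sum_distrib_left power2_eq_square mult_ac)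
    also have "\<dots> \<le> (d * pi / 2)\<^sup>2 * (cov_bound * card B)"
    proof (rule mult_mono)
      show "q\<^sup>2 \<le> (d * pi / 2)\<^sup>2" using q by (intro power_mono)
      show le: "form_variance n c \<le> cov_bound * card B"
        by (rule form_variance_le[OF _ _ B]) (use g1 in \<open>auto simp: c_def\<close>)
      \<comment> \<open>The product estimate needs a nonnegative variance; it follows from the
        modulus of a characteristic function being at most 1.\<close>
      have "complex_of_real (exp (- (form_variance n c / 2))) = (\<integral>\<omega>. iexp (linear_form n c \<omega>) \<partial>P)"
        by (rule linear_form_law(3)[symmetric])
      hence "exp (- (form_variance n c / 2)) = norm (\<integral>\<omega>. iexp (linear_form n c \<omega>) \<partial>P)"
        by (metis norm_of_real abs_of_pos exp_gt_zero)
      also have "\<dots> \<le> (\<integral>\<omega>. norm (iexp (linear_form n c \<omega>)) \<partial>P)" by (rule integral_norm_bound)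
      also have "\<dots> = 1" using prob_space by simp
      finally show "0 \<le> form_variance n c" by simp
    qed simp
    finally have V: "form_variance n (\<lambda>a. q * c a) / 2 \<le> d\<^sup>2 * pi\<^sup>2 * cov_bound / 8 * card B"
      by (simp add: power_divide power_mult_distrib)
    have "1 - cos t \<le> t\<^sup>2 / 2"
    proof -
      have "1 - cos t = 2 * (sin (t / 2))\<^sup>2" using cos_double_sin[of "t / 2"] by simp
      also have "\<dots> \<le> 2 * (t / 2)\<^sup>2"
        using t by (intro mult_left_mono power_mono sin_x_le_x sin_ge_zero) auto
      finally show ?thesis by (simp add: power_divide)
    qed
    hence "real N * d * (1 - cos t) \<le> real N * d * (t\<^sup>2 / 2)" using d by (intro mult_left_mono) auto
    also have "\<dots> = d * pi\<^sup>2 / (8 * real N)" using N by (simp add: t_def power2_eq_square field_simps)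
    finally have s: "real N * d * (1 - cos t) \<le> d * pi\<^sup>2 / (8 * real N)" .
    have "(\<Sum>a\<in>B. g a x * x a) \<le> (\<Sum>a\<in>B. \<bar>x a\<bar>)"
    proof (rule sum_mono)
      fix a
      have "g a x * x a \<le> \<bar>g a x\<bar> * \<bar>x a\<bar>" by (metis abs_ge_self abs_mult)
      also have "\<dots> \<le> 1 * \<bar>x a\<bar>" by (intro mult_right_mono g1) simp
      finally show "g a x * x a \<le> \<bar>x a\<bar>" by simp
    qed
    hence "A \<le> real N * d * (1 - cos t) * (\<Sum>a\<in>B. \<bar>x a\<bar>)"
      unfolding A_def using d by (intro mult_left_mono) auto
    also have "\<dots> \<le> d * pi\<^sup>2 / (8 * real N) * (\<Sum>a\<in>B. \<bar>x a\<bar>)"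
      by (intro mult_right_mono s sum_nonneg) simp
    finally have A: "A \<le> d * pi\<^sup>2 / (8 * real N) * (\<Sum>a\<in>B. \<bar>x a\<bar>)" .
    have "(\<integral>\<^sup>+y. ennreal (exp (real N * (d * Phi (x, y)))) \<partial>P) =
        (\<integral>\<^sup>+y. ennreal (exp A) * ennreal (exp (linear_form n (\<lambda>a. q * c a) y)) \<partial>P)"
      unfolding exp_eq exp_add by (simp add: ennreal_mult')
    also have "\<dots> = ennreal (exp A) * ennreal (exp (form_variance n (\<lambda>a. q * c a) / 2))"
      by (subst nn_integral_cmult) (auto simp: linear_form_law(2))
    also have "\<dots> \<le> ennreal (exp (d * pi\<^sup>2 / (8 * real N) * (\<Sum>a\<in>B. \<bar>x a\<bar>))) *
        ennreal (exp (d\<^sup>2 * pi\<^sup>2 * cov_bound / 8 * card B))"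
      using A V by (intro mult_mono ennreal_leI) auto
    finally show "(\<integral>\<^sup>+y. ennreal (exp (real N * (d * Phi (x, y)))) \<partial>P) \<le>
        ennreal (exp (d\<^sup>2 * pi\<^sup>2 * cov_bound / 8 * card B)) *
        ennreal (exp (d * pi\<^sup>2 / (8 * real N) * (\<Sum>a\<in>B. \<bar>x a\<bar>)))"
      by (simp add: mult.commute)
  qed
  also have "\<dots> = ennreal (exp (d\<^sup>2 * pi\<^sup>2 * cov_bound / 8 * card B)) *
      (\<integral>\<^sup>+x. ennreal (exp (d * pi\<^sup>2 / (8 * real N) * (\<Sum>a\<in>B. \<bar>x a\<bar>))) \<partial>P)"
    by (rule nn_integral_cmult) measurable
  also have "\<dots> \<le> ennreal (exp (d\<^sup>2 * pi\<^sup>2 * cov_bound / 8 * card B)) *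
      ennreal (exp (d * pi\<^sup>2 / (8 * real N) * card B * (ln 2 + cov_bound / 2)))"
    by (intro mult_left_mono nn_integral_exp_sum_abs B) (use d in auto)
  also have "\<dots> = ennreal (exp (card B * (d\<^sup>2 * pi\<^sup>2 * cov_bound / 8 + d * pi\<^sup>2 / (8 * real N) * (ln 2 + cov_bound / 2))))"
    by (subst ennreal_mult''[symmetric]) (auto simp: exp_add[symmetric] algebra_simps)
  finally show ?thesis .
qed

text \<open>Jensen's inequality for an independent copy supplies the factor
  \<open>exp (d * expectation F)\<close>, so the centred negative moment is at most the exponential
  moment of the difference of two copies.\<close>

lemma nn_integral_exp_neg_le:
  fixes F :: "(nat \<Rightarrow> real) \<Rightarrow> real" and g :: "nat \<Rightarrow> (nat \<Rightarrow> real) \<Rightarrow> real"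
  assumes F: "integrable P F"
    and g: "\<And>a. g a \<in> borel_measurable P" "\<And>a x. \<bar>g a x\<bar> \<le> 1"
    and tangent: "\<And>x y. F x + (\<Sum>a\<in>B. g a x * (y a - x a)) \<le> F y"
    and B: "finite B" and N: "1 \<le> N" and d: "0 \<le> d" "d * pi\<^sup>2 / (8 * real N) \<le> 1"
  shows "(\<integral>\<^sup>+\<omega>. ennreal (exp (- (d * F \<omega>))) \<partial>P) \<le> ennreal (exp (- (d * expectation F) +
    card B * (d\<^sup>2 * pi\<^sup>2 * cov_bound / 8 + d * pi\<^sup>2 / (8 * real N) * (ln 2 + cov_bound / 2))))"
proof -
  let ?K = "card B * (d\<^sup>2 * pi\<^sup>2 * cov_bound / 8 + d * pi\<^sup>2 / (8 * real N) * (ln 2 + cov_bound / 2))"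
  let ?I = "\<integral>\<^sup>+\<omega>. ennreal (exp (- (d * F \<omega>))) \<partial>P"
  have [measurable]: "F \<in> borel_measurable P" using F by simp
  have "ennreal (exp (d * expectation F)) \<le> (\<integral>\<^sup>+\<omega>. ennreal (exp (d * F \<omega>)) \<partial>P)"
    using exp_expectation_le[of "\<lambda>\<omega>. d * F \<omega>"] F by simp
  hence "ennreal (exp (d * expectation F)) * ?I \<le> (\<integral>\<^sup>+\<omega>. ennreal (exp (d * F \<omega>)) \<partial>P) * ?I"
    by (rule mult_right_mono) simp
  also have "\<dots> = (\<integral>\<^sup>+x. \<integral>\<^sup>+y. ennreal (exp (d * (F x - F y))) \<partial>P \<partial>P)"
  proof -
    have "(\<integral>\<^sup>+x. \<integral>\<^sup>+y. ennreal (exp (d * (F x - F y))) \<partial>P \<partial>P) =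
        (\<integral>\<^sup>+x. \<integral>\<^sup>+y. ennreal (exp (d * F x)) * ennreal (exp (- (d * F y))) \<partial>P \<partial>P)"
      by (simp add: ennreal_mult'[symmetric] exp_add[symmetric] algebra_simps)
    also have "\<dots> = (\<integral>\<^sup>+x. ennreal (exp (d * F x)) * ?I \<partial>P)" by (simp add: nn_integral_cmult)
    also have "\<dots> = (\<integral>\<^sup>+\<omega>. ennreal (exp (d * F \<omega>)) \<partial>P) * ?I" by (simp add: nn_integral_multc)
    finally show ?thesis by simp
  qed
  also have "\<dots> = (\<integral>\<^sup>+z. ennreal (exp (d * (F (fst z) - F (snd z)))) \<partial>PP)"
    by (subst nn_integral_fst[symmetric]) simp_all
  also have "\<dots> \<le> ennreal (exp ?K)"
    by (rule nn_integral_exp_difference[OF _ g tangent B N d]) simp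
  finally have le: "ennreal (exp (d * expectation F)) * ?I \<le> ennreal (exp ?K)" .
  have "?I = ennreal (exp (- (d * expectation F))) * (ennreal (exp (d * expectation F)) * ?I)"
    unfolding mult.assoc[symmetric] by (subst ennreal_mult''[symmetric]) (simp_all add: exp_add[symmetric])
  also have "\<dots> \<le> ennreal (exp (- (d * expectation F))) * ennreal (exp ?K)"
    by (rule mult_left_mono[OF le]) simp
  also have "\<dots> = ennreal (exp (- (d * expectation F) + ?K))"
    by (subst ennreal_mult''[symmetric]) (simp_all add: exp_add[symmetric])
  finally show ?thesis .
qed

end

section \<open>Partition functions and superadditivity\<close>

text \<open>Fekete's argument: dividing \<open>n\<close> by a nearly optimal \<open>m\<close> bounds
  \<open>s n\<close> from below by the quotient times \<open>s m\<close>, up to a bounded remainder,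
  so the ratios tend to their supremum.\<close>

lemma fekete_superadditive:
  fixes s :: "nat \<Rightarrow> real"
  assumes super: "\<And>m n. 1 \<le> m \<Longrightarrow> 1 \<le> n \<Longrightarrow> s m + s n \<le> s (m + n)"
    and bound: "\<And>n. 1 \<le> n \<Longrightarrow> s n / real n \<le> C"
  shows "convergent (\<lambda>n. s n / real n)"
proof -
  let ?S = "(\<lambda>n. s n / real n) ` {1..}"
  define L where "L = Sup ?S"
  have bdd: "bdd_above ?S" using bound by (intro bdd_aboveI[of _ C]) auto
  have le: "s n / real n \<le> L" if "1 \<le> n" for n
    unfolding L_def by (rule cSup_upper[OF _ bdd]) (use that in auto)
  have "(\<lambda>n. s n / real n) \<longlonglongrightarrow> L"
  proof (rule LIMSEQ_I)
    fix e :: real assume e: "0 < e"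
    have "L - e / 2 < Sup ?S" using e by (simp add: L_def)
    then obtain m where m: "1 \<le> m" "L - e / 2 < s m / real m"
      using less_cSup_iff[OF _ bdd, of "L - e / 2"] by auto
    \<comment> \<open>Superadditivity says nothing about \<open>s 0\<close>, so an empty remainder
      counts as 0.\<close>
    define r where "r i = (if i = 0 then 0 else s i)" for i
    define c where "c = Max ((\<lambda>i. \<bar>r i\<bar>) ` {..<m})"
    have c: "\<bar>r i\<bar> \<le> c" if "i < m" for i unfolding c_def by (rule Max_ge) (use that in auto)
    have mult: "real q * s m + r i \<le> s (q * m + i)" if "1 \<le> q * m + i" for q i
      using that
    proof (induction q)
      case 0
      then show ?case by (simp add: r_def)
    next
      case (Suc q)
      show ?case
      proof (cases "q * m + i = 0")
        case True
        hence "q = 0" "i = 0" using m by auto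
        thus ?thesis by (simp add: r_def)
      next
        case False
        hence "real q * s m + r i \<le> s (q * m + i)" using False by (intro Suc.IH) linarith
        moreover have "s m + s (q * m + i) \<le> s (m + (q * m + i))" using m(1) False by (intro super) linarith+
        moreover have "s (Suc q * m + i) = s (m + (q * m + i))" by (simp add: add.assoc)
        moreover have "real (Suc q) * s m = s m + real q * s m" by (simp add: distrib_right)
        ultimately show ?thesis by linarith
      qed
    qed
    obtain n0 :: nat where n0: "2 * (\<bar>s m\<bar> + c) / e < n0" using reals_Archimedean2 by blast
    have "norm (s n / real n - L) < e" if n: "max 1 n0 \<le> n" for n
    proof -
      define q i where "q = n div m" and "i = n mod m"
      have n_eq: "n = q * m + i" by (simp add: q_def i_def)
      have im: "i < m" using m by (simp add: i_def)
      have "real q * s m + r i \<le> s n" using mult[of q i] n unfolding n_eq by auto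
      moreover have "real q * s m = real n * (s m / real m) - real i / real m * s m"
        using m by (simp add: n_eq field_simps)
      moreover have "real i / real m * s m \<le> \<bar>s m\<bar>"
      proof -
        have "real i / real m * s m \<le> real i / real m * \<bar>s m\<bar>" by (intro mult_left_mono) auto
        also have "\<dots> \<le> 1 * \<bar>s m\<bar>" using im by (intro mult_right_mono) auto
        finally show ?thesis by simp
      qed
      ultimately have "real n * (s m / real m) - (\<bar>s m\<bar> + c) \<le> s n" using c[OF im] by linarith
      hence "(real n * (s m / real m) - (\<bar>s m\<bar> + c)) / real n \<le> s n / real n"
        by (rule divide_right_mono) simp
      moreover have "(real n * (s m / real m) - (\<bar>s m\<bar> + c)) / real n = s m / real m - (\<bar>s m\<bar> + c) / real n"
        using n by (simp add: diff_divide_distrib)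
      moreover have "(\<bar>s m\<bar> + c) / real n < e / 2"
      proof -
        have "2 * (\<bar>s m\<bar> + c) / e < real n" using n0 n by linarith
        thus ?thesis using e n by (simp add: field_simps)
      qed
      ultimately have "L - e < s n / real n" using m by linarith
      thus ?thesis using le[of n] n e by (simp add: abs_if)
    qed
    thus "\<exists>no. \<forall>n\<ge>no. norm (s n / real n - L) < e" by blast
  qed
  thus ?thesis by (rule convergentI)
qed

definition site_weight :: "real \<Rightarrow> (nat \<Rightarrow> real) \<Rightarrow> nat \<Rightarrow> real" where
  "site_weight h \<omega> x = exp (h + \<omega> x)"

lemma site_weight_pos [simp]: "0 < site_weight h \<omega> x"
  by (simp add: site_weight_def)

text \<open>For \<open>W = site_weight h \<omega>\<close> this is the derivative of
  \<open>ln (path_sum p W u v)\<close> in \<open>\<omega> a\<close>. Being a probability, it lies in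
  \<open>[0, 1]\<close>.\<close>

definition visit_prob :: "(nat \<Rightarrow> real) \<Rightarrow> (nat \<Rightarrow> real) \<Rightarrow> nat \<Rightarrow> nat \<Rightarrow> nat \<Rightarrow> real" where
  "visit_prob p W u v a =
     (\<Sum>A\<in>paths u v. of_bool (a \<in> A \<inter> {u<..<v}) * path_weight p W u v A) / path_sum p W u v"

lemma gaps_shift: "gaps ((+) u ` A) = map_prod ((+) u) ((+) u) ` gaps A"
proof (intro equalityI subsetI)
  fix g assume "g \<in> gaps ((+) u ` A)"
  then obtain x y where g: "g = (u + x, u + y)" "x \<in> A" "y \<in> A" "u + x < u + y"
    "{u + x<..<u + y} \<inter> (+) u ` A = {}" by (auto simp: gaps_def)
  have "z \<notin> {x<..<y}" if "z \<in> A" for z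
    using g(5) that by (auto dest: equalityD1[THEN subsetD, of _ _ "u + z"])
  hence "(x, y) \<in> gaps A" using g by (auto simp: gaps_def)
  thus "g \<in> map_prod ((+) u) ((+) u) ` gaps A" using g by (auto intro: rev_image_eqI)
qed (auto simp: gaps_def disjoint_iff)

lemma gap_weight_shift: "gap_weight p ((+) u ` A) = gap_weight p A"
  unfolding gap_weight_def gaps_shift
  by (subst prod.reindex) (auto simp: case_prod_unfold comp_def inj_on_def)

lemma path_sum_shift: "path_sum p W u (u + m) = path_sum p (\<lambda>x. W (u + x)) 0 m"
proof -
  have "path_weight p W u (u + m) ((+) u ` A) = path_weight p (\<lambda>x. W (u + x)) 0 m A" for A
  proof -
    have "(+) u ` A \<inter> {u<..<u + m} = (+) u ` (A \<inter> {0<..<m})" by auto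
    hence "(\<Prod>x\<in>(+) u ` A \<inter> {u<..<u + m}. W x) = (\<Prod>x\<in>A \<inter> {0<..<m}. W (u + x))"
      by (simp add: prod.reindex)
    thus ?thesis by (simp add: path_weight_def gap_weight_shift)
  qed
  moreover have "bij_betw ((`) ((+) u)) (paths 0 m) (paths u (u + m))"
  proof (rule bij_betwI[of _ _ _ "\<lambda>A. (\<lambda>x. x - u) ` A"])
    show "(`) ((+) u) \<in> paths 0 m \<rightarrow> paths u (u + m)" by (force simp: paths_def)
    show "(\<lambda>A. (\<lambda>x. x - u) ` A) \<in> paths u (u + m) \<rightarrow> paths 0 m" by (force simp: paths_def)
    show "(\<lambda>x. x - u) ` (+) u ` A = A" for A by (simp add: image_image)
    fix A assume "A \<in> paths u (u + m)"
    hence "u + (x - u) = x" if "x \<in> A" for x using that by (auto simp: paths_def)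
    thus "(+) u ` (\<lambda>x. x - u) ` A = A" by (force simp: image_image)
  qed
  ultimately show ?thesis unfolding path_sum_def by (subst sum.reindex_bij_betw[symmetric]) auto
qed

context gap_law begin

lemma visit_prob_bounds:
  assumes W: "\<And>x. 0 < W x" and uv: "u \<le> v"
  shows "0 \<le> visit_prob p W u v a" "visit_prob p W u v a \<le> 1" "a \<notin> {u<..<v} \<Longrightarrow> visit_prob p W u v a = 0"
proof -
  note Z = path_sum_pos[of W, OF W uv]
  have w: "0 < path_weight p W u v A" for A by (rule path_weight_pos[of W, OF W])
  show "0 \<le> visit_prob p W u v a"
    unfolding visit_prob_def using Z w by (intro divide_nonneg_pos sum_nonneg mult_nonneg_nonneg) (auto intro: less_imp_le)
  have "(\<Sum>A\<in>paths u v. of_bool (a \<in> A \<inter> {u<..<v}) * path_weight p W u v A) \<le> path_sum p W u v"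
    unfolding path_sum_def by (rule sum_mono) (auto simp: w less_imp_le)
  thus "visit_prob p W u v a \<le> 1" unfolding visit_prob_def using Z by simp
  show "visit_prob p W u v a = 0" if "a \<notin> {u<..<v}"
  proof -
    have "(\<Sum>A\<in>paths u v. of_bool (a \<in> A \<inter> {u<..<v}) * path_weight p W u v A) = 0"
      by (rule sum.neutral) (use that in auto)
    thus ?thesis by (simp only: visit_prob_def div_0)
  qed
qed

text \<open>Passing from \<open>x\<close> to \<open>y\<close> multiplies the weight of
  \<open>A\<close> by \<open>exp (t A)\<close>, where \<open>t A\<close> adds the changes along
  \<open>A\<close>. Jensen's inequality under the path law at \<open>x\<close> bounds the ratio of
  path sums below by \<open>exp s\<close>, with \<open>s\<close> the mean of \<open>t\<close>:
  convexity without differentiation.\<close>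

lemma ln_path_sum_tangent:
  assumes uv: "u \<le> v"
  shows "ln (path_sum p (site_weight h x) u v)
      + (\<Sum>a\<in>{u<..<v}. visit_prob p (site_weight h x) u v a * (y a - x a))
    \<le> ln (path_sum p (site_weight h y) u v)"
proof -
  let ?w = "path_weight p (site_weight h x) u v"
  let ?Z = "\<lambda>x. path_sum p (site_weight h x) u v"
  have Z: "0 < ?Z x" for x by (rule path_sum_pos[of "site_weight h x"]) (use uv in auto)
  have w: "0 < ?w A" for A by (rule path_weight_pos) simp
  define t where "t A = (\<Sum>a\<in>A \<inter> {u<..<v}. y a - x a)" for A
  define s where "s = (\<Sum>a\<in>{u<..<v}. visit_prob p (site_weight h x) u v a * (y a - x a))"
  have wy: "path_weight p (site_weight h y) u v A = ?w A * exp (t A)" for A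
  proof -
    have "(\<Prod>a\<in>A \<inter> {u<..<v}. site_weight h y a) =
        (\<Prod>a\<in>A \<inter> {u<..<v}. site_weight h x a * exp (y a - x a))"
      by (rule prod.cong) (auto simp: site_weight_def exp_add[symmetric])
    also have "\<dots> = (\<Prod>a\<in>A \<inter> {u<..<v}. site_weight h x a) * exp (t A)"
      by (simp add: prod.distrib t_def exp_sum)
    finally show ?thesis by (simp add: path_weight_def)
  qed
  have s: "?Z x * s = (\<Sum>A\<in>paths u v. ?w A * t A)"
  proof -
    have "?Z x * s = (\<Sum>a\<in>{u<..<v}. \<Sum>A\<in>paths u v. of_bool (a \<in> A \<inter> {u<..<v}) * ?w A * (y a - x a))"
      unfolding s_def sum_distrib_left visit_prob_def sum_distrib_right[symmetric]
      using Z[of x] by (intro sum.cong refl) (simp del: sum_mult_of_bool_eq sum_of_bool_mult_eq)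
    also have "\<dots> = (\<Sum>A\<in>paths u v. \<Sum>a\<in>{u<..<v}. of_bool (a \<in> A \<inter> {u<..<v}) * ?w A * (y a - x a))"
      by (rule sum.swap)
    also have "\<dots> = (\<Sum>A\<in>paths u v. \<Sum>a\<in>A \<inter> {u<..<v}. ?w A * (y a - x a))"
      by (intro sum.cong sum.mono_neutral_cong_right) auto
    finally show ?thesis by (simp add: t_def sum_distrib_left)
  qed
  have "exp s * ?Z x = (\<Sum>A\<in>paths u v. exp s * (?w A * (1 + (t A - s))))"
  proof -
    have "(\<Sum>A\<in>paths u v. ?w A * (1 + (t A - s))) = ?Z x + (?Z x * s - ?Z x * s)"
      unfolding s by (simp add: distrib_left sum.distrib right_diff_distrib sum_subtractf path_sum_def
          sum_distrib_right s[unfolded path_sum_def, symmetric])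
    thus ?thesis by (simp add: sum_distrib_left[symmetric])
  qed
  also have "\<dots> \<le> (\<Sum>A\<in>paths u v. exp s * (?w A * exp (t A - s)))"
    by (intro sum_mono mult_left_mono exp_ge_add_one_self less_imp_le[OF w]) simp
  also have "\<dots> = ?Z y"
    unfolding path_sum_def wy by (rule sum.cong) (auto simp: exp_diff)
  finally have "ln (exp s * ?Z x) \<le> ln (?Z y)" using Z[of x] by (intro ln_mono) auto
  thus ?thesis using Z[of x] by (simp add: ln_mult s_def)
qed

text \<open>Paths through \<open>n\<close> are pairs of paths glued at \<open>n\<close>. The
  junction becomes an interior point, whence the factor \<open>W n\<close>.\<close>

lemma path_sum_superadditive:
  assumes W: "\<And>x. 0 < W x" and nm: "1 \<le> n" "1 \<le> m"
  shows "path_sum p W 0 n * W n * path_sum p W n (n + m) \<le> path_sum p W 0 (n + m)"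
proof -
  let ?S = "paths 0 n \<times> paths n (n + m)"
  have w: "path_weight p W 0 n A * W n * path_weight p W n (n + m) C = path_weight p W 0 (n + m) (A \<union> C)"
    and rec: "(A \<union> C) \<inter> {..n} = A" "(A \<union> C) \<inter> {n..} = C" and mem: "A \<union> C \<in> paths 0 (n + m)"
    if AC: "A \<in> paths 0 n" "C \<in> paths n (n + m)" for A C
  proof -
    have b: "x \<le> n" if "x \<in> A" for x using AC that by (auto simp: paths_def)
    have b': "n \<le> x" if "x \<in> C" for x using AC that by (auto simp: paths_def)
    have n: "n \<in> A" "n \<in> C" using AC by (auto simp: paths_def)
    have e: "x = n" if "x \<in> A" "n \<le> x" for x using b[OF that(1)] that by simp
    have e': "x = n" if "x \<in> C" "x \<le> n" for x using b'[OF that(1)] that by simp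
    show r1: "(A \<union> C) \<inter> {..n} = A" using b n e' by blast
    show r2: "(A \<union> C) \<inter> {n..} = C" using b' n e by blast
    show "A \<union> C \<in> paths 0 (n + m)" using AC by (auto simp: paths_def)
    have g: "gap_weight p (A \<union> C) = gap_weight p A * gap_weight p C"
      using gap_weight_split[of "A \<union> C" n p] finite_path[OF AC(1)] finite_path[OF AC(2)] n
      unfolding r1 r2 by simp
    have "(A \<union> C) \<inter> {0<..<n + m} = insert n ((A \<inter> {0<..<n}) \<union> (C \<inter> {n<..<n + m}))"
    proof (intro set_eqI iffI)
      fix x assume "x \<in> (A \<union> C) \<inter> {0<..<n + m}"
      thus "x \<in> insert n ((A \<inter> {0<..<n}) \<union> (C \<inter> {n<..<n + m}))"
        using b[of x] b'[of x] by auto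
    qed (use n nm in auto)
    also have "(\<Prod>x\<in>\<dots>. W x) = W n * ((\<Prod>x\<in>A \<inter> {0<..<n}. W x) * (\<Prod>x\<in>C \<inter> {n<..<n + m}. W x))"
      by (subst prod.insert) (auto intro!: prod.union_disjoint)
    finally show "path_weight p W 0 n A * W n * path_weight p W n (n + m) C = path_weight p W 0 (n + m) (A \<union> C)"
      by (simp add: path_weight_def g mult_ac)
  qed
  have "path_sum p W 0 n * W n * path_sum p W n (n + m) =
      (\<Sum>A\<in>paths 0 n. \<Sum>C\<in>paths n (n + m). path_weight p W 0 n A * W n * path_weight p W n (n + m) C)"
    unfolding path_sum_def by (simp only: sum_distrib_right) (simp only: sum_distrib_left)
  also have "\<dots> = (\<Sum>(A, C)\<in>?S. path_weight p W 0 (n + m) (A \<union> C))"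
    unfolding sum.cartesian_product by (rule sum.cong) (auto simp: w)
  also have "\<dots> = (\<Sum>B\<in>(\<lambda>(A, C). A \<union> C) ` ?S. path_weight p W 0 (n + m) B)"
  proof (subst sum.reindex)
    show "inj_on (\<lambda>(A, C). A \<union> C) ?S"
    proof (rule inj_onI)
      fix x y assume *: "x \<in> ?S" "y \<in> ?S" "(\<lambda>(A, C). A \<union> C) x = (\<lambda>(A, C). A \<union> C) y"
      obtain A C A' C' where xy: "x = (A, C)" "y = (A', C')" by (metis surj_pair)
      have "A \<union> C = A' \<union> C'" using * xy by simp
      thus "x = y" using rec[of A C] rec[of A' C'] * unfolding xy by simp
    qed
  qed (simp add: case_prod_unfold comp_def)
  also have "\<dots> \<le> path_sum p W 0 (n + m)"
    unfolding path_sum_def by (rule sum_mono2) (auto simp: mem intro: less_imp_le[OF path_weight_pos] W)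
  finally show ?thesis .
qed

lemma path_sum_ge:
  assumes W: "\<And>x. 0 < W x" and uv: "u < v"
  shows "p (v - u) \<le> path_sum p W u v"
proof -
  have "gaps {u, v} = {(u, v)}" using uv by (auto simp: gaps_def)
  moreover have "{u, v} \<inter> {u<..<v} = {}" by auto
  ultimately have "path_weight p W u v {u, v} = p (v - u)" by (simp add: path_weight_def gap_weight_def)
  moreover have "path_weight p W u v {u, v} \<le> path_sum p W u v"
    unfolding path_sum_def
    by (rule member_le_sum) (use uv in \<open>auto simp: paths_def intro: less_imp_le[OF path_weight_pos] W\<close>)
  ultimately show ?thesis by simp
qed

lemma gap_weight_le_1: "gap_weight p A \<le> 1"
  unfolding gap_weight_def
  by (rule prod_le_1) (auto simp: gaps_def intro!: less_imp_le[OF p_pos] p_le_1)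

text \<open>Crude count of all subsets times a bound on every weight; it serves the integrability of
  the logarithm and the upper bound on its mean per site.\<close>

lemma path_sum_le:
  "path_sum p (site_weight h \<omega>) u v \<le> 2 ^ (v + 1 - u) * exp (\<Sum>a\<in>{u<..<v}. \<bar>h\<bar> + \<bar>\<omega> a\<bar>)"
proof -
  have "path_weight p (site_weight h \<omega>) u v A \<le> exp (\<Sum>a\<in>{u<..<v}. \<bar>h\<bar> + \<bar>\<omega> a\<bar>)" for A
  proof -
    have "(\<Prod>x\<in>A \<inter> {u<..<v}. site_weight h \<omega> x) = exp (\<Sum>a\<in>A \<inter> {u<..<v}. h + \<omega> a)"
      by (simp add: site_weight_def exp_sum)
    also have "\<dots> \<le> exp (\<Sum>a\<in>{u<..<v}. \<bar>h\<bar> + \<bar>\<omega> a\<bar>)"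
    proof -
      have "(\<Sum>a\<in>A \<inter> {u<..<v}. h + \<omega> a) \<le> (\<Sum>a\<in>A \<inter> {u<..<v}. \<bar>h\<bar> + \<bar>\<omega> a\<bar>)" by (rule sum_mono) auto
      also have "\<dots> \<le> (\<Sum>a\<in>{u<..<v}. \<bar>h\<bar> + \<bar>\<omega> a\<bar>)" by (rule sum_mono2) auto
      finally show ?thesis by simp
    qed
    finally have "gap_weight p A * (\<Prod>x\<in>A \<inter> {u<..<v}. site_weight h \<omega> x)
        \<le> 1 * exp (\<Sum>a\<in>{u<..<v}. \<bar>h\<bar> + \<bar>\<omega> a\<bar>)"
      by (intro mult_mono gap_weight_le_1) (auto intro!: less_imp_le[OF prod_pos])
    thus ?thesis by (simp add: path_weight_def)
  qed
  hence "path_sum p (site_weight h \<omega>) u v \<le> of_nat (card (paths u v)) * exp (\<Sum>a\<in>{u<..<v}. \<bar>h\<bar> + \<bar>\<omega> a\<bar>)"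
    unfolding path_sum_def by (rule sum_bounded_above)
  also have "card (paths u v) \<le> card (Pow {u..v})" by (rule card_mono) (auto simp: paths_def)
  hence "real (card (paths u v)) \<le> 2 ^ (v + 1 - u)" by (simp add: card_Pow flip: of_nat_le_iff)
  finally show ?thesis by (simp add: mult_right_mono)
qed

end

section \<open>Localisation\<close>

lemma site_weight_measurable [measurable]: "(\<lambda>\<omega>. site_weight h \<omega> x) \<in> borel_measurable borel"
  unfolding site_weight_def by measurable

lemma path_weight_measurable [measurable]:
  "(\<lambda>\<omega>. path_weight p (site_weight h \<omega>) u v A) \<in> borel_measurable borel"
  unfolding path_weight_def by measurable

lemma path_sum_measurable [measurable]:
  "(\<lambda>\<omega>. path_sum p (site_weight h \<omega>) u v) \<in> borel_measurable borel"
  unfolding path_sum_def by measurable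

lemma visit_prob_measurable [measurable]:
  "(\<lambda>\<omega>. visit_prob p (site_weight h \<omega>) u v a) \<in> borel_measurable borel"
  unfolding visit_prob_def by measurable

text \<open>Lets a union bound run on moments of order \<open>d\<close>: a term that is at least 1
  has a power at least 1, and if all terms are below 1, each is at most its power.\<close>

lemma min_1_sum_le:
  fixes f :: "'i \<Rightarrow> real"
  assumes f: "\<And>i. i \<in> I \<Longrightarrow> 0 \<le> f i" and d: "0 < d" "d \<le> 1"
  shows "min 1 (\<Sum>i\<in>I. f i) \<le> (\<Sum>i\<in>I. f i powr d)"
proof (cases "\<exists>i\<in>I. 1 \<le> f i \<and> finite I")
  case True
  then obtain i where i: "i \<in> I" "1 \<le> f i" "finite I" by auto
  have "1 \<le> f i powr d" using i d by (intro ge_one_powr_ge_zero) auto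
  also have "\<dots> \<le> (\<Sum>i\<in>I. f i powr d)" by (rule member_le_sum) (use i in auto)
  finally show ?thesis by simp
next
  case False
  show ?thesis
  proof (cases "finite I")
    case True
    have "f i \<le> f i powr d" if "i \<in> I" for i
    proof (cases "f i = 0")
      case False
      hence "0 < f i" "f i < 1" using f[OF that] \<open>\<not> (\<exists>i\<in>I. 1 \<le> f i \<and> finite I)\<close> True that by force+
      thus ?thesis using powr_mono'[of d 1 "f i"] d by simp
    qed simp
    hence "(\<Sum>i\<in>I. f i) \<le> (\<Sum>i\<in>I. f i powr d)" by (rule sum_mono)
    thus ?thesis by simp
  qed simp
qed

text \<open>An interval of length \<open>l\<close> with \<open>u < b\<close> and
  \<open>a < v\<close> has its left end in \<open>{a + 1 - l..<b}\<close>, so it has at most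
  \<open>(b - a) + l\<close> positions. The product \<open>(b - a + 1) * (l + 1)\<close> separates
  the two variables.\<close>

lemma sum_gap_intervals_le:
  assumes q: "0 \<le> q" and ab: "a \<le> b"
  shows "(\<Sum>(u, v) | u < v \<and> v \<le> n \<and> u < b \<and> a < v \<and> L < v - u. q ^ (v - u)) \<le>
    (real (b - a) + 1) * (\<Sum>l\<in>{L<..n}. real (l + 1) * q ^ l)"
proof -
  let ?I = "{(u, v). u < v \<and> v \<le> n \<and> u < b \<and> a < v \<and> L < v - u}"
  let ?J = "SIGMA l:{L<..n}. {a + 1 - l..<b}"
  have "(\<Sum>(u, v)\<in>?I. q ^ (v - u)) = (\<Sum>(l, u)\<in>(\<lambda>(u, v). (v - u, u)) ` ?I. q ^ l)"
    by (subst sum.reindex) (auto simp: inj_on_def case_prod_unfold)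
  also have "\<dots> \<le> (\<Sum>(l, u)\<in>?J. q ^ l)" by (rule sum_mono2) (use q in auto)
  also have "\<dots> = (\<Sum>l\<in>{L<..n}. \<Sum>u\<in>{a + 1 - l..<b}. q ^ l)" by (rule sum.Sigma[symmetric]) auto
  also have "\<dots> \<le> (\<Sum>l\<in>{L<..n}. (real (b - a) + 1) * (real (l + 1) * q ^ l))"
  proof (rule sum_mono)
    fix l
    have "b - (a + 1 - l) \<le> (b - a) + l" using ab by linarith
    also have "\<dots> \<le> (b - a + 1) * (l + 1)" by (simp add: distrib_left distrib_right)
    finally have "b - (a + 1 - l) \<le> (b - a + 1) * (l + 1)" .
    hence "real (b - (a + 1 - l)) \<le> real ((b - a + 1) * (l + 1))" by (rule of_nat_mono)
    hence le: "real (b - (a + 1 - l)) * q ^ l \<le> real ((b - a + 1) * (l + 1)) * q ^ l"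
      using q by (intro mult_right_mono) auto
    have "(\<Sum>u\<in>{a + 1 - l..<b}. q ^ l) = real (b - (a + 1 - l)) * q ^ l" by simp
    also note le
    also have "real ((b - a + 1) * (l + 1)) * q ^ l = (real (b - a) + 1) * (real (l + 1) * q ^ l)"
      by (simp only: of_nat_mult of_nat_add of_nat_1 mult.assoc)
    finally show "(\<Sum>u\<in>{a + 1 - l..<b}. q ^ l) \<le> (real (b - a) + 1) * (real (l + 1) * q ^ l)" .
  qed
  finally show ?thesis by (simp add: sum_distrib_left)
qed

lemma geometric_tail_small:
  fixes q e :: real
  assumes q: "0 \<le> q" "q < 1" and e: "0 < e"
  obtains L where "L0 \<le> L" "\<And>n. (\<Sum>l\<in>{L<..n}. real (l + 1) * q ^ l) \<le> e"
proof -
  have "(\<lambda>l. real (Suc l) * q ^ l) sums (1 / (1 - q)\<^sup>2)" using q by (intro geometric_deriv_sums) simp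
  hence s: "summable (\<lambda>l. real (l + 1) * q ^ l)" by (simp add: sums_iff)
  obtain L1 where L1: "norm (\<Sum>i. real (i + n + 1) * q ^ (i + n)) < e" if "L1 \<le> n" for n
    using suminf_exist_split[OF e s] by auto
  define L where "L = max L0 L1"
  have "(\<Sum>l\<in>{L<..n}. real (l + 1) * q ^ l) \<le> e" for n
  proof -
    have "(\<Sum>l\<in>{L<..n}. real (l + 1) * q ^ l) \<le> (\<Sum>l\<in>(\<lambda>i. i + L) ` {..n}. real (l + 1) * q ^ l)"
    proof (rule sum_mono2)
      show "{L<..n} \<subseteq> (\<lambda>i. i + L) ` {..n}"
      proof
        fix l assume "l \<in> {L<..n}"
        thus "l \<in> (\<lambda>i. i + L) ` {..n}" by (intro image_eqI[of _ _ "l - L"]) auto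
      qed
    qed (use q in auto)
    also have "\<dots> = (\<Sum>i\<le>n. real (i + L + 1) * q ^ (i + L))"
      by (subst sum.reindex) (auto simp: inj_on_def)
    also have "\<dots> \<le> (\<Sum>i. real (i + L + 1) * q ^ (i + L))"
      using summable_ignore_initial_segment[OF s, of L] q by (intro sum_le_suminf) auto
    also have "\<dots> \<le> e" using L1[of L] by (auto simp: L_def)
    finally show ?thesis .
  qed
  thus ?thesis using that[of L] by (simp add: L_def)
qed

locale disordered_gap_law = gap_law p + gaussian_disorder P
  for p :: "nat \<Rightarrow> real" and P :: "(nat \<Rightarrow> real) measure"
begin

text \<open>The weight of the endpoint is left out; for \<open>m \<ge> 1\<close>, the mean logarithm
  of the partition function is \<open>mean_log h m + h\<close>.\<close>

definition mean_log :: "real \<Rightarrow> nat \<Rightarrow> real" where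
  "mean_log h m = (\<integral>\<omega>. ln (path_sum p (site_weight h \<omega>) 0 m) \<partial>P)"

lemma path_sum_measurable_P [measurable]:
  "(\<lambda>\<omega>. path_sum p (site_weight h \<omega>) u v) \<in> borel_measurable P"
  by (rule measurable_P) measurable

lemma path_sum_site_pos: "u \<le> v \<Longrightarrow> 0 < path_sum p (site_weight h \<omega>) u v"
  by (rule path_sum_pos) simp_all

lemma ln_path_sum_le:
  "u < v \<Longrightarrow> ln (path_sum p (site_weight h \<omega>) u v) \<le> real (v + 1 - u) * ln 2 + (\<Sum>a\<in>{u<..<v}. \<bar>h\<bar> + \<bar>\<omega> a\<bar>)"
proof -
  assume uv: "u < v"
  have "ln (path_sum p (site_weight h \<omega>) u v) \<le> ln (2 ^ (v + 1 - u) * exp (\<Sum>a\<in>{u<..<v}. \<bar>h\<bar> + \<bar>\<omega> a\<bar>))"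
    by (rule ln_mono) (use path_sum_site_pos path_sum_le uv in auto)
  thus ?thesis by (simp add: ln_mult ln_realpow)
qed

lemma ln_path_sum_integrable:
  assumes uv: "u < v"
  shows "integrable P (\<lambda>\<omega>. ln (path_sum p (site_weight h \<omega>) u v))"
proof (rule Bochner_Integration.integrable_bound)
  let ?g = "\<lambda>\<omega>. \<bar>ln (p (v - u))\<bar> + (real (v + 1 - u) * ln 2 + (\<Sum>a\<in>{u<..<v}. \<bar>h\<bar> + \<bar>\<omega> a\<bar>))"
  show "integrable P ?g" using coordinate_integrable(1) by auto
  show "AE \<omega> in P. norm (ln (path_sum p (site_weight h \<omega>) u v)) \<le> norm (?g \<omega>)"
  proof (rule AE_I2)
    fix \<omega> :: "nat \<Rightarrow> real"
    have "ln (p (v - u)) \<le> ln (path_sum p (site_weight h \<omega>) u v)"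
      using path_sum_ge[of "site_weight h \<omega>" u v] p_pos[of "v - u"] uv path_sum_site_pos[of u v h \<omega>]
      by (intro ln_mono) auto
    moreover have "0 \<le> (\<Sum>a\<in>{u<..<v}. \<bar>h\<bar> + \<bar>\<omega> a\<bar>)" by (intro sum_nonneg) auto
    moreover have "0 \<le> real (v + 1 - u) * ln 2" by simp
    ultimately show "norm (ln (path_sum p (site_weight h \<omega>) u v)) \<le> norm (?g \<omega>)"
      using ln_path_sum_le[OF uv, of h \<omega>] unfolding real_norm_def by linarith
  qed
qed measurable

lemma expectation_ln_path_sum:
  "u < v \<Longrightarrow> (\<integral>\<omega>. ln (path_sum p (site_weight h \<omega>) u v) \<partial>P) = mean_log h (v - u)"
proof -
  assume uv: "u < v"
  have "ln (path_sum p (site_weight h \<omega>) u v) =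
      ln (path_sum p (site_weight h (\<lambda>a. \<omega> (u + a))) 0 (v - u))" for \<omega>
    using path_sum_shift[of p "site_weight h \<omega>" u "v - u"] uv by (simp add: site_weight_def[abs_def])
  thus ?thesis
    using integral_shift[of "\<lambda>\<omega>. ln (path_sum p (site_weight h \<omega>) 0 (v - u))" u] by (simp add: mean_log_def)
qed

text \<open>The sum \<open>F\<close> of the logarithms has mean at least \<open>f * T\<close>, with
  \<open>T\<close> the total length, and a subgradient with entries in \<open>[0, 1]\<close> because
  the intervals are disjoint. The variance term is quadratic in \<open>d\<close> and becomes
  negligible for small \<open>d\<close>; the discretisation error is linear in \<open>d\<close> like
  the mean, so it has to be made small through \<open>N\<close>.\<close>

lemma localisation:
  assumes f: "0 < f" "\<And>m. L0 \<le> m \<Longrightarrow> f * real m \<le> mean_log h m"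
  obtains d r where "0 < d" "d \<le> 1" "0 < r"
    "\<And>G. finite G \<Longrightarrow> disjoint_family_on (\<lambda>(u, v). {u..<v}) G \<Longrightarrow>
      (\<And>u v. (u, v) \<in> G \<Longrightarrow> u < v \<and> L0 < v - u) \<Longrightarrow>
      (\<integral>\<^sup>+\<omega>. ennreal ((\<Prod>(u, v)\<in>G. 1 / path_sum p (site_weight h \<omega>) u v) powr d) \<partial>P)
        \<le> ennreal (exp (- (r * (\<Sum>(u, v)\<in>G. real (v - u)))))"
proof -
  define c where "c = pi\<^sup>2 / 8 * (ln 2 + cov_bound / 2)"
  have c: "0 \<le> c" unfolding c_def using cov_bound_nonneg by simp
  \<comment> \<open>\<open>N > 2\<close> serves \<open>dN\<close>, and \<open>N > 4 * c / f\<close>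
    keeps the discretisation error below a quarter of the mean.\<close>
  obtain N :: nat where N: "max 2 (4 * c / f) < N" using reals_Archimedean2 by blast
  hence N1: "1 \<le> N" and Nc: "c / real N \<le> f / 4" using f by (auto simp: field_simps)
  \<comment> \<open>The middle bound keeps the variance term below another quarter of the mean, the
    summand 1 guarding against \<open>cov_bound = 0\<close>. Half of the mean is left, hence
    \<open>r = d * f / 2\<close>.\<close>
  define d where "d = min 1 (min (f / (pi\<^sup>2 * cov_bound + 1)) (1 / 2))"
  have cb: "0 < pi\<^sup>2 * cov_bound + 1" using cov_bound_nonneg by (simp add: add_nonneg_pos)
  have d: "0 < d" "d \<le> 1" using f cb by (auto simp: d_def)
  have "d \<le> f / (pi\<^sup>2 * cov_bound + 1)" by (simp add: d_def)
  hence "d * (pi\<^sup>2 * cov_bound + 1) \<le> f" using cb by (simp add: pos_le_divide_eq)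
  hence dc: "d * (pi\<^sup>2 * cov_bound / 8) \<le> f / 4" using d f by (simp add: algebra_simps)
  have dN: "d * pi\<^sup>2 / (8 * real N) \<le> 1"
  proof -
    have "pi\<^sup>2 \<le> 4\<^sup>2" using pi_less_4 by (intro power_mono) auto
    hence "d * pi\<^sup>2 \<le> 1 * 16" using d by (intro mult_mono) auto
    also have "\<dots> \<le> 8 * real N" using N by simp
    finally show ?thesis using N1 by simp
  qed
  define r where "r = d * f / 2"
  have r: "0 < r" using d f by (simp add: r_def)
  show thesis
  proof (rule that[OF d r])
    fix G :: "(nat \<times> nat) set"
    assume G: "finite G" "disjoint_family_on (\<lambda>(u, v). {u..<v}) G"
      and len: "\<And>u v. (u, v) \<in> G \<Longrightarrow> u < v \<and> L0 < v - u"
    define F where "F \<omega> = (\<Sum>(u, v)\<in>G. ln (path_sum p (site_weight h \<omega>) u v))" for \<omega>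
    define g where "g a \<omega> = (\<Sum>(u, v)\<in>G. visit_prob p (site_weight h \<omega>) u v a)" for a \<omega>
    define B where "B = (\<Union>(u, v)\<in>G. {u<..<v})"
    define T where "T = (\<Sum>(u, v)\<in>G. real (v - u))"
    have B: "finite B" using G(1) by (auto simp: B_def)
    have cardB: "real (card B) \<le> T"
    proof -
      have "card B \<le> (\<Sum>x\<in>G. card (case x of (u, v) \<Rightarrow> {u<..<v}))" unfolding B_def by (rule card_UN_le[OF G(1)])
      also have "\<dots> \<le> (\<Sum>(u, v)\<in>G. v - u)" by (rule sum_mono) auto
      finally have "real (card B) \<le> real (\<Sum>(u, v)\<in>G. v - u)" by (rule of_nat_mono)
      thus ?thesis by (simp add: T_def case_prod_unfold)
    qed
    have T0: "0 \<le> T" unfolding T_def by (rule sum_nonneg) auto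
    have F: "integrable P F" unfolding F_def[abs_def] case_prod_unfold
      by (rule Bochner_Integration.integrable_sum) (use len ln_path_sum_integrable in auto)
    have EF: "f * T \<le> expectation F"
    proof -
      have "f * T = (\<Sum>(u, v)\<in>G. f * real (v - u))" by (simp add: T_def sum_distrib_left case_prod_unfold)
      also have "\<dots> \<le> (\<Sum>(u, v)\<in>G. mean_log h (v - u))"
      proof (rule sum_mono, clarify)
        fix u v assume "(u, v) \<in> G"
        thus "f * real (v - u) \<le> mean_log h (v - u)" using f(2)[of "v - u"] len[of u v] by simp
      qed
      also have "\<dots> = (\<Sum>x\<in>G. \<integral>\<omega>. ln (path_sum p (site_weight h \<omega>) (fst x) (snd x)) \<partial>P)"
        by (rule sum.cong) (use len expectation_ln_path_sum in auto)
      also have "\<dots> = expectation F"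
        unfolding F_def[abs_def] case_prod_unfold
        by (rule Bochner_Integration.integral_sum[symmetric]) (use len ln_path_sum_integrable in auto)
      finally show ?thesis .
    qed
    have visit: "0 \<le> visit_prob p (site_weight h \<omega>) u v a" "visit_prob p (site_weight h \<omega>) u v a \<le> 1"
      "a \<notin> {u<..<v} \<Longrightarrow> visit_prob p (site_weight h \<omega>) u v a = 0" if "(u, v) \<in> G" for \<omega> u v a
      using visit_prob_bounds[of "site_weight h \<omega>" u v a] len[OF that] by auto
    have g1: "\<bar>g a \<omega>\<bar> \<le> 1" for a \<omega>
    proof -
      have "0 \<le> g a \<omega>" unfolding g_def by (rule sum_nonneg) (use visit in auto)
      moreover have "g a \<omega> \<le> 1"
      proof (cases "\<exists>u v. (u, v) \<in> G \<and> a \<in> {u<..<v}")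
        case True
        then obtain u v where uv: "(u, v) \<in> G" "a \<in> {u<..<v}" by blast
        have "g a \<omega> = (\<Sum>(u, v)\<in>{(u, v)}. visit_prob p (site_weight h \<omega>) u v a)"
          unfolding g_def
        proof (rule sum.mono_neutral_right[OF G(1)])
          show "\<forall>i\<in>G - {(u, v)}. (case i of (u, v) \<Rightarrow> visit_prob p (site_weight h \<omega>) u v a) = 0"
          proof
            fix i assume i: "i \<in> G - {(u, v)}"
            obtain u' v' where iv: "i = (u', v')" by force
            have *: "(u', v') \<in> G" "(u', v') \<notin> {(u, v)}" using i iv by auto
            have "{u..<v} \<inter> {u'..<v'} = {}"
              using disjoint_family_onD[OF G(2) uv(1) *(1)] *(2) by auto
            hence "a \<notin> {u'<..<v'}" using uv(2) by auto
            thus "(case i of (u, v) \<Rightarrow> visit_prob p (site_weight h \<omega>) u v a) = 0"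
              using visit(3)[OF *(1)] iv by simp
          qed
        qed (use uv in auto)
        thus ?thesis using visit(2)[OF uv(1)] by simp
      next
        case False
        hence "g a \<omega> = 0" unfolding g_def by (intro sum.neutral) (auto intro!: visit(3))
        thus ?thesis by simp
      qed
      ultimately show ?thesis by simp
    qed
    have tangent: "F x + (\<Sum>a\<in>B. g a x * (y a - x a)) \<le> F y" for x y
    proof -
      have "(\<Sum>a\<in>B. g a x * (y a - x a)) =
          (\<Sum>a\<in>B. \<Sum>(u, v)\<in>G. visit_prob p (site_weight h x) u v a * (y a - x a))"
        by (simp add: g_def sum_distrib_right case_prod_unfold)
      also have "\<dots> = (\<Sum>i\<in>G. \<Sum>a\<in>B. visit_prob p (site_weight h x) (fst i) (snd i) a * (y a - x a))"
        unfolding case_prod_unfold by (rule sum.swap)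
      also have "\<dots> = (\<Sum>i\<in>G. \<Sum>a\<in>{fst i<..<snd i}. visit_prob p (site_weight h x) (fst i) (snd i) a * (y a - x a))"
      proof (rule sum.cong[OF refl], rule sum.mono_neutral_right[OF B])
        fix i assume i: "i \<in> G"
        show "{fst i<..<snd i} \<subseteq> B" using i by (force simp: B_def)
        show "\<forall>a\<in>B - {fst i<..<snd i}. visit_prob p (site_weight h x) (fst i) (snd i) a * (y a - x a) = 0"
          using visit(3)[of "fst i" "snd i"] i by auto
      qed
      finally have "F x + (\<Sum>a\<in>B. g a x * (y a - x a)) =
          (\<Sum>i\<in>G. ln (path_sum p (site_weight h x) (fst i) (snd i)) +
            (\<Sum>a\<in>{fst i<..<snd i}. visit_prob p (site_weight h x) (fst i) (snd i) a * (y a - x a)))"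
        by (simp add: F_def sum.distrib case_prod_unfold)
      also have "\<dots> \<le> F y"
        unfolding F_def case_prod_unfold
        by (rule sum_mono, rule ln_path_sum_tangent) (use len in \<open>auto intro: less_imp_le\<close>)
      finally show ?thesis .
    qed
    have gm: "g a \<in> borel_measurable P" for a
      unfolding g_def[abs_def] case_prod_unfold by (rule measurable_P) measurable
    have eq: "(\<Prod>(u, v)\<in>G. 1 / path_sum p (site_weight h \<omega>) u v) powr d = exp (- (d * F \<omega>))" for \<omega>
    proof -
      have pos: "0 < path_sum p (site_weight h \<omega>) (fst i) (snd i)" if "i \<in> G" for i
        using len[of "fst i" "snd i"] that by (intro path_sum_site_pos) auto
      have "(\<Prod>i\<in>G. 1 / path_sum p (site_weight h \<omega>) (fst i) (snd i)) = exp (- F \<omega>)"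
        unfolding F_def case_prod_unfold sum_negf[symmetric] exp_sum[OF G(1)]
        by (rule prod.cong) (auto simp: exp_minus pos inverse_eq_divide)
      thus ?thesis by (simp add: case_prod_unfold powr_def)
    qed
    have "(\<integral>\<^sup>+\<omega>. ennreal ((\<Prod>(u, v)\<in>G. 1 / path_sum p (site_weight h \<omega>) u v) powr d) \<partial>P) \<le>
        ennreal (exp (- (d * expectation F) + card B * (d\<^sup>2 * pi\<^sup>2 * cov_bound / 8 +
          d * pi\<^sup>2 / (8 * real N) * (ln 2 + cov_bound / 2))))"
      unfolding eq by (rule nn_integral_exp_neg_le[OF F gm g1 tangent B N1 less_imp_le[OF d(1)] dN])
    also have "\<dots> \<le> ennreal (exp (- (r * T)))"
    proof (intro ennreal_leI, subst exp_le_cancel_iff)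
      have e: "d\<^sup>2 * pi\<^sup>2 * cov_bound / 8 + d * pi\<^sup>2 / (8 * real N) * (ln 2 + cov_bound / 2) =
          d * (d * (pi\<^sup>2 * cov_bound / 8) + c / real N)"
        by (simp add: c_def power2_eq_square field_simps)
      have "d * (d * (pi\<^sup>2 * cov_bound / 8) + c / real N) \<le> d * (f / 2)"
        using dc Nc d by (intro mult_left_mono) auto
      hence "card B * (d * (d * (pi\<^sup>2 * cov_bound / 8) + c / real N)) \<le> T * (d * (f / 2))"
      proof (rule mult_mono[OF cardB _ T0])
        show "0 \<le> d * (d * (pi\<^sup>2 * cov_bound / 8) + c / real N)"
          using d c cov_bound_nonneg by simp
      qed
      moreover have "d * (f * T) \<le> d * expectation F" using EF d by (intro mult_left_mono) auto
      ultimately show "- (d * expectation F) + card B * (d\<^sup>2 * pi\<^sup>2 * cov_bound / 8 +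
          d * pi\<^sup>2 / (8 * real N) * (ln 2 + cov_bound / 2)) \<le> - (r * T)"
        unfolding e by (simp add: r_def algebra_simps)
    qed
    finally show "(\<integral>\<^sup>+\<omega>. ennreal ((\<Prod>(u, v)\<in>G. 1 / path_sum p (site_weight h \<omega>) u v) powr d) \<partial>P)
        \<le> ennreal (exp (- (r * (\<Sum>(u, v)\<in>G. real (v - u)))))" by (simp add: T_def)
  qed
qed

end

context disordered_gap_law begin

text \<open>Half of the rate \<open>r\<close> yields decay in the total length, which is at least
  \<open>e * (b - a)\<close>. The other half leaves the weight \<open>q ^ (v - u)\<close> on each
  interval and pays for the number of families: for large \<open>L\<close> their weights add up to
  at most \<open>exp ((b - a + 1) * r * e / 4)\<close>, so the rate \<open>r * e / 4\<close>
  survives.\<close>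

lemma gap_family_sum_expectation:
  assumes d: "0 < d" "d \<le> 1" and r: "0 < r" and e: "0 < e"
    and loc: "\<And>G. finite G \<Longrightarrow> disjoint_family_on (\<lambda>(u, v). {u..<v}) G \<Longrightarrow>
      (\<And>u v. (u, v) \<in> G \<Longrightarrow> u < v \<and> L0 < v - u) \<Longrightarrow>
      (\<integral>\<^sup>+\<omega>. ennreal ((\<Prod>(u, v)\<in>G. 1 / path_sum p (site_weight h \<omega>) u v) powr d) \<partial>P)
        \<le> ennreal (exp (- (r * (\<Sum>(u, v)\<in>G. real (v - u)))))"
  obtains L where "1 \<le> L"
    "\<And>n a b. a \<le> b \<Longrightarrow>
      (\<integral>\<^sup>+\<omega>. ennreal (min 1 (gap_family_sum p (site_weight h \<omega>) n L a b (e * real (b - a)))) \<partial>P)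
        \<le> ennreal (exp (r * e / 4) * exp (- (r * e / 4) * real (b - a)))"
proof -
  define q where "q = exp (- (r / 2))"
  have q: "0 \<le> q" "q < 1" using r by (auto simp: q_def)
  obtain L where L: "max 1 L0 \<le> L" "\<And>n. (\<Sum>l\<in>{L<..n}. real (l + 1) * q ^ l) \<le> r * e / 4"
    by (rule geometric_tail_small[OF q, of "r * e / 4" "max 1 L0"]) (use r e in auto)
  show thesis
  proof (rule that[of L])
    fix n a b :: nat assume ab: "a \<le> b"
    define m where "m = real (b - a)"
    let ?F = "gap_families n L a b (e * m)"
    let ?I = "{(u, v). u < v \<and> v \<le> n \<and> u < b \<and> a < v \<and> L < v - u}"
    let ?x = "\<lambda>(u, v). q ^ (v - u)"
    let ?X = "\<lambda>G \<omega>. (\<Prod>(u, v)\<in>G. 1 / path_sum p (site_weight h \<omega>) u v)"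
    have Fin: "finite G" "disjoint_family_on (\<lambda>(u, v). {u..<v}) G" "G \<subseteq> ?I" "e * m \<le> (\<Sum>(u, v)\<in>G. real (v - u))"
      if "G \<in> ?F" for G using that gap_families_finite[OF that] by (auto simp: gap_families_def)
    have X0: "0 \<le> ?X G \<omega>" if "G \<in> ?F" for G \<omega>
    proof (rule prod_nonneg)
      fix i assume "i \<in> G"
      moreover obtain u v where "i = (u, v)" by force
      ultimately have "u \<le> v" using Fin(3)[OF that] by auto
      thus "0 \<le> (case i of (u, v) \<Rightarrow> 1 / path_sum p (site_weight h \<omega>) u v)"
        using path_sum_site_pos[of u v h \<omega>] \<open>i = (u, v)\<close> by simp
    qed
    have [measurable]: "?X G \<in> borel_measurable P" for G unfolding case_prod_unfold by measurable
    have one: "(\<integral>\<^sup>+\<omega>. ennreal (?X G \<omega> powr d) \<partial>P) \<le> ennreal (exp (- (r * e / 2) * m) * (\<Prod>i\<in>G. ?x i))"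
      if G: "G \<in> ?F" for G
    proof -
      let ?T = "\<Sum>(u, v)\<in>G. real (v - u)"
      have "(\<integral>\<^sup>+\<omega>. ennreal (?X G \<omega> powr d) \<partial>P) \<le> ennreal (exp (- (r * ?T)))"
        by (rule loc[OF Fin(1,2)[OF G]]) (use Fin(3)[OF G] L(1) in auto)
      also have "\<dots> \<le> ennreal (exp (- (r * e / 2) * m) * (\<Prod>i\<in>G. ?x i))"
      proof (rule ennreal_leI)
        have "(\<Prod>i\<in>G. ?x i) = exp (- (r / 2) * ?T)"
          unfolding sum_distrib_left exp_sum[OF Fin(1)[OF G]]
          by (rule prod.cong) (auto simp: q_def exp_of_nat_mult[symmetric] mult.commute)
        moreover have "r / 2 * (e * m) \<le> r / 2 * ?T" using Fin(4)[OF G] r by (intro mult_left_mono) auto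
        ultimately show "exp (- (r * ?T)) \<le> exp (- (r * e / 2) * m) * (\<Prod>i\<in>G. ?x i)"
          by (simp add: exp_add[symmetric] algebra_simps)
      qed
      finally show ?thesis .
    qed
    have x0: "0 \<le> ?x i" for i using q by (cases i) auto
    have finI: "finite ?I" by (rule finite_gap_interval_set)
    \<comment> \<open>Enlarging the sum to all subsets of \<open>?I\<close> makes it factorise over
      the intervals.\<close>
    have "(\<Sum>G\<in>?F. \<Prod>i\<in>G. ?x i) \<le> (\<Sum>G\<in>Pow ?I. \<Prod>i\<in>G. ?x i)"
      by (rule sum_mono2) (use finI Fin(3) q(1) in \<open>auto intro!: prod_nonneg\<close>)
    also have "\<dots> = (\<Prod>i\<in>?I. ?x i + 1)" by (subst prod_add[OF finI]) simp
    also have "\<dots> \<le> (\<Prod>i\<in>?I. exp (?x i))"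
      by (rule prod_mono) (use x0 in \<open>auto simp: add.commute intro!: add_nonneg_nonneg\<close>)
    also have "\<dots> = exp (\<Sum>i\<in>?I. ?x i)" by (rule exp_sum[OF finI, symmetric])
    also have "\<dots> \<le> exp ((m + 1) * (r * e / 4))"
    proof (subst exp_le_cancel_iff)
      have "(\<Sum>i\<in>?I. ?x i) \<le> (m + 1) * (\<Sum>l\<in>{L<..n}. real (l + 1) * q ^ l)"
        unfolding m_def by (rule sum_gap_intervals_le[OF q(1) ab])
      also have "\<dots> \<le> (m + 1) * (r * e / 4)" by (intro mult_left_mono L(2)) (simp add: m_def)
      finally show "(\<Sum>i\<in>?I. ?x i) \<le> (m + 1) * (r * e / 4)" .
    qed
    finally have sum: "(\<Sum>G\<in>?F. \<Prod>i\<in>G. ?x i) \<le> exp ((m + 1) * (r * e / 4))" .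
    have "(\<integral>\<^sup>+\<omega>. ennreal (min 1 (gap_family_sum p (site_weight h \<omega>) n L a b (e * m))) \<partial>P) \<le>
        (\<integral>\<^sup>+\<omega>. (\<Sum>G\<in>?F. ennreal (?X G \<omega> powr d)) \<partial>P)"
    proof (rule nn_integral_mono)
      fix \<omega> :: "nat \<Rightarrow> real"
      have "min 1 (gap_family_sum p (site_weight h \<omega>) n L a b (e * m)) \<le> (\<Sum>G\<in>?F. ?X G \<omega> powr d)"
        unfolding gap_family_sum_def by (rule min_1_sum_le[OF X0 d])
      thus "ennreal (min 1 (gap_family_sum p (site_weight h \<omega>) n L a b (e * m))) \<le> (\<Sum>G\<in>?F. ennreal (?X G \<omega> powr d))"
        by (simp add: sum_ennreal ennreal_leI)
    qed
    also have "\<dots> = (\<Sum>G\<in>?F. \<integral>\<^sup>+\<omega>. ennreal (?X G \<omega> powr d) \<partial>P)" by (rule nn_integral_sum) measurable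
    also have "\<dots> \<le> (\<Sum>G\<in>?F. ennreal (exp (- (r * e / 2) * m) * (\<Prod>i\<in>G. ?x i)))" by (rule sum_mono[OF one])
    also have "\<dots> = ennreal (exp (- (r * e / 2) * m) * (\<Sum>G\<in>?F. \<Prod>i\<in>G. ?x i))"
      unfolding sum_distrib_left by (rule sum_ennreal) (intro mult_nonneg_nonneg prod_nonneg x0, simp)
    also have "\<dots> \<le> ennreal (exp (- (r * e / 2) * m) * exp ((m + 1) * (r * e / 4)))"
      by (intro ennreal_leI mult_left_mono sum) simp
    also have "exp (- (r * e / 2) * m) * exp ((m + 1) * (r * e / 4)) = exp (r * e / 4) * exp (- (r * e / 4) * m)"
      by (simp add: exp_add[symmetric] field_simps)
    finally show "(\<integral>\<^sup>+\<omega>. ennreal (min 1 (gap_family_sum p (site_weight h \<omega>) n L a b (e * real (b - a)))) \<partial>P)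
        \<le> ennreal (exp (r * e / 4) * exp (- (r * e / 4) * real (b - a)))" by (simp add: m_def)
  qed (use L(1) in simp)
qed

text \<open>Exponential Markov inequality: a site of weight below \<open>exp (h - K)\<close> has
  \<open>\<bar>\<omega> y\<bar>\<close> above \<open>K\<close>, so many such sites make the sum of
  these absolute values large. \<open>X\<close> is the resulting majorant of the indicator.\<close>

lemma low_weight_sites:
  assumes e: "0 < e"
  obtains w X where "0 < w" "\<And>a b. X a b \<in> borel_measurable P"
    "\<And>a b \<omega>. of_bool (e * real (b - a) < real (card {y \<in> {a<..<b}. site_weight h \<omega> y < w})) \<le> (X a b \<omega> :: real)"
    "\<And>a b. (\<integral>\<^sup>+\<omega>. ennreal (X a b \<omega>) \<partial>P) \<le> ennreal (exp (- real (b - a)))"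
proof -
  define g where "g = ln 2 + cov_bound / 2"
  have g: "0 \<le> g" using cov_bound_nonneg by (simp add: g_def)
  \<comment> \<open>\<open>K * e = g + 1\<close> exceeds the growth rate \<open>g\<close> of the
    exponential moment by 1, which leaves the decay rate 1.\<close>
  define K where "K = (g + 1) / e"
  have K: "0 \<le> K" using g e by (simp add: K_def)
  define X where "X a b \<omega> = exp (- ((g + 1) * real (b - a))) * exp (1 * (\<Sum>y\<in>{a<..<b}. \<bar>\<omega> y\<bar>))" for a b and \<omega> :: "nat \<Rightarrow> real"
  show thesis
  proof (rule that[of "exp (h - K)" X])
    show "X a b \<in> borel_measurable P" for a b unfolding X_def[abs_def] by measurable
    fix a b :: nat
    show "of_bool (e * real (b - a) < real (card {y \<in> {a<..<b}. site_weight h \<omega> y < exp (h - K)})) \<le> X a b \<omega>" for \<omega>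
    proof (cases "e * real (b - a) < real (card {y \<in> {a<..<b}. site_weight h \<omega> y < exp (h - K)})")
      case True
      let ?D = "{y \<in> {a<..<b}. site_weight h \<omega> y < exp (h - K)}"
      have "(g + 1) * real (b - a) = K * (e * real (b - a))" using e by (simp add: K_def)
      also have "\<dots> \<le> K * real (card ?D)" using True K by (intro mult_left_mono) auto
      also have "\<dots> = (\<Sum>y\<in>?D. K)" by simp
      also have "\<dots> \<le> (\<Sum>y\<in>?D. \<bar>\<omega> y\<bar>)" by (rule sum_mono) (auto simp: site_weight_def)
      also have "\<dots> \<le> (\<Sum>y\<in>{a<..<b}. \<bar>\<omega> y\<bar>)" by (rule sum_mono2) auto
      finally have "1 \<le> X a b \<omega>" by (simp add: X_def exp_add[symmetric])
      thus ?thesis by simp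
    qed (simp add: X_def)
    have "(\<integral>\<^sup>+\<omega>. ennreal (X a b \<omega>) \<partial>P) = ennreal (exp (- ((g + 1) * real (b - a)))) *
        (\<integral>\<^sup>+\<omega>. ennreal (exp (1 * (\<Sum>y\<in>{a<..<b}. \<bar>\<omega> y\<bar>))) \<partial>P)"
      unfolding X_def by (subst ennreal_mult'', simp, subst nn_integral_cmult) measurable
    also have "\<dots> \<le> ennreal (exp (- ((g + 1) * real (b - a)))) * ennreal (exp (1 * real (card {a<..<b}) * g))"
      unfolding g_def by (rule mult_left_mono[OF nn_integral_exp_sum_abs]) auto
    also have "\<dots> \<le> ennreal (exp (- ((g + 1) * real (b - a)))) * ennreal (exp (real (b - a) * g))"
      by (intro mult_left_mono ennreal_leI) (use g in \<open>auto intro!: mult_right_mono\<close>)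
    also have "\<dots> = ennreal (exp (- real (b - a)))"
      by (subst ennreal_mult''[symmetric]) (simp_all add: exp_add[symmetric] algebra_simps)
    finally show "(\<integral>\<^sup>+\<omega>. ennreal (X a b \<omega>) \<partial>P) \<le> ennreal (exp (- real (b - a)))" .
  qed simp
qed

section \<open>Free energy\<close>

text \<open>The junction site contributes \<open>h\<close> on average because the disorder is
  centred; so \<open>mean_log h n + h\<close> is superadditive in \<open>n\<close>.\<close>

lemma mean_log_superadditive:
  assumes nm: "1 \<le> n" "1 \<le> m"
  shows "mean_log h n + h + mean_log h m \<le> mean_log h (n + m)"
proof -
  let ?Z = "\<lambda>u v \<omega>. path_sum p (site_weight h \<omega>) u v"
  have "mean_log h n + h + mean_log h m = (\<integral>\<omega>. ln (?Z 0 n \<omega>) + (h + \<omega> n) + ln (?Z n (n + m) \<omega>) \<partial>P)"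
    using ln_path_sum_integrable[of 0 n h] ln_path_sum_integrable[of n "n + m" h] coordinate_integrable(1)[of n]
      centered[of n] expectation_ln_path_sum[of 0 n h] expectation_ln_path_sum[of n "n + m" h] nm prob_space
    by simp
  also have "\<dots> \<le> (\<integral>\<omega>. ln (?Z 0 (n + m) \<omega>) \<partial>P)"
  proof (rule integral_mono)
    fix \<omega> :: "nat \<Rightarrow> real"
    have pos: "0 < ?Z 0 n \<omega>" "0 < ?Z n (n + m) \<omega>" by (simp_all add: path_sum_site_pos)
    have "ln (?Z 0 n \<omega> * site_weight h \<omega> n * ?Z n (n + m) \<omega>) \<le> ln (?Z 0 (n + m) \<omega>)"
      using pos path_sum_superadditive[of "site_weight h \<omega>" n m] nm by (intro ln_mono) auto
    thus "ln (?Z 0 n \<omega>) + (h + \<omega> n) + ln (?Z n (n + m) \<omega>) \<le> ln (?Z 0 (n + m) \<omega>)"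
      using pos by (simp add: ln_mult site_weight_def)
  qed (use nm ln_path_sum_integrable coordinate_integrable(1) in auto)
  also have "\<dots> = mean_log h (n + m)" using expectation_ln_path_sum[of 0 "n + m" h] nm by simp
  finally show ?thesis .
qed

lemma mean_log_le:
  assumes n: "1 \<le> n"
  shows "(mean_log h n + h) / real n \<le> 2 * ln 2 + 2 * \<bar>h\<bar> + (\<integral>\<omega>. \<bar>\<omega> 0\<bar> \<partial>P)"
proof -
  define k where "k = (\<integral>\<omega>. \<bar>\<omega> 0\<bar> \<partial>P)"
  have c: "(\<integral>\<omega>. \<bar>\<omega> a\<bar> \<partial>P) = k" for a
    using integral_shift[of "\<lambda>\<omega>. \<bar>\<omega> 0\<bar>" a] by (simp add: k_def)
  have c0: "0 \<le> k" by (simp add: k_def)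
  have "mean_log h n \<le> (\<integral>\<omega>. real (n + 1 - 0) * ln 2 + (\<Sum>a\<in>{0<..<n}. \<bar>h\<bar> + \<bar>\<omega> a\<bar>) \<partial>P)"
    unfolding mean_log_def
    by (rule integral_mono) (use n ln_path_sum_integrable ln_path_sum_le[of 0 n h] coordinate_integrable(1) in auto)
  also have "\<dots> = real (n + 1) * ln 2 + real (n - 1) * (\<bar>h\<bar> + k)"
    using coordinate_integrable(1) prob_space by (simp add: c)
  also have "\<dots> \<le> real (2 * n) * ln 2 + real n * (\<bar>h\<bar> + k)"
    by (intro add_mono mult_right_mono) (use n c0 in auto)
  finally have "mean_log h n + h \<le> real n * (2 * ln 2 + 2 * \<bar>h\<bar> + k)"
  proof -
    assume "mean_log h n \<le> real (2 * n) * ln 2 + real n * (\<bar>h\<bar> + k)"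
    moreover have "h \<le> real n * \<bar>h\<bar>" using n mult_right_mono[of 1 "real n" "\<bar>h\<bar>"] by simp
    ultimately show ?thesis by (simp add: algebra_simps)
  qed
  thus ?thesis using n by (simp add: pos_divide_le_eq mult.commute k_def)
qed

lemma mean_log_convergent: "convergent (\<lambda>n. (mean_log h n + h) / real n)"
proof (rule fekete_superadditive)
  show "(mean_log h m + h) + (mean_log h n + h) \<le> mean_log h (m + n) + h" if "1 \<le> m" "1 \<le> n" for m n
    using mean_log_superadditive[OF that, of h] by simp
qed (rule mean_log_le)

text \<open>Makes the free energy positive for large \<open>h\<close>, so that
  \<open>critical_point\<close> is the infimum of a nonempty set. The bound iterates superadditivity
  with unit steps.\<close>

lemma mean_log_lim_ge: "h + ln (p 1) \<le> lim (\<lambda>n. (mean_log h n + h) / real n)"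
proof -
  let ?s = "\<lambda>n. mean_log h n + h"
  have "ln (p 1) \<le> mean_log h 1"
  proof -
    have "(\<integral>\<omega>. ln (p 1) \<partial>P) \<le> (\<integral>\<omega>. ln (path_sum p (site_weight h \<omega>) 0 1) \<partial>P)"
    proof (rule integral_mono)
      fix \<omega>
      show "ln (p 1) \<le> ln (path_sum p (site_weight h \<omega>) 0 1)"
        using path_sum_ge[of "site_weight h \<omega>" 0 1] p_pos[of 1] by (intro ln_mono) auto
    qed (use ln_path_sum_integrable[of 0 1 h] in auto)
    thus ?thesis using prob_space by (simp add: mean_log_def)
  qed
  hence one: "h + ln (p 1) \<le> ?s 1" by simp
  have "real n * (h + ln (p 1)) \<le> ?s n" if "1 \<le> n" for n
    using that
  proof (induction n rule: dec_induct)
    case base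
    show ?case using one by simp
  next
    case (step n)
    thus ?case using mean_log_superadditive[of n 1 h] one by (simp add: distrib_right)
  qed
  hence "eventually (\<lambda>n. h + ln (p 1) \<le> ?s n / real n) sequentially"
    by (intro eventually_sequentiallyI[of 1]) (auto simp: pos_le_divide_eq mult.commute)
  thus ?thesis
    using mean_log_convergent[of h]
    by (intro tendsto_lowerbound[of "\<lambda>n. ?s n / real n"]) (auto simp: convergent_LIMSEQ_iff)
qed

text \<open>Half of the limit bounds the ratios from below for large \<open>n\<close>, and half of
  that is given up to absorb the constant \<open>h\<close>.\<close>

lemma mean_log_linear:
  assumes "0 < lim (\<lambda>n. (mean_log h n + h) / real n)"
  obtains f L where "0 < f" "\<And>m. L \<le> m \<Longrightarrow> f * real m \<le> mean_log h m"
proof -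
  define F where "F = lim (\<lambda>n. (mean_log h n + h) / real n)"
  have F: "0 < F" using assms by (simp add: F_def)
  have "(\<lambda>n. (mean_log h n + h) / real n) \<longlonglongrightarrow> F"
    using mean_log_convergent[of h] by (simp add: convergent_LIMSEQ_iff F_def)
  hence "eventually (\<lambda>n. F / 2 < (mean_log h n + h) / real n) sequentially"
    using F by (intro order_tendstoD(1)) auto
  then obtain n1 where n1: "\<And>n. n1 \<le> n \<Longrightarrow> F / 2 < (mean_log h n + h) / real n"
    unfolding eventually_sequentially by auto
  obtain n2 :: nat where n2: "4 * \<bar>h\<bar> / F < n2" using reals_Archimedean2 by blast
  show thesis
  proof (rule that[of "F / 4" "max 1 (max n1 n2)"])
    fix m assume m: "max 1 (max n1 n2) \<le> m"
    have "4 * \<bar>h\<bar> / F < real m" using n2 m by linarith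
    hence "\<bar>h\<bar> \<le> F / 4 * real m" using F by (simp add: field_simps)
    moreover have "F / 2 * real m < mean_log h m + h" using n1[of m] m by (simp add: pos_less_divide_eq)
    ultimately show "F / 4 * real m \<le> mean_log h m" by linarith
  qed (use F in simp)
qed

end

section \<open>Choice of the constants and conclusion\<close>

theorem corollary4p6:
  fixes M :: "'a measure" and T :: "nat \<Rightarrow> 'a \<Rightarrow> nat" and \<alpha> :: real and l :: "real \<Rightarrow> real"
    and P :: "(nat \<Rightarrow> real) measure" and H :: "real set"
  assumes "renewal_process M T \<alpha> l"
    and "gaussian_disorder P"
    and "closed H"
    and "H \<subseteq> {critical_point M T P<..}"
  shows "\<exists>C>0. \<exists>r>0. \<forall>n a b :: nat. 1 \<le> n \<longrightarrow> a \<le> b \<longrightarrow> b \<le> n \<longrightarrow>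
           (\<integral>\<^sup>+\<omega>. (SUP h\<in>H. ennreal (cov_ratio M T n h \<omega> a b)) \<partial>P)
             \<le> ennreal (C * exp (- r * (real b - real a)))"
proof (cases "H = {}")
  case True
  \<comment> \<open>The supremum over the empty set is 0.\<close>
  thus ?thesis by (intro exI[of _ "1 :: real"] conjI) (simp_all add: bot_ennreal)
next
  case False
  interpret renewal_process M T \<alpha> l by fact
  interpret D: gaussian_disorder P by fact
  let ?p = gap_prob
  interpret D: disordered_gap_law ?p P ..
  have free: "free_energy M T P h = lim (\<lambda>n. (D.mean_log h n + h) / real n)" for h
  proof -
    have "(\<integral>\<omega>. 1 / real n * ln (partition_function M T n h \<omega>) \<partial>P) = (D.mean_log h n + h) / real n" for n
    proof (cases "n = 0")
      case False
      hence n: "1 \<le> n" by simp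
      have "ln (partition_function M T n h \<omega>) = (h + \<omega> n) + ln (path_sum ?p (site_weight h \<omega>) 0 n)" for \<omega>
        using D.path_sum_site_pos[of 0 n h \<omega>]
        by (simp add: partition_function_eq[OF n] site_weight_def[abs_def] ln_mult)
      thus ?thesis
        using D.ln_path_sum_integrable[of 0 n h] D.coordinate_integrable(1)[of n] D.centered[of n] n D.prob_space
        by (simp add: D.mean_log_def)
    qed simp
    thus ?thesis by (simp only: free_energy_def)
  qed
  have ne: "{h. 0 < free_energy M T P h} \<noteq> {}"
    using D.mean_log_lim_ge[of "1 - ln (?p 1)"] by (auto simp: free intro!: exI[of _ "1 - ln (?p 1)"])
  obtain h1 where h1: "0 < free_energy M T P h1" "\<And>h. h \<in> H \<Longrightarrow> h1 \<le> h"
  proof -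
    have bdd: "bdd_below H" using assms(4) by (intro bdd_belowI[of _ "critical_point M T P"]) auto
    \<comment> \<open>Closedness puts the infimum of \<open>H\<close> strictly above the critical
      point, which leaves room for an \<open>h1\<close> of positive free energy below all of
      \<open>H\<close>.\<close>
    have "Inf H \<in> H" using closed_contains_Inf[OF False bdd assms(3)] .
    hence "Inf {h. 0 < free_energy M T P h} < Inf H" using assms(4) by (auto simp: critical_point_def)
    then obtain h1 where "0 < free_energy M T P h1" "h1 < Inf H" using cInf_lessD[OF ne] by blast
    moreover have "h1 \<le> h" if "h \<in> H" for h using cInf_lower[OF that bdd] \<open>h1 < Inf H\<close> by simp
    ultimately show thesis using that by blast
  qed
  obtain f L0 where f: "0 < f" "\<And>m. L0 \<le> m \<Longrightarrow> f * real m \<le> D.mean_log h1 m"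
    using D.mean_log_linear[of h1] h1(1) unfolding free by blast
  obtain d r where d: "0 < d" "d \<le> 1" "0 < r"
    and loc: "\<And>G. finite G \<Longrightarrow> disjoint_family_on (\<lambda>(u, v). {u..<v}) G \<Longrightarrow>
      (\<And>u v. (u, v) \<in> G \<Longrightarrow> u < v \<and> L0 < v - u) \<Longrightarrow>
      (\<integral>\<^sup>+\<omega>. ennreal ((\<Prod>(u, v)\<in>G. 1 / path_sum ?p (site_weight h1 \<omega>) u v) powr d) \<partial>P)
        \<le> ennreal (exp (- (r * (\<Sum>(u, v)\<in>G. real (v - u)))))"
    using D.localisation[OF f] by blast
  let ?S = "\<lambda>n L a b m \<omega>. gap_family_sum ?p (site_weight h1 \<omega>) n L a b m"
  obtain L where L: "1 \<le> L"
    and S1: "\<And>n a b. a \<le> b \<Longrightarrow> (\<integral>\<^sup>+\<omega>. ennreal (min 1 (?S n L a b (1 / 2 * real (b - a)) \<omega>)) \<partial>P)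
        \<le> ennreal (exp (r * (1 / 2) / 4) * exp (- (r * (1 / 2) / 4) * real (b - a)))"
    by (rule D.gap_family_sum_expectation[OF d(1,2,3) _ loc, of "1 / 2"]) auto
  \<comment> \<open>The share of \<open>b - a\<close> granted to low sites and, separately, to long
    gaps of the second path. It depends on \<open>L\<close>, so \<open>L'\<close> and
    \<open>w\<close> come after \<open>L\<close>, and \<open>c\<close> after both.\<close>
  define e where "e = 1 / (8 * real L)"
  have e: "0 < e" using L by (simp add: e_def)
  obtain L' where L': "1 \<le> L'"
    and S2: "\<And>n a b. a \<le> b \<Longrightarrow> (\<integral>\<^sup>+\<omega>. ennreal (min 1 (?S n L' a b (e * real (b - a)) \<omega>)) \<partial>P)
        \<le> ennreal (exp (r * e / 4) * exp (- (r * e / 4) * real (b - a)))"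
    by (rule D.gap_family_sum_expectation[OF d(1,2,3) e loc]) auto
  obtain w X where w: "0 < w" and Xm [measurable]: "\<And>a b. X a b \<in> borel_measurable P"
    and X: "\<And>a b \<omega>. of_bool (e * real (b - a) < real (card {y \<in> {a<..<b}. site_weight h1 \<omega> y < w})) \<le> (X a b \<omega> :: real)"
    and XI: "\<And>a b. (\<integral>\<^sup>+\<omega>. ennreal (X a b \<omega>) \<partial>P) \<le> ennreal (exp (- real (b - a)))"
    by (rule D.low_weight_sites[OF e, of h1]) blast
  \<comment> \<open>The least gap probability up to length \<open>L'\<close>; it makes
    \<open>c\<close> a uniform lower bound for the gain of an insertion.\<close>
  define pm where "pm = Min (?p ` {1..L'})"
  have pm: "0 < pm" unfolding pm_def using L' by (subst Min_gr_iff) (auto intro!: p_pos)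
  have pm_le: "pm \<le> ?p i" if "1 \<le> i" "i \<le> L'" for i unfolding pm_def using that by (intro Min_le) auto
  define c where "c = pm * pm * w"
  have c0: "0 < c" using pm w by (simp add: c_def)
  have c: "c \<le> ?p i * ?p j * w" if "1 \<le> i" "i \<le> L'" "1 \<le> j" "j \<le> L'" for i j
    unfolding c_def using pm pm_le[of i] pm_le[of j] p_pos[of i] that w by (intro mult_right_mono mult_mono) auto
  \<comment> \<open>Chosen so that \<open>(1 + c) powr (1 - m / (4 * L))\<close> equals
    \<open>(1 + c) * exp (- r1 * m)\<close>.\<close>
  define r1 where "r1 = ln (1 + c) / (4 * real L)"
  have r1: "0 < r1" using c0 L by (simp add: r1_def)
  define R where "R = min (min r1 1) (min (r * (1 / 2) / 4) (r * e / 4))"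
  have R: "0 < R" "R \<le> r1" "R \<le> 1" "R \<le> r * (1 / 2) / 4" "R \<le> r * e / 4"
    using r1 d e by (auto simp: R_def)
  define C where "C = (1 + c) + 1 + exp (r * (1 / 2) / 4) + exp (r * e / 4)"
  have C: "0 < C" using c0 by (simp add: C_def add_pos_pos)
  have decay: "k * exp (- s * m) \<le> k * exp (- R * m)" if "R \<le> s" "0 \<le> m" "0 \<le> k" for k s m :: real
    using that by (intro mult_left_mono) (auto intro: mult_right_mono)
  have "(\<integral>\<^sup>+\<omega>. (SUP h\<in>H. ennreal (cov_ratio M T n h \<omega> a b)) \<partial>P) \<le> ennreal (C * exp (- R * (real b - real a)))"
    if n: "1 \<le> n" and ab: "a \<le> b" "b \<le> n" for n a b
  proof -
    define m where "m = real (b - a)"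
    have m0: "0 \<le> m" by (simp add: m_def)
    have mab: "real b - real a = m" using ab by (simp add: m_def)
    let ?A = "(1 + c) powr (1 - m / (4 * real L))"
    let ?B = "\<lambda>\<omega>. min 1 (?S n L a b (1 / 2 * m) \<omega>)" and ?E = "\<lambda>\<omega>. min 1 (?S n L' a b (e * m) \<omega>)"
    have A: "?A = (1 + c) * exp (- r1 * m)"
    proof -
      have "?A = exp (ln (1 + c) + - r1 * m)"
        using c0 L by (simp add: powr_def r1_def algebra_simps)
      also have "\<dots> = (1 + c) * exp (- r1 * m)" using c0 by (simp only: exp_add) simp
      finally show ?thesis .
    qed
    have [measurable]: "?S n L a b x \<in> borel_measurable P" for L x
      unfolding gap_family_sum_def case_prod_unfold by measurable
    have S0: "0 \<le> ?S n L a b x \<omega>" for L x \<omega> by (rule gap_family_sum_nonneg) simp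
    have X0: "0 \<le> X a b \<omega>" for \<omega> using X[of b a \<omega>] by (smt (verit) of_bool_eq_iff zero_less_eq_of_bool)
    \<comment> \<open>The right side is free of \<open>h\<close>, since the site weights for
      \<open>h\<close> in \<open>H\<close> dominate those for \<open>h1\<close>; the supremum is
      bounded before integrating.\<close>
    have "(SUP h\<in>H. ennreal (cov_ratio M T n h \<omega> a b)) \<le> ennreal ?A + ennreal (X a b \<omega>) + ennreal (?B \<omega>) + ennreal (?E \<omega>)" for \<omega>
    proof (rule SUP_least)
      fix h assume h: "h \<in> H"
      have "cov_ratio M T n h \<omega> a b \<le> ?A + of_bool (m / (8 * real L) < real (card {y \<in> {a<..<b}. site_weight h1 \<omega> y < w}))
          + min 1 (?S n L a b (m / 2) \<omega>) + min 1 (?S n L' a b (m / (8 * real L)) \<omega>)"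
        using covariance_ratio_le[of "site_weight h1 \<omega>" "site_weight h \<omega>" a b n c L' w L m, OF _ _ ab less_imp_le[OF c0] c L m_def]
          h1(2)[OF h] ab
        unfolding cov_ratio_eq[OF n order_trans[OF ab] ab(2)] site_weight_def[abs_def] by simp
      also have "\<dots> \<le> ?A + X a b \<omega> + ?B \<omega> + ?E \<omega>"
        using X[of b a \<omega>] by (simp add: e_def m_def)
      finally have "ennreal (cov_ratio M T n h \<omega> a b) \<le> ennreal (?A + X a b \<omega> + ?B \<omega> + ?E \<omega>)" by (rule ennreal_leI)
      also have "\<dots> = ennreal ?A + ennreal (X a b \<omega>) + ennreal (?B \<omega>) + ennreal (?E \<omega>)"
        using X0 S0 by (simp add: ennreal_plus)
      finally show "ennreal (cov_ratio M T n h \<omega> a b) \<le> ennreal ?A + ennreal (X a b \<omega>) + ennreal (?B \<omega>) + ennreal (?E \<omega>)" .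
    qed
    hence "(\<integral>\<^sup>+\<omega>. (SUP h\<in>H. ennreal (cov_ratio M T n h \<omega> a b)) \<partial>P) \<le>
        (\<integral>\<^sup>+\<omega>. ennreal ?A + ennreal (X a b \<omega>) + ennreal (?B \<omega>) + ennreal (?E \<omega>) \<partial>P)"
      by (intro nn_integral_mono)
    also have "\<dots> = ennreal ?A + (\<integral>\<^sup>+\<omega>. ennreal (X a b \<omega>) \<partial>P) + (\<integral>\<^sup>+\<omega>. ennreal (?B \<omega>) \<partial>P) + (\<integral>\<^sup>+\<omega>. ennreal (?E \<omega>) \<partial>P)"
      using D.emeasure_space_1 by (simp add: nn_integral_add)
    also have "\<dots> \<le> ennreal ((1 + c) * exp (- R * m)) + ennreal (1 * exp (- R * m)) +
        ennreal (exp (r * (1 / 2) / 4) * exp (- R * m)) + ennreal (exp (r * e / 4) * exp (- R * m))"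
    proof (intro add_mono)
      show "ennreal ?A \<le> ennreal ((1 + c) * exp (- R * m))"
        unfolding A by (intro ennreal_leI decay R m0) (use c0 in simp)
      have "exp (- real (b - a)) \<le> 1 * exp (- R * m)" using decay[of 1 m 1] R m0 by (simp add: m_def)
      thus "(\<integral>\<^sup>+\<omega>. ennreal (X a b \<omega>) \<partial>P) \<le> ennreal (1 * exp (- R * m))"
        using XI[of a b] by (meson ennreal_leI order_trans)
      show "(\<integral>\<^sup>+\<omega>. ennreal (?B \<omega>) \<partial>P) \<le> ennreal (exp (r * (1 / 2) / 4) * exp (- R * m))"
        unfolding m_def by (rule order_trans[OF S1[OF ab(1)]], intro ennreal_leI decay R) simp_all
      show "(\<integral>\<^sup>+\<omega>. ennreal (?E \<omega>) \<partial>P) \<le> ennreal (exp (r * e / 4) * exp (- R * m))"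
        unfolding m_def by (rule order_trans[OF S2[OF ab(1)]], intro ennreal_leI decay R) simp_all
    qed
    also have "\<dots> = ennreal (C * exp (- R * m))"
      using c0 by (simp add: C_def distrib_right ennreal_plus[symmetric] del: ennreal_plus)
    finally show ?thesis unfolding mab .
  qed
  thus ?thesis using C R(1) by blast
qed

end
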